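(* Let $d\ge 2$, let $P$ be a finite set of $n$ points in general position in $\mathbb{R}^d$, and let $r$ be a positive integer with $r\le n$. Then the simplicial $r$-partition $\Pi_d(P,r)=\{(P_i,\Delta_i)\}_{i=1}^r$ yields only $O\!\left(r^{d+1-\frac{1}{d^4+d}}\right)$ loose families $\{\Delta_{i_1},\dots,\Delta_{i_{d+1}}\}\subseteq\Sigma_d(P,r)$ of $d+1$ simplices; the implicit constant depends only on $d$.
   Context: General position: no $d+1$ points on a common hyperplane. A simplicial $r$-partition of an $n$-point set $P$ is a collection $\{(P_i,\Delta_i)\}_{i=1}^r$ with $P=\bigsqcup P_i$, each nonempty $P_i$ satisfying $\lceil n/r\rceil\le|P_i|<2\lceil n/r\rceil$, and each $\Delta_i$ a closed $d$-simplex containing $P_i$ in its interior. $\Pi_d(P,r)$ denotes a fixed such partition in which every hyperplane intersects at most $c(d)r^{1-1/d}$ of the $\Delta_i$ ($c(d)$ depending only on $d$; such partitions exist by Matoušek's theorem), with the vertices of the simplices in general position; $\Sigma_d(P,r)=\{\Delta_1,\dots,\Delta_r\}$. A family of convex sets is separated if for every $2\le k\le d+1$ no $k$ members can all be intersected by a single $(k-2)$-flat. For a finite family $\mathcal{F}$ let $C(\mathcal{F})=\operatorname{conv}(\bigcup\mathcal{F})$. A separated family $\mathcal{K}=\{K_1,\dots,K_{d+1}\}$ of nonempty compact convex sets is tight if $\bigcap_{i=1}^{d+1}C(\mathcal{K}\setminus\{K_i\})=\emptyset$, and loose otherwise. *)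

theory Defs
  imports "HOL-Analysis.Analysis"
begin

definition hyperplane :: "(real ^ 'd) set \<Rightarrow> bool" where
  "hyperplane H \<longleftrightarrow> (\<exists>a b. a \<noteq> 0 \<and> H = {x. a \<bullet> x = b})"

definition general_position :: "(real ^ 'd) set \<Rightarrow> bool" where
  "general_position S \<longleftrightarrow>
     (\<forall>A. A \<subseteq> S \<and> card A = CARD('d) + 1 \<longrightarrow> \<not> (\<exists>H. hyperplane H \<and> A \<subseteq> H))"

definition flat :: "int \<Rightarrow> (real ^ 'd) set \<Rightarrow> bool" where
  "flat k A \<longleftrightarrow> affine A \<and> aff_dim A = k"

(* The parts Q i may be empty: the cardinality bounds apply to the nonempty ones only. *)
definition simplicial_partition ::
    "(real ^ 'd) set \<Rightarrow> nat \<Rightarrow> (nat \<Rightarrow> (real ^ 'd) set) \<Rightarrow> (nat \<Rightarrow> (real ^ 'd) set) \<Rightarrow> bool" where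
  "simplicial_partition P r Q \<Delta> \<longleftrightarrow>
     P = (\<Union>i\<in>{1..r}. Q i) \<and> disjoint_family_on Q {1..r} \<and>
     (\<forall>i\<in>{1..r}. Q i \<noteq> {} \<longrightarrow>
        \<lceil>real (card P) / real r\<rceil> \<le> int (card (Q i)) \<and>
        int (card (Q i)) < 2 * \<lceil>real (card P) / real r\<rceil>) \<and>
     (\<forall>i\<in>{1..r}. int CARD('d) simplex \<Delta> i \<and> Q i \<subseteq> interior (\<Delta> i))"

(* The simplicial r-partitions from which Pi_d(P, r) is chosen, with crossing constant c = c(d).
   The vertices of a simplex are its extreme points. *)
definition low_crossing_partition ::
    "real \<Rightarrow> (real ^ 'd) set \<Rightarrow> nat \<Rightarrow>
     (nat \<Rightarrow> (real ^ 'd) set) \<Rightarrow> (nat \<Rightarrow> (real ^ 'd) set) \<Rightarrow> bool" where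
  "low_crossing_partition c P r Q \<Delta> \<longleftrightarrow>
     simplicial_partition P r Q \<Delta> \<and>
     (\<forall>H. hyperplane H \<longrightarrow>
        real (card {i \<in> {1..r}. H \<inter> \<Delta> i \<noteq> {}}) \<le> c * real r powr (1 - 1 / real CARD('d))) \<and>
     general_position (\<Union>i\<in>{1..r}. {v. v extreme_point_of \<Delta> i})"

definition separated_family :: "(real ^ 'd) set set \<Rightarrow> bool" where
  "separated_family \<F> \<longleftrightarrow>
     (\<forall>K\<in>\<F>. convex K) \<and>
     (\<forall>k\<in>{2..CARD('d) + 1}. \<forall>\<G>. \<G> \<subseteq> \<F> \<and> card \<G> = k \<longrightarrow>
        \<not> (\<exists>A. flat (int k - 2) A \<and> (\<forall>K\<in>\<G>. K \<inter> A \<noteq> {})))"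

definition conv_family :: "(real ^ 'd) set set \<Rightarrow> (real ^ 'd) set" where
  "conv_family \<F> = convex hull (\<Union>\<F>)"

(* The families for which the dichotomy between tight and loose is defined. *)
definition separated_compact_family :: "(real ^ 'd) set set \<Rightarrow> bool" where
  "separated_compact_family \<K> \<longleftrightarrow>
     card \<K> = CARD('d) + 1 \<and> (\<forall>K\<in>\<K>. K \<noteq> {} \<and> compact K \<and> convex K) \<and> separated_family \<K>"

definition tight_family :: "(real ^ 'd) set set \<Rightarrow> bool" where
  "tight_family \<K> \<longleftrightarrow>
     separated_compact_family \<K> \<and> (\<Inter>K\<in>\<K>. conv_family (\<K> - {K})) = {}"

definition loose_family :: "(real ^ 'd) set set \<Rightarrow> bool" where
  "loose_family \<K> \<longleftrightarrow> separated_compact_family \<K> \<and> \<not> tight_family \<K>"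

end

theory Submission
  imports Defs "HOL-Computational_Algebra.Polynomial" "HOL-Library.Z2"
begin

text \<open>
  Choose \<open>d + 1\<close> of the \<open>r\<close> simplices with repetition, one for each of the \<open>d + 1\<close> colours in \<^typ>\<open>'d option\<close>,
  and let \<open>\<epsilon>\<close> be the fraction of the choices for which the \<open>d + 1\<close> facet hulls have a common point.
  Whether this holds depends, as a function of a single simplex, on the signs of boundedly many
  polynomials in its \<open>d\<^sup>2 + d\<close> vertex coordinates; hence a set of simplices that pairwise behave
  differently on a fraction \<open>\<delta>\<close> of the tuples has size \<open>N = O(\<delta> powr (- d\<^sup>3))\<close>. Clustering the simplices in
  each colour with \<open>\<delta>\<close> a small multiple of \<open>\<epsilon>\<close> gives a box, with sides of size at least of order \<open>\<epsilon> r / N\<close>,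
  in which almost all tuples are loose.
  If no hyperplane met more than a small fraction of a side, Gromov's topological selection argument
  would give a point \<open>y\<close> in the hull of one vertex per simplex for a positive fraction of the tuples of the box.
  For a loose tuple, the ray from a common point of the facet hulls through \<open>y\<close> shows
  that \<open>y\<close> lies in one of these hulls, so one of the simplices is crossed by a hyperplane spanned by \<open>y\<close> and
  vertices of the others, which is rare. Hence some hyperplane crosses a constant fraction of a side,
  and the crossing bound gives \<open>\<epsilon> r / N = O(r powr (1 - 1 / d))\<close>, that is,
  \<open>\<epsilon> ^ (d\<^sup>3 + 1) = O(r powr (- 1 / d))\<close>.
\<close>

section \<open>Polynomial functions and sign patterns\<close>

text \<open>Counting tuples with repetition makes the sides of a box independent of each other, and
  every loose family gives at least one loose tuple. That \<delta> must be proportional to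
  \<epsilon> comes from resampling: redrawing all entries of a random tuple inside their clusters
  changes looseness with probability O(\<delta>), hence O(\<delta> / \<epsilon>) for a typical loose
  tuple, and this has to stay below the density of non-loose tuples that selection guarantees. The
  packing bound naturally has exponent d^2 + d up to a logarithm; d^3 is a larger integer because d
  \<ge> 2, and d (d^3 + 1) = d^4 + d is the denominator in the theorem. The selection theorem has to
  cope with vertices in any position, even coinciding ones, so the grid is made generic and not the
  points. Its hypothesis on hyperplanes controls the grid cells of positive dimension: by
  compactness a small cell can be replaced by one point z, and faces with a missing colour whose
  affine hull contains z are rare if no hyperplane contains many points. Working mod 2 avoids
  orientations, and the constants depend only on the number of colours.\<close>

lemma homogeneous_system_solution:
  fixes M :: "'k \<Rightarrow> 'a \<Rightarrow> real"
  assumes "finite A" "finite K" "card A < card K"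
  shows "\<exists>c. (\<exists>k\<in>K. c k \<noteq> 0) \<and> (\<forall>a\<in>A. (\<Sum>k\<in>K. c k * M k a) = 0)"
  using assms
proof (induction A arbitrary: K M rule: finite_induct)
  case empty
  then obtain k where "k \<in> K" by fastforce
  then show ?case by (intro exI[of _ "\<lambda>_. 1"]) auto
next
  case (insert b A)
  show ?case
  proof (cases "\<forall>k\<in>K. M k b = 0")
    case True
    have "card A < card K" using insert by simp
    from insert.IH[OF insert.prems(1) this, of M] obtain c
      where "\<exists>k\<in>K. c k \<noteq> 0" "\<forall>a\<in>A. (\<Sum>k\<in>K. c k * M k a) = 0" by blast
    then show ?thesis using True by (intro exI[of _ c]) simp
  next
    case False
    then obtain k0 where k0: "k0 \<in> K" "M k0 b \<noteq> 0" by blast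
    define K' where "K' = K - {k0}"
    \<comment> \<open>Row reduction with pivot \<open>M k0 b\<close>: the unknown \<open>k0\<close>
      is eliminated from the other equations.\<close>
    define M' where "M' = (\<lambda>k a. M k a - M k b / M k0 b * M k0 a)"
    have "finite K'" "card A < card K'" using insert k0 by (auto simp: K'_def)
    from insert.IH[OF this, of M'] obtain c
      where c: "\<exists>k\<in>K'. c k \<noteq> 0" "\<forall>a\<in>A. (\<Sum>k\<in>K'. c k * M' k a) = 0" by blast
    define e where "e = - (\<Sum>k\<in>K'. c k * M k b) / M k0 b"
    define c' where "c' = c(k0 := e)"
    have K: "K = insert k0 K'" "k0 \<notin> K'" "finite K'"
      using k0 insert.prems by (auto simp: K'_def)
    have S: "(\<Sum>k\<in>K. c' k * M k a) = e * M k0 a + (\<Sum>k\<in>K'. c k * M k a)" for a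
    proof -
      have "(\<Sum>k\<in>K'. c' k * M k a) = (\<Sum>k\<in>K'. c k * M k a)"
        using K by (intro sum.cong) (auto simp: c'_def)
      then show ?thesis using K by (simp add: c'_def)
    qed
    have "(\<Sum>k\<in>K. c' k * M k a) = 0" if "a \<in> A" for a
    proof -
      have "0 = (\<Sum>k\<in>K'. c k * M' k a)" using c that by simp
      also have "\<dots> = (\<Sum>k\<in>K'. c k * M k a) - (\<Sum>k\<in>K'. c k * M k b) * (M k0 a / M k0 b)"
        by (simp add: M'_def algebra_simps sum_subtractf sum_distrib_left sum_divide_distrib)
      also have "\<dots> = (\<Sum>k\<in>K. c' k * M k a)"
        unfolding S by (simp add: e_def)
      finally show ?thesis by simp
    qed
    moreover have "(\<Sum>k\<in>K. c' k * M k b) = 0"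
      unfolding S using k0 by (simp add: e_def)
    moreover have "\<exists>k\<in>K. c' k \<noteq> 0" using c(1) K by (auto simp: c'_def)
    ultimately show ?thesis by (intro exI[of _ c']) auto
  qed
qed

lemma digit_sum_less:
  fixes d :: "nat \<Rightarrow> nat"
  assumes "\<And>j. j < D \<Longrightarrow> d j \<le> L"
  shows "(\<Sum>j<D. d j * Suc L ^ j) < Suc L ^ D"
  using assms
proof (induction D)
  case (Suc D)
  have "(\<Sum>j<Suc D. d j * Suc L ^ j) < Suc L ^ D + d D * Suc L ^ D"
    using Suc by (simp del: power_Suc)
  also have "\<dots> \<le> Suc L ^ D + L * Suc L ^ D" using Suc.prems[of D] by (intro add_left_mono mult_right_mono) auto
  finally show ?case by simp
qed simp

text \<open>The leading digit is the quotient by \<open>Suc L ^ D\<close>, since the lower digits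
  add up to less than that; remove it and induct.\<close>

lemma digit_sum_inject:
  fixes d e :: "nat \<Rightarrow> nat"
  assumes "\<And>j. j < D \<Longrightarrow> d j \<le> L" "\<And>j. j < D \<Longrightarrow> e j \<le> L"
    and "(\<Sum>j<D. d j * Suc L ^ j) = (\<Sum>j<D. e j * Suc L ^ j)" "j < D"
  shows "d j = e j"
  using assms
proof (induction D)
  case (Suc D)
  have q: "(\<Sum>j<Suc D. f j * Suc L ^ j) div Suc L ^ D = f D"
    if "\<And>j. j < Suc D \<Longrightarrow> f j \<le> L" for f :: "nat \<Rightarrow> nat"
    using digit_sum_less[of D f L] that by (simp del: power_Suc)
  have top: "d D = e D" using q[of d, OF Suc.prems(1)] q[of e, OF Suc.prems(2)] Suc.prems(3) by metis
  show ?case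
  proof (cases "j = D")
    case False
    then show ?thesis using Suc.IH Suc.prems top by (simp del: power_Suc)
  qed (use top in simp)
qed simp

section \<open>Polynomial functions with bounded degree in each variable\<close>

definition monom_fun :: "('v::finite \<Rightarrow> nat) \<Rightarrow> real ^ 'v \<Rightarrow> real" where
  "monom_fun a z = (\<Prod>v\<in>UNIV. z $ v ^ a v)"

definition exps :: "nat \<Rightarrow> ('v::finite \<Rightarrow> nat) set" where
  "exps n = {a. \<forall>v. a v \<le> n}"

text \<open>Bounding the degree in each variable separately makes the exponent vectors a box, so
  monomials are counted by the plain power \<open>Suc n ^ CARD('v)\<close>.\<close>

definition polyfun :: "nat \<Rightarrow> (real ^ 'v::finite \<Rightarrow> real) set" where
  "polyfun n = {g. \<exists>c. g = (\<lambda>z. \<Sum>a\<in>exps n. c a * monom_fun a z)}"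

lemma exps_eq_PiE: "exps n = (UNIV :: 'v::finite set) \<rightarrow>\<^sub>E {..n}"
  by (auto simp: exps_def PiE_def)

lemma finite_exps [simp]: "finite (exps n :: ('v::finite \<Rightarrow> nat) set)"
  unfolding exps_eq_PiE by (intro finite_PiE) auto

lemma card_exps: "card (exps n :: ('v::finite \<Rightarrow> nat) set) = Suc n ^ CARD('v)"
  unfolding exps_eq_PiE by (subst card_PiE) auto

lemma exps_mono: "n \<le> m \<Longrightarrow> exps n \<subseteq> exps m"
  by (auto simp: exps_def intro: order_trans)

lemma polyfunI: "(\<And>z. g z = (\<Sum>a\<in>exps n. c a * monom_fun a z)) \<Longrightarrow> g \<in> polyfun n"
  by (auto simp: polyfun_def)

lemma polyfunE:
  assumes "g \<in> polyfun n"
  obtains c where "\<And>z. g z = (\<Sum>a\<in>exps n. c a * monom_fun a z)"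
  using assms by (auto simp: polyfun_def)

lemma monom_fun_in_polyfun:
  assumes "a \<in> exps n" shows "monom_fun a \<in> polyfun n"
proof (rule polyfunI)
  show "monom_fun a z = (\<Sum>b\<in>exps n. (if b = a then 1 else 0) * monom_fun b z)" for z
  proof -
    have "(\<Sum>b\<in>exps n. (if b = a then 1 else 0) * monom_fun b z)
        = (\<Sum>b\<in>exps n. if b = a then monom_fun b z else 0)"
      by (intro sum.cong) auto
    then show ?thesis using assms by simp
  qed
qed

lemma polyfun_scale: "g \<in> polyfun n \<Longrightarrow> (\<lambda>z. k * g z) \<in> polyfun n"
proof (erule polyfunE)
  fix c assume "\<And>z. g z = (\<Sum>a\<in>exps n. c a * monom_fun a z)"
  then show ?thesis by (intro polyfunI[where c = "\<lambda>a. k * c a"]) (simp add: sum_distrib_left mult.assoc)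
qed

lemma polyfun_add: "g \<in> polyfun n \<Longrightarrow> h \<in> polyfun n \<Longrightarrow> (\<lambda>z. g z + h z) \<in> polyfun n"
proof (elim polyfunE)
  fix c e assume "\<And>z. g z = (\<Sum>a\<in>exps n. c a * monom_fun a z)"
    "\<And>z. h z = (\<Sum>a\<in>exps n. e a * monom_fun a z)"
  then show ?thesis
    by (intro polyfunI[where c = "\<lambda>a. c a + e a"]) (simp add: sum.distrib distrib_right)
qed

lemma polyfun_zero: "(\<lambda>z. 0) \<in> polyfun n"
  by (rule polyfunI[where c = "\<lambda>_. 0"]) simp

lemma polyfun_sum:
  "(\<And>i. i \<in> I \<Longrightarrow> g i \<in> polyfun n) \<Longrightarrow> (\<lambda>z. \<Sum>i\<in>I. g i z) \<in> polyfun n"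
  by (induction I rule: infinite_finite_induct) (auto intro: polyfun_add polyfun_zero)

lemma polyfun_mono:
  assumes "n \<le> m" shows "polyfun n \<subseteq> polyfun m"
proof
  fix g :: "real ^ 'v \<Rightarrow> real" assume "g \<in> polyfun n"
  then obtain c where "\<And>z. g z = (\<Sum>a\<in>exps n. c a * monom_fun a z)" by (rule polyfunE) blast
  then have "g = (\<lambda>z. \<Sum>a\<in>exps n. c a * monom_fun a z)" by auto
  moreover have "(\<lambda>z. \<Sum>a\<in>exps n. c a * monom_fun a z) \<in> polyfun m"
    using exps_mono[OF assms]
    by (intro polyfun_sum polyfun_scale monom_fun_in_polyfun) (auto dest: subsetD)
  ultimately show "g \<in> polyfun m" by simp
qed

lemma polyfun_const: "(\<lambda>z. k) \<in> polyfun n"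
proof -
  have "monom_fun (\<lambda>_. 0) \<in> polyfun n"
    by (rule monom_fun_in_polyfun) (simp add: exps_def)
  then have "(\<lambda>z. k * monom_fun (\<lambda>_. 0) z) \<in> polyfun n" by (rule polyfun_scale)
  then show ?thesis by (simp add: monom_fun_def)
qed

lemma polyfun_uminus: "g \<in> polyfun n \<Longrightarrow> (\<lambda>z. - g z) \<in> polyfun n"
  using polyfun_scale[of g n "-1"] by simp

lemma polyfun_diff: "g \<in> polyfun n \<Longrightarrow> h \<in> polyfun n \<Longrightarrow> (\<lambda>z. g z - h z) \<in> polyfun n"
  using polyfun_add[of g n "\<lambda>z. - h z"] polyfun_uminus[of h n] by simp

lemma polyfun_coordinate:
  fixes v :: "'v::finite"
  shows "(\<lambda>z. z $ v) \<in> polyfun (Suc n)"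
proof -
  have "monom_fun (\<lambda>w. if w = v then 1 else 0) \<in> polyfun (Suc n)"
    by (rule monom_fun_in_polyfun) (simp add: exps_def)
  moreover have "monom_fun (\<lambda>w. if w = v then 1 else 0) z = z $ v" for z :: "real ^ 'v"
  proof -
    have "monom_fun (\<lambda>w. if w = v then 1 else 0) z = (\<Prod>w\<in>UNIV. if w = v then z $ w else 1)"
      unfolding monom_fun_def by (intro prod.cong) auto
    then show ?thesis by simp
  qed
  then have "(\<lambda>z :: real ^ 'v. z $ v) = monom_fun (\<lambda>w. if w = v then 1 else 0)" by auto
  ultimately show ?thesis by simp
qed

lemma monom_fun_add: "monom_fun (\<lambda>v. a v + b v) z = monom_fun a z * monom_fun b z"
  by (simp add: monom_fun_def power_add prod.distrib)

lemma polyfun_mult: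
  assumes "g \<in> polyfun n" "h \<in> polyfun m"
  shows "(\<lambda>z. g z * h z) \<in> polyfun (n + m)"
proof -
  obtain c where c: "\<And>z. g z = (\<Sum>a\<in>exps n. c a * monom_fun a z)" using assms(1) by (rule polyfunE) blast
  obtain e where e: "\<And>z. h z = (\<Sum>a\<in>exps m. e a * monom_fun a z)" using assms(2) by (rule polyfunE) blast
  have "g z * h z = (\<Sum>a\<in>exps n. \<Sum>b\<in>exps m. (c a * e b) * monom_fun (\<lambda>v. a v + b v) z)" for z
    by (simp add: c e sum_product monom_fun_add mult_ac)
  moreover have "(\<lambda>z. \<Sum>a\<in>exps n. \<Sum>b\<in>exps m. (c a * e b) * monom_fun (\<lambda>v. a v + b v) z) \<in> polyfun (n + m)"
    by (intro polyfun_sum polyfun_scale monom_fun_in_polyfun) (auto simp: exps_def add_mono)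
  ultimately show ?thesis by presburger
qed

lemma polyfun_prod:
  assumes "finite I" "\<And>i. i \<in> I \<Longrightarrow> g i \<in> polyfun n"
  shows "(\<lambda>z. \<Prod>i\<in>I. g i z) \<in> polyfun (card I * n)"
  using assms
  by (induction I rule: finite_induct) (auto intro: polyfun_const polyfun_mult)

lemma polyfun_power:
  assumes "g \<in> polyfun n" shows "(\<lambda>z. g z ^ k) \<in> polyfun (k * n)"
  by (induction k) (auto intro: polyfun_const polyfun_mult assms)

lemma continuous_polyfun:
  assumes "g \<in> polyfun n" shows "continuous_on S g"
proof -
  obtain c where c: "\<And>z. g z = (\<Sum>a\<in>exps n. c a * monom_fun a z)" using assms by (rule polyfunE) blast
  have "g = (\<lambda>z. \<Sum>a\<in>exps n. c a * (\<Prod>v\<in>UNIV. z $ v ^ a v))" by (auto simp: c monom_fun_def)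
  then show ?thesis by (auto intro!: continuous_intros)
qed

lemma polyfun_partial_derivative:
  fixes g :: "real ^ 'v::finite \<Rightarrow> real"
  assumes "g \<in> polyfun n"
  shows "\<exists>g'\<in>polyfun n. \<forall>z. ((\<lambda>s. g (z + s *\<^sub>R axis v 1)) has_real_derivative g' z) (at 0)"
proof -
  obtain c where c: "\<And>z. g z = (\<Sum>a\<in>exps n. c a * monom_fun a z)" using assms by (rule polyfunE) blast
  have M: "\<exists>m'\<in>polyfun n. \<forall>z. ((\<lambda>s. monom_fun a (z + s *\<^sub>R axis v 1)) has_real_derivative m' z) (at 0)"
    if "a \<in> exps n" for a
  proof -
    \<comment> \<open>If \<open>a v = 0\<close>, the truncated \<open>a v - 1\<close> does no harm
      because of the factor \<open>real (a v)\<close>.\<close>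
    define m' where "m' = (\<lambda>z. real (a v) * monom_fun (a(v := a v - 1)) z)"
    have "m' \<in> polyfun n" unfolding m'_def
    proof (intro polyfun_scale monom_fun_in_polyfun)
      show "a(v := a v - 1) \<in> exps n"
      proof -
        have "a w \<le> n" for w using that by (simp add: exps_def)
        then show ?thesis by (auto simp: exps_def le_diff_conv intro: le_SucI trans_le_add1)
      qed
    qed
    moreover have "((\<lambda>s. monom_fun a (z + s *\<^sub>R axis v 1)) has_real_derivative m' z) (at 0)" for z
    proof -
      define k where "k = (\<Prod>w\<in>UNIV - {v}. z $ w ^ a w)"
      have e: "monom_fun b (z + s *\<^sub>R axis v 1) = (z $ v + s) ^ b v * k"
        if "\<And>w. w \<noteq> v \<Longrightarrow> b w = a w" for b s
      proof -
        have "monom_fun b (z + s *\<^sub>R axis v 1)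
            = (z + s *\<^sub>R axis v 1) $ v ^ b v * (\<Prod>w\<in>UNIV - {v}. (z + s *\<^sub>R axis v 1) $ w ^ b w)"
          unfolding monom_fun_def by (subst prod.remove[of _ v]) auto
        also have "(\<Prod>w\<in>UNIV - {v}. (z + s *\<^sub>R axis v 1) $ w ^ b w) = k"
          unfolding k_def by (intro prod.cong) (auto simp: axis_def that)
        finally show ?thesis by (simp add: axis_def)
      qed
      have "((\<lambda>s. (z $ v + s) ^ a v * k) has_real_derivative real (a v) * (z $ v) ^ (a v - 1) * k) (at 0)"
        by (auto intro!: derivative_eq_intros)
      moreover have "m' z = real (a v) * (z $ v) ^ (a v - 1) * k"
        using e[of "a(v := a v - 1)" 0] by (simp add: m'_def)
      ultimately show ?thesis by (simp add: e)
    qed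
    ultimately show ?thesis by blast
  qed
  define m where "m a = (SOME m'. m' \<in> polyfun n \<and>
    (\<forall>z. ((\<lambda>s. monom_fun a (z + s *\<^sub>R axis v 1)) has_real_derivative m' z) (at 0)))" for a
  have m: "m a \<in> polyfun n"
    "((\<lambda>s. monom_fun a (z + s *\<^sub>R axis v 1)) has_real_derivative m a z) (at 0)"
    if "a \<in> exps n" for a z
    using someI_ex[of "\<lambda>m'. m' \<in> polyfun n \<and>
      (\<forall>z. ((\<lambda>s. monom_fun a (z + s *\<^sub>R axis v 1)) has_real_derivative m' z) (at 0))"] M[OF that]
    unfolding m_def by blast+
  define g' where "g' = (\<lambda>z. \<Sum>a\<in>exps n. c a * m a z)"
  have "g' \<in> polyfun n" unfolding g'_def by (intro polyfun_sum polyfun_scale m)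
  moreover have "((\<lambda>s. g (z + s *\<^sub>R axis v 1)) has_real_derivative g' z) (at 0)" for z
    unfolding c g'_def by (intro DERIV_sum DERIV_cmult m)
  ultimately show ?thesis by blast
qed

text \<open>\<open>h\<close> and the \<open>D v\<close> are one more polynomial than there are
  variables, so they are algebraically dependent. With
  \<open>t = (CARD('v) * n + 1) ^ CARD('v)\<close> there are \<open>Suc t ^ CARD('v) * Suc t\<close>
  products with exponents up to \<open>t\<close>, but at most \<open>Suc t ^ CARD('v) * t\<close>
  monomials for them to use. The degree \<open>t\<close> in \<open>h\<close> will bound the number
  of points in a fibre.\<close>

lemma polyfun_common_relation:
  fixes h :: "real ^ 'v::finite \<Rightarrow> real" and D :: "'v \<Rightarrow> real ^ 'v \<Rightarrow> real"
  assumes h: "h \<in> polyfun 1" and D: "\<And>v. D v \<in> polyfun n"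
  shows "\<exists>c. (\<exists>i\<le>(CARD('v) * n + 1) ^ CARD('v). \<exists>b\<in>exps ((CARD('v) * n + 1) ^ CARD('v)). c i b \<noteq> 0) \<and>
    (\<forall>z. (\<Sum>i\<le>(CARD('v) * n + 1) ^ CARD('v). \<Sum>b\<in>exps ((CARD('v) * n + 1) ^ CARD('v)).
      c i b * (h z ^ i * (\<Prod>v\<in>UNIV. D v z ^ b v))) = 0)"
proof -
  define t where "t = (CARD('v) * n + 1) ^ CARD('v)"
  define N where "N = t + CARD('v) * (t * n)"
  define \<Phi> where "\<Phi> = (\<lambda>k z. h z ^ fst k * (\<Prod>v\<in>UNIV. D v z ^ (snd k v)))"
  define K where "K = {..t} \<times> (exps t :: ('v \<Rightarrow> nat) set)"
  have "\<exists>M. \<forall>z. \<Phi> k z = (\<Sum>a\<in>exps N. M a * monom_fun a z)" if "k \<in> K" for k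
  proof -
    have "(\<lambda>z. h z ^ fst k) \<in> polyfun t"
      using polyfun_power[OF h, of "fst k"] polyfun_mono[of "fst k" t] that
      by (auto simp: K_def)
    moreover have "(\<lambda>z. D v z ^ (snd k v)) \<in> polyfun (t * n)" for v
    proof -
      have "snd k v * n \<le> t * n" using that by (auto simp: K_def exps_def)
      then show ?thesis using polyfun_power[OF D[of v], of "snd k v"] polyfun_mono by blast
    qed
    then have "(\<lambda>z. \<Prod>v\<in>UNIV. D v z ^ (snd k v)) \<in> polyfun (CARD('v) * (t * n))"
      by (intro polyfun_prod) auto
    ultimately have "\<Phi> k \<in> polyfun N"
      unfolding \<Phi>_def N_def by (rule polyfun_mult)
    then show ?thesis by (auto simp: polyfun_def)
  qed
  then have "\<exists>M. \<forall>k\<in>K. \<forall>z. \<Phi> k z = (\<Sum>a\<in>exps N. M k a * monom_fun a z)" by (intro bchoice) blast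
  then obtain M where M: "\<And>k z. k \<in> K \<Longrightarrow> \<Phi> k z = (\<Sum>a\<in>exps N. M k a * monom_fun a z)" by blast
  have le: "Suc N \<le> Suc t * (CARD('v) * n + 1)" by (simp add: N_def algebra_simps)
  have "card (exps N :: ('v \<Rightarrow> nat) set) \<le> (Suc t * (CARD('v) * n + 1)) ^ CARD('v)"
    unfolding card_exps by (rule power_mono[OF le]) simp
  also have "\<dots> = Suc t ^ CARD('v) * t" by (simp only: power_mult_distrib t_def)
  also have "\<dots> < Suc t ^ CARD('v) * Suc t" by simp
  also have "\<dots> = card K" by (simp add: K_def card_cartesian_product card_exps)
  finally have "card (exps N :: ('v \<Rightarrow> nat) set) < card K" .
  moreover have "finite K" by (simp add: K_def)
  ultimately obtain c where c: "\<exists>k\<in>K. c k \<noteq> 0" "\<forall>a\<in>exps N. (\<Sum>k\<in>K. c k * M k a) = 0"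
    using homogeneous_system_solution[of "exps N" K M] by auto
  have "(\<Sum>k\<in>K. c k * \<Phi> k z) = 0" for z
  proof -
    have "(\<Sum>k\<in>K. c k * \<Phi> k z) = (\<Sum>k\<in>K. \<Sum>a\<in>exps N. c k * M k a * monom_fun a z)"
      by (intro sum.cong refl) (simp add: M sum_distrib_left mult.assoc)
    also have "\<dots> = (\<Sum>a\<in>exps N. (\<Sum>k\<in>K. c k * M k a) * monom_fun a z)"
      by (subst sum.swap) (simp add: sum_distrib_right)
    finally show ?thesis using c(2) by simp
  qed
  then have "(\<Sum>i\<le>t. \<Sum>b\<in>exps t. c (i, b) * (h z ^ i * (\<Prod>v\<in>UNIV. D v z ^ b v))) = 0" for z
    by (simp add: K_def \<Phi>_def sum.cartesian_product case_prod_beta)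
  moreover have "\<exists>i\<le>t. \<exists>b\<in>exps t. c (i, b) \<noteq> 0" using c(1) by (auto simp: K_def)
  ultimately show ?thesis unfolding t_def by (intro exI[of _ "\<lambda>i b. c (i, b)"]) auto
qed

text \<open>Kronecker substitution: with powers of \<open>Suc t\<close> as weights, replacing
  variable \<open>v\<close> by \<open>s ^ w v\<close> keeps monomials with exponents up to
  \<open>t\<close> distinct. Positive weights let the substituted point tend to 0 with
  \<open>s\<close>.\<close>

lemma exists_weight_vector:
  "\<exists>w :: 'v::finite \<Rightarrow> nat. (\<forall>v. w v > 0) \<and> inj_on (\<lambda>b. \<Sum>v\<in>UNIV. w v * b v) (exps t)"
proof -
  obtain e :: "'v \<Rightarrow> nat" where e: "bij_betw e UNIV {..<CARD('v)}"
    using ex_bij_betw_finite_nat[of "UNIV :: 'v set"] by (auto simp: atLeast0LessThan)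
  define w where "w v = Suc t ^ e v" for v
  have "b = b'" if "b \<in> exps t" "b' \<in> exps t"
    and eq: "(\<Sum>v\<in>UNIV. w v * b v) = (\<Sum>v\<in>UNIV. w v * b' v)" for b b'
  proof
    fix v
    define f where "f = inv_into UNIV e"
    have f: "f (e v) = v" for v using e by (simp add: f_def bij_betw_def)
    have S: "(\<Sum>v\<in>UNIV. w v * c v) = (\<Sum>j<CARD('v). c (f j) * Suc t ^ j)" for c :: "'v \<Rightarrow> nat"
    proof -
      have "(\<Sum>v\<in>UNIV. w v * c v) = (\<Sum>v\<in>UNIV. c (f (e v)) * Suc t ^ e v)"
        by (simp add: w_def f mult.commute)
      also have "\<dots> = (\<Sum>j<CARD('v). c (f j) * Suc t ^ j)" by (rule sum.reindex_bij_betw[OF e])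
      finally show ?thesis .
    qed
    have "e v < CARD('v)" using e by (auto simp: bij_betw_def)
    then have "b (f (e v)) = b' (f (e v))"
      using eq that(1,2) unfolding S
      by (intro digit_sum_inject[of "CARD('v)" "\<lambda>j. b (f j)" t "\<lambda>j. b' (f j)" "e v"]) (auto simp: exps_def)
    then show "b v = b' v" by (simp add: f)
  qed
  then have "inj_on (\<lambda>b. \<Sum>v\<in>UNIV. w v * b v) (exps t)" by (auto intro: inj_onI)
  then show ?thesis by (intro exI[of _ w]) (auto simp: w_def)
qed

lemma poly_of_enumerated_coefficients:
  fixes e :: "'v::finite \<Rightarrow> nat"
  assumes "inj e" "z \<noteq> (0 :: real ^ 'v)"
  defines "p \<equiv> (\<Sum>v\<in>UNIV. monom (z $ v) (e v))"
  shows "p \<noteq> 0" "poly p x = (\<Sum>v\<in>UNIV. x ^ e v * z $ v)"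
proof -
  obtain v where v: "z $ v \<noteq> 0" using assms(2) by (auto simp: vec_eq_iff)
  have "coeff p (e v) = (\<Sum>w\<in>UNIV. if w = v then z $ w else 0)"
    unfolding p_def coeff_sum using assms(1) by (intro sum.cong) (auto simp: inj_eq)
  then show "p \<noteq> 0" using v by auto
  show "poly p x = (\<Sum>v\<in>UNIV. x ^ e v * z $ v)"
    by (simp add: p_def poly_sum poly_monom mult.commute)
qed

lemma finite_zeros_enumerated:
  fixes e :: "'v::finite \<Rightarrow> nat"
  assumes "inj e" "z \<noteq> (0 :: real ^ 'v)" "\<And>v. e v < D"
  shows "finite {x. (\<Sum>v\<in>UNIV. x ^ e v * z $ v) = 0}"
    and "card {x. (\<Sum>v\<in>UNIV. x ^ e v * z $ v) = 0} \<le> D"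
proof -
  define p where "p = (\<Sum>v\<in>UNIV. monom (z $ v) (e v))"
  have p: "p \<noteq> 0" "\<And>x. poly p x = (\<Sum>v\<in>UNIV. x ^ e v * z $ v)"
    using poly_of_enumerated_coefficients[OF assms(1,2)] by (auto simp: p_def)
  have "degree p \<le> D" unfolding p_def
    by (intro degree_sum_le) (auto intro: order_trans[OF degree_monom_le less_imp_le[OF assms(3)]])
  then show "finite {x. (\<Sum>v\<in>UNIV. x ^ e v * z $ v) = 0}"
    "card {x. (\<Sum>v\<in>UNIV. x ^ e v * z $ v) = 0} \<le> D"
    using poly_roots_finite[OF p(1)] card_poly_roots_bound[OF p(1)] by (auto simp: p(2))
qed

text \<open>The directions lie on the moment curve. Two distinct points have equal images for at
  most \<open>D\<close> values of \<open>k\<close>, the roots of a nonzero polynomial, so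
  \<open>K + 1\<close> candidates are enough for all pairs at once.\<close>

lemma exists_separating_direction:
  fixes Z :: "(real ^ 'v::finite) set" and e :: "'v \<Rightarrow> nat"
  assumes "finite Z" "inj e" "\<And>v. e v < D" "card Z * card Z * D \<le> K"
  shows "\<exists>k\<le>K. inj_on (\<lambda>z. \<Sum>v\<in>UNIV. real k ^ e v * z $ v) Z"
proof (rule ccontr)
  assume neg: "\<not> ?thesis"
  define B where "B p = {k. k \<le> K \<and> (\<Sum>v\<in>UNIV. real k ^ e v * (fst p - snd p) $ v) = 0}" for p
  define P where "P = {p \<in> Z \<times> Z. fst p \<noteq> snd p}"
  have B: "card (B p) \<le> D" if "p \<in> P" for p
  proof -
    have nz: "fst p - snd p \<noteq> 0" using that by (auto simp: P_def)
    have "card (B p) = card (real ` B p)" by (simp add: card_image)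
    also have "\<dots> \<le> card {x. (\<Sum>v\<in>UNIV. x ^ e v * (fst p - snd p) $ v) = 0}"
      by (rule card_mono[OF finite_zeros_enumerated(1)[OF assms(2) nz assms(3)]]) (auto simp: B_def)
    also have "\<dots> \<le> D" by (rule finite_zeros_enumerated(2)[OF assms(2) nz assms(3)])
    finally show ?thesis .
  qed
  have fP: "finite P" unfolding P_def using assms(1) by simp
  have "{..K} \<subseteq> (\<Union>p\<in>P. B p)"
  proof
    fix k assume "k \<in> {..K}"
    with neg have "\<not> inj_on (\<lambda>z. \<Sum>v\<in>UNIV. real k ^ e v * z $ v) Z" by blast
    then obtain z z' where z: "z \<in> Z" "z' \<in> Z" "z \<noteq> z'"
      and eq: "(\<Sum>v\<in>UNIV. real k ^ e v * z $ v) = (\<Sum>v\<in>UNIV. real k ^ e v * z' $ v)"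
      unfolding inj_on_def by blast
    have "(\<Sum>v\<in>UNIV. real k ^ e v * (z - z') $ v) = 0"
      using eq by (simp add: right_diff_distrib sum_subtractf)
    then have "(z, z') \<in> P" "k \<in> B (z, z')" using \<open>k \<in> {..K}\<close> z by (simp_all add: P_def B_def)
    then show "k \<in> (\<Union>p\<in>P. B p)" by blast
  qed
  moreover have "finite (B p)" for p by (rule finite_subset[of _ "{..K}"]) (simp_all add: B_def subset_iff)
  then have "finite (\<Union>p\<in>P. B p)" using fP by blast
  ultimately have "card {..K} \<le> card (\<Union>p\<in>P. B p)" by (intro card_mono)
  then have "Suc K \<le> card (\<Union>p\<in>P. B p)" by simp
  also have "\<dots> \<le> (\<Sum>p\<in>P. card (B p))" by (rule card_UN_le[OF fP])
  also have "\<dots> \<le> card P * D" using sum_bounded_above[of P "\<lambda>p. card (B p)" D, OF B] by (simp only: of_nat_id)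
  also have "\<dots> \<le> card (Z \<times> Z) * D"
    using assms(1) by (intro mult_right_mono card_mono finite_cartesian_product) (auto simp only: P_def)
  also have "\<dots> \<le> K" using assms(4) by (simp add: card_cartesian_product)
  finally show False by simp
qed

text \<open>A linear form that is injective on the fibre over some \<open>a\<close> takes \<open>card X\<close> values there, all of them
  roots of the one-variable polynomial obtained from the common relation at \<open>a\<close>. The weights keep
  this polynomial from vanishing.\<close>

lemma card_le_of_polynomial_fibres:
  fixes D :: "'v \<Rightarrow> real ^ 'v::finite \<Rightarrow> real" and X :: "'x set"
  assumes "finite X" and D: "\<And>v. D v \<in> polyfun n" and "\<delta> > 0"
    and fib: "\<And>a. norm a < \<delta> \<Longrightarrow> \<exists>\<zeta>. inj_on \<zeta> X \<and> (\<forall>x\<in>X. \<forall>v. D v (\<zeta> x) = a $ v)"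
  shows "card X \<le> (CARD('v) * n + 1) ^ CARD('v)"
proof (rule ccontr)
  assume neg: "\<not> ?thesis"
  define t where "t = (CARD('v) * n + 1) ^ CARD('v)"
  obtain e :: "'v \<Rightarrow> nat" where e: "bij_betw e UNIV {..<CARD('v)}"
    using ex_bij_betw_finite_nat[of "UNIV :: 'v set"] by (auto simp: atLeast0LessThan)
  then have e': "inj e" "\<And>v. e v < CARD('v)" by (auto simp: bij_betw_def)
  obtain w :: "'v \<Rightarrow> nat" where w: "\<And>v. w v > 0" "inj_on (\<lambda>b. \<Sum>v\<in>UNIV. w v * b v) (exps t)"
    using exists_weight_vector by blast
  \<comment> \<open>The pool of directions must be finite: the fibre, and with it the separating
    \<open>k\<close>, is known only after \<open>s\<close> is fixed, so \<open>s\<close> has to suit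
    every \<open>k \<le> K\<close>.\<close>
  define K where "K = card X * card X * CARD('v)"
  define h where "h k z = (\<Sum>v\<in>UNIV. real k ^ e v * z $ v)" for k and z :: "real ^ 'v"
  have "h k \<in> polyfun 1" for k
    unfolding h_def using polyfun_coordinate[of _ 0] by (intro polyfun_sum polyfun_scale) simp
  then have "\<exists>c. (\<exists>i\<le>t. \<exists>b\<in>exps t. c i b \<noteq> 0) \<and>
    (\<forall>z. (\<Sum>i\<le>t. \<Sum>b\<in>exps t. c i b * (h k z ^ i * (\<Prod>v\<in>UNIV. D v z ^ b v))) = 0)" for k
    unfolding t_def using polyfun_common_relation D by blast
  then have "\<exists>c. \<forall>k. (\<exists>i\<le>t. \<exists>b\<in>exps t. c k i b \<noteq> 0) \<and>
    (\<forall>z. (\<Sum>i\<le>t. \<Sum>b\<in>exps t. c k i b * (h k z ^ i * (\<Prod>v\<in>UNIV. D v z ^ b v))) = 0)"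
    by (intro choice) blast
  then obtain c where c: "\<And>k. \<exists>i\<le>t. \<exists>b\<in>exps t. c k i b \<noteq> 0"
    "\<And>k z. (\<Sum>i\<le>t. \<Sum>b\<in>exps t. c k i b * (h k z ^ i * (\<Prod>v\<in>UNIV. D v z ^ b v))) = 0" by blast
  \<comment> \<open>\<open>i0 k\<close> is a power of \<open>h k\<close> whose coefficient is a
    nonzero polynomial in the values of \<open>D\<close>; along the curve \<open>a s\<close> this
    coefficient becomes the one-variable polynomial \<open>q k\<close>.\<close>
  have "\<exists>i0. \<forall>k. i0 k \<le> t \<and> (\<exists>b\<in>exps t. c k (i0 k) b \<noteq> 0)"
    by (intro choice allI) (use c(1) in blast)
  then obtain i0 where i0: "\<And>k. i0 k \<le> t" "\<And>k. \<exists>b\<in>exps t. c k (i0 k) b \<noteq> 0" by blast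
  define E where "E b = (\<Sum>v\<in>UNIV. w v * b v)" for b
  define q where "q k = (\<Sum>b\<in>exps t. monom (c k (i0 k) b) (E b))" for k
  have q0: "q k \<noteq> 0" for k
  proof -
    obtain b where b: "b \<in> exps t" "c k (i0 k) b \<noteq> 0" using i0(2) by blast
    have "coeff (q k) (E b) = (\<Sum>b'\<in>exps t. if b' = b then c k (i0 k) b' else 0)"
      unfolding q_def coeff_sum using w(2) b(1) by (intro sum.cong) (auto simp: inj_on_def E_def)
    then show ?thesis using b by auto
  qed
  define a where "a s = (\<chi> v. s ^ w v)" for s :: real
  have "(a \<longlongrightarrow> a 0) (at 0)"
    by (rule vec_tendstoI) (simp add: a_def tendsto_power[OF tendsto_ident_at])
  then have "((\<lambda>s. norm (a s)) \<longlongrightarrow> norm (a 0)) (at 0)" by (rule tendsto_norm)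
  moreover have "a 0 = 0" using w(1) by (auto simp: a_def vec_eq_iff)
  ultimately have "eventually (\<lambda>s. norm (a s) < \<delta>) (at 0)"
    using \<open>\<delta> > 0\<close> by (intro order_tendstoD(2)[of _ "norm (a 0)"]) simp_all
  then obtain s0 where s0: "s0 > 0" "\<And>s. 0 < s \<Longrightarrow> s < s0 \<Longrightarrow> norm (a s) < \<delta>"
    unfolding eventually_at by (auto simp: dist_real_def)
  have "finite (\<Union>k\<in>{..K}. {s. poly (q k) s = 0})" using poly_roots_finite[OF q0] by auto
  moreover have "infinite {0<..<s0}" using s0(1) by simp
  ultimately have "\<not> {0<..<s0} \<subseteq> (\<Union>k\<in>{..K}. {s. poly (q k) s = 0})" using finite_subset by blast
  then obtain s where s': "s \<in> {0<..<s0}" "s \<notin> (\<Union>k\<in>{..K}. {s. poly (q k) s = 0})" by blast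
  then have s: "0 < s" "s < s0" "\<And>k. k \<le> K \<Longrightarrow> poly (q k) s \<noteq> 0" by auto
  obtain \<zeta> where z: "inj_on \<zeta> X" "\<And>x v. x \<in> X \<Longrightarrow> D v (\<zeta> x) = a s $ v"
    using fib[OF s0(2)[OF s(1,2)]] by blast
  obtain k where k: "k \<le> K" "inj_on (h k) (\<zeta> ` X)"
    using exists_separating_direction[of "\<zeta> ` X" e "CARD('v)" K] e' assms(1) z(1)
    by (auto simp: h_def[abs_def] K_def card_image)
  define Q where "Q = (\<Sum>i\<le>t. monom (\<Sum>b\<in>exps t. c k i b * (\<Prod>v\<in>UNIV. (a s $ v) ^ b v)) i)"
  have pe: "(\<Prod>v\<in>UNIV. (a s $ v) ^ b v) = s ^ E b" for b
    by (simp add: a_def E_def power_mult power_sum)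
  have "coeff Q (i0 k) = poly (q k) s"
    using i0(1)[of k] by (simp add: Q_def coeff_sum q_def poly_sum poly_monom pe)
  then have Q0: "Q \<noteq> 0" using s(3)[OF k(1)] by auto
  have "degree Q \<le> t" unfolding Q_def by (intro degree_sum_le) (auto intro: order_trans[OF degree_monom_le])
  moreover have "poly Q (h k (\<zeta> x)) = 0" if "x \<in> X" for x
  proof -
    have "poly Q (h k (\<zeta> x))
        = (\<Sum>i\<le>t. \<Sum>b\<in>exps t. c k i b * (h k (\<zeta> x) ^ i * (\<Prod>v\<in>UNIV. D v (\<zeta> x) ^ b v)))"
      by (simp add: Q_def poly_sum poly_monom z(2)[OF that] sum_distrib_right sum_distrib_left mult_ac)
    then show ?thesis using c(2) by simp
  qed
  then have "h k ` \<zeta> ` X \<subseteq> {x. poly Q x = 0}" by auto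
  then have "card (h k ` \<zeta> ` X) \<le> card {x. poly Q x = 0}" by (intro card_mono poly_roots_finite Q0)
  moreover have "card (h k ` \<zeta> ` X) = card X" using k(2) z(1) by (simp add: card_image)
  ultimately have "card X \<le> t" using card_poly_roots_bound[OF Q0] by linarith
  then show False using neg by (simp add: t_def)
qed

text \<open>The regions of distinct patterns, shrunk by \<open>\<epsilon>\<close>, are disjoint open sets on whose boundaries the product \<open>F\<close>
  vanishes; so for small \<open>a\<close> each of them contains an extremum of \<open>F - a \<bullet> z\<close>, a point with gradient \<open>a\<close>.\<close>

theorem card_positivity_patterns:
  fixes G :: "(real ^ 'v::finite \<Rightarrow> real) set"
  assumes "finite G" "G \<subseteq> polyfun n" "finite X" "inj_on (\<lambda>z. {g\<in>G. g z > 0}) X"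
  shows "card X \<le> (CARD('v) * (card G * n + 2) + 1) ^ CARD('v)"
proof (cases "X = {}")
  case False
  \<comment> \<open>\<open>\<epsilon>\<close> will be at most half of every positive value of a
    \<open>g\<close> on \<open>X\<close>, so that positivity on \<open>X\<close> means exceeding
    \<open>\<epsilon>\<close> and no value equals \<open>\<epsilon>\<close>; the 1 keeps the set
    nonempty.\<close>
  define vals where "vals = insert 1 ((\<lambda>(g, z). g z) ` (G \<times> X) \<inter> {0<..})"
  have vals: "finite vals" "vals \<noteq> {}" "\<And>x. x \<in> vals \<Longrightarrow> x > 0"
    using assms by (auto simp: vals_def)
  define \<epsilon> where "\<epsilon> = Min vals / 2"
  have "Min vals > 0" using vals by simp
  then have \<epsilon>: "\<epsilon> > 0" "\<epsilon> < Min vals" by (simp_all add: \<epsilon>_def)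
  have gX: "g x > 0 \<longleftrightarrow> g x > \<epsilon>" "g x \<noteq> \<epsilon>" if "g \<in> G" "x \<in> X" for g x
  proof -
    have "g x > \<epsilon>" if "g x > 0"
    proof -
      have "g x \<in> (\<lambda>(g, z). g z) ` (G \<times> X)"
        by (rule image_eqI[of _ _ "(g, x)"]) (use \<open>g \<in> G\<close> \<open>x \<in> X\<close> in simp_all)
      then have "Min vals \<le> g x" using vals(1) that by (intro Min_le) (simp_all add: vals_def)
      then show ?thesis using \<epsilon>(2) by simp
    qed
    then show "g x > 0 \<longleftrightarrow> g x > \<epsilon>" "g x \<noteq> \<epsilon>" using \<epsilon>(1) by auto
  qed
  define R where "R = Max (norm ` X) + 1"
  have "norm x \<le> Max (norm ` X)" if "x \<in> X" for x using assms(3) that by simp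
  then have R: "norm x < R" if "x \<in> X" for x using that by (fastforce simp: R_def)
  have R0: "R > 0" using False R norm_ge_zero by (metis all_not_in_conv le_less_trans)
  \<comment> \<open>The last factor vanishes on the sphere of radius \<open>R\<close>, which makes
    every region bounded; it accounts for the \<open>2\<close> in the degree bound.\<close>
  define F where "F z = (\<Prod>g\<in>G. g z - \<epsilon>) * (R\<^sup>2 - (\<Sum>v\<in>UNIV. (z $ v)\<^sup>2))" for z
  have sq: "(\<Sum>v\<in>UNIV. (z $ v)\<^sup>2) = (norm z)\<^sup>2" for z :: "real ^ 'v"
    by (simp add: norm_vec_def L2_set_def real_sqrt_pow2 sum_nonneg)
  define N where "N = card G * n + 2"
  have "(\<lambda>z::real^'v. (z $ v)\<^sup>2) \<in> polyfun 2" for v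
    using polyfun_power[OF polyfun_coordinate[of v 0], of 2] by simp
  then have F: "F \<in> polyfun N"
    unfolding F_def N_def
    by (intro polyfun_mult polyfun_prod polyfun_diff polyfun_const polyfun_sum) (use assms in auto)
  have cF: "continuous_on S F" for S using F by (rule continuous_polyfun)
  have "\<exists>g'\<in>polyfun N. \<forall>z. ((\<lambda>s. F (z + s *\<^sub>R axis v 1)) has_real_derivative g' z) (at 0)" for v
    using polyfun_partial_derivative[OF F] .
  then have "\<exists>D. \<forall>v. D v \<in> polyfun N \<and> (\<forall>z. ((\<lambda>s. F (z + s *\<^sub>R axis v 1)) has_real_derivative D v z) (at 0))"
    by (intro choice) blast
  then obtain D where D: "\<And>v. D v \<in> polyfun N"
    "\<And>v z. ((\<lambda>s. F (z + s *\<^sub>R axis v 1)) has_real_derivative D v z) (at 0)" by blast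
  define reg where "reg x g = (if g x > 0 then {z. g z > \<epsilon>} else {z. g z < \<epsilon>})" for x :: "real ^ 'v" and g
  define creg where "creg x g = (if g x > 0 then {z. g z \<ge> \<epsilon>} else {z. g z \<le> \<epsilon>})" for x :: "real ^ 'v" and g
  define U where "U x = ball 0 R \<inter> (\<Inter>g\<in>G. reg x g)" for x
  define C where "C x = cball 0 R \<inter> (\<Inter>g\<in>G. creg x g)" for x
  have cg: "continuous_on UNIV g" if "g \<in> G" for g using that assms(2) continuous_polyfun by blast
  have openU: "open (U x)" for x
    unfolding U_def using assms(1) cg
    by (intro open_Int open_INT open_ball) (auto simp: reg_def intro!: open_Collect_less continuous_on_const)
  have compC: "compact (C x)" for x
  proof -
    have "closed (\<Inter>g\<in>G. creg x g)"
      using cg by (intro closed_INT) (auto simp: creg_def intro!: closed_Collect_le continuous_on_const)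
    then show ?thesis unfolding C_def by (intro compact_Int_closed compact_cball)
  qed
  have xU: "x \<in> U x" if "x \<in> X" for x
  proof -
    have "x \<in> reg x g" if "g \<in> G" for g
      using gX[OF that \<open>x \<in> X\<close>] by (cases "g x > 0") (auto simp: reg_def)
    then show ?thesis using R[OF that] by (simp add: U_def)
  qed
  have UC: "U x \<subseteq> C x" for x unfolding U_def C_def by (intro Int_mono INT_anti_mono ball_subset_cball) (auto simp: reg_def creg_def)
  have F_bd: "F z = 0" if "z \<in> C x" "z \<notin> U x" for x z
  proof (cases "norm z = R")
    case True
    then show ?thesis by (simp add: F_def sq)
  next
    case False
    have "norm z \<le> R" using that(1) by (simp add: C_def)
    with False have "z \<in> ball 0 R" by simp
    with that(2) obtain g where g: "g \<in> G" "z \<notin> reg x g"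
      unfolding U_def by blast
    then have "z \<in> creg x g" using that(1) by (auto simp: C_def)
    with g(2) have "g z = \<epsilon>" by (auto simp: reg_def creg_def split: if_splits)
    then show ?thesis using g(1) assms(1) by (auto simp: F_def)
  qed
  have FX: "F x \<noteq> 0" if "x \<in> X" for x
  proof -
    have "(norm x)\<^sup>2 < R\<^sup>2" using R[OF that] by (intro power_strict_mono) auto
    then show ?thesis using gX[OF _ that] assms(1) by (auto simp: F_def sq)
  qed
  \<comment> \<open>Inside the ball the linear term stays below \<open>\<delta> * R\<close>, half
    the least \<open>\<bar>F x\<bar>\<close> on \<open>X\<close>, so tilting cannot push the
    extremum to the boundary.\<close>
  define \<delta> where "\<delta> = Min ((\<lambda>x. \<bar>F x\<bar>) ` X) / (2 * R)"
  have "Min ((\<lambda>x. \<bar>F x\<bar>) ` X) > 0" using False assms(3) FX by simp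
  then have "\<delta> > 0" using R0 by (simp add: \<delta>_def)
  moreover have "\<exists>\<zeta>. inj_on \<zeta> X \<and> (\<forall>x\<in>X. \<forall>v. D v (\<zeta> x) = a $ v)" if a: "norm a < \<delta>" for a
  proof -
    have "\<exists>z\<in>U x. \<forall>v. D v z = a $ v" if x: "x \<in> X" for x
    proof -
      define \<sigma> where "\<sigma> = sgn (F x)"
      have \<sigma>: "\<bar>\<sigma>\<bar> = 1" "\<sigma> * F x = \<bar>F x\<bar>" using FX[OF x] by (auto simp: \<sigma>_def sgn_if)
      define H where "H z = \<sigma> * (F z - a \<bullet> z)" for z
      have "continuous_on (C x) H" unfolding H_def by (intro continuous_intros cF)
      moreover have "C x \<noteq> {}" using xU[OF x] UC by blast
      ultimately obtain z where z: "z \<in> C x" "\<And>y. y \<in> C x \<Longrightarrow> H y \<le> H z"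
        using continuous_attains_sup[OF compC] by metis
      have bd: "\<bar>\<sigma> * (a \<bullet> y)\<bar> \<le> norm a * R" if "norm y \<le> R" for y
      proof -
        have "\<bar>\<sigma> * (a \<bullet> y)\<bar> = \<bar>a \<bullet> y\<bar>" using \<sigma>(1) by (simp add: abs_mult)
        also have "\<dots> \<le> norm a * norm y" by (rule Cauchy_Schwarz_ineq2)
        also have "\<dots> \<le> norm a * R" using that by (simp add: mult_left_mono)
        finally show ?thesis .
      qed
      have "z \<in> U x"
      proof (rule ccontr)
        assume "z \<notin> U x"
        then have "F z = 0" using F_bd z(1) by blast
        then have "H z \<le> norm a * R" using bd[of z] z(1) by (simp add: H_def C_def)
        moreover have "H x \<ge> \<bar>F x\<bar> - norm a * R"
          using bd[of x] R[OF x] \<sigma>(2) by (simp add: H_def algebra_simps)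
        moreover have "H x \<le> H z" using z(2) xU[OF x] UC by blast
        ultimately have "\<bar>F x\<bar> \<le> 2 * (norm a * R)" by linarith
        then have "\<bar>F x\<bar> \<le> 2 * R * norm a" by (simp add: mult_ac)
        moreover have "2 * R * norm a < 2 * R * \<delta>" using a R0 by simp
        moreover have "2 * R * \<delta> \<le> \<bar>F x\<bar>" using R0 x assms(3) by (simp add: \<delta>_def)
        ultimately show False by linarith
      qed
      moreover have "D v z = a $ v" for v
      proof -
        obtain r where r: "r > 0" "ball z r \<subseteq> U x" using openU \<open>z \<in> U x\<close> open_contains_ball by blast
        have d: "((\<lambda>s. H (z + s *\<^sub>R axis v 1)) has_real_derivative \<sigma> * (D v z - a $ v)) (at 0)"
          unfolding H_def
          by (auto intro!: derivative_eq_intros D(2) simp: inner_add_right inner_axis algebra_simps)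
        have "\<forall>y. \<bar>0 - y\<bar> < r \<longrightarrow> H (z + y *\<^sub>R axis v 1) \<le> H (z + 0 *\<^sub>R axis v 1)"
        proof (intro allI impI)
          fix y :: real assume "\<bar>0 - y\<bar> < r"
          then have "z + y *\<^sub>R axis v 1 \<in> ball z r" by (simp add: dist_norm)
          then show "H (z + y *\<^sub>R axis v 1) \<le> H (z + 0 *\<^sub>R axis v 1)"
            using z(2)[of "z + y *\<^sub>R axis v 1"] r(2) UC[of x] by (simp add: subset_iff)
        qed
        then have "\<sigma> * (D v z - a $ v) = 0" by (rule DERIV_local_max[OF d r(1)])
        then show ?thesis using \<sigma>(1) by auto
      qed
      ultimately show ?thesis by blast
    qed
    then have "\<exists>\<zeta>. \<forall>x\<in>X. \<zeta> x \<in> U x \<and> (\<forall>v. D v (\<zeta> x) = a $ v)" by (intro bchoice) blast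
    then obtain \<zeta> where \<zeta>: "\<And>x. x \<in> X \<Longrightarrow> \<zeta> x \<in> U x" "\<And>x v. x \<in> X \<Longrightarrow> D v (\<zeta> x) = a $ v" by blast
    have "x = y" if xy: "x \<in> X" "y \<in> X" "\<zeta> x = \<zeta> y" for x y
    proof -
      have "g x > 0 \<longleftrightarrow> g y > 0" if "g \<in> G" for g
      proof -
        have "\<zeta> y \<in> reg x g" using \<zeta>(1)[OF xy(1)] that unfolding xy(3) U_def by blast
        moreover have "\<zeta> y \<in> reg y g" using \<zeta>(1)[OF xy(2)] that unfolding U_def by blast
        ultimately show ?thesis by (auto simp: reg_def split: if_splits)
      qed
      then have "{g\<in>G. g x > 0} = {g\<in>G. g y > 0}" by blast
      then show ?thesis using inj_onD[OF assms(4)] xy by blast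
    qed
    then have "inj_on \<zeta> X" by (auto intro: inj_onI)
    then show ?thesis using \<zeta>(2) by blast
  qed
  ultimately have "card X \<le> (CARD('v) * N + 1) ^ CARD('v)"
    by (intro card_le_of_polynomial_fibres[where D = D] assms(3) D(1))
  then show ?thesis by (simp add: N_def)
qed simp

section \<open>Elimination and the semialgebraic complexity of looseness\<close>

definition lp_feasible :: "('x \<Rightarrow> 'z \<Rightarrow> real) set \<Rightarrow> 'x set \<Rightarrow> 'z \<Rightarrow> bool" where
  "lp_feasible \<A> X z \<longleftrightarrow> (\<exists>\<omega>. \<forall>a\<in>\<A>. (\<Sum>x\<in>X. a x z * \<omega> x) > 0)"

text \<open>Fourier-Motzkin elimination of \<open>y\<close>; \<open>P\<close> and \<open>N\<close> are meant to be the forms with positive and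
  negative coefficient of \<open>y\<close>, but are free so that only finitely many systems arise as \<open>z\<close> varies.\<close>

definition fm_eliminate ::
    "('x \<Rightarrow> 'z \<Rightarrow> real) set \<Rightarrow> 'x \<Rightarrow> ('x \<Rightarrow> 'z \<Rightarrow> real) set \<Rightarrow> ('x \<Rightarrow> 'z \<Rightarrow> real) set \<Rightarrow> ('x \<Rightarrow> 'z \<Rightarrow> real) set" where
  "fm_eliminate \<A> y P N =
     (\<A> - P - N) \<union> (\<lambda>(a, b) x z. a x z * (- b y z) + b x z * a y z) ` (P \<times> N)"

lemma finite_sets_between:
  fixes L U :: "real set"
  assumes "finite L" "finite U" "\<And>l u. l \<in> L \<Longrightarrow> u \<in> U \<Longrightarrow> l < u"
  shows "\<exists>w. (\<forall>l\<in>L. l < w) \<and> (\<forall>u\<in>U. w < u)"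
proof (cases "L = {}")
  case True
  show ?thesis
  proof (cases "U = {}")
    case False
    have "Min U - 1 < u" if "u \<in> U" for u using Min_le[OF assms(2) that] by simp
    then show ?thesis using True by (intro exI[of _ "Min U - 1"]) blast
  qed (use True in simp)
next
  case L: False
  show ?thesis
  proof (cases "U = {}")
    case True
    have "l < Max L + 1" if "l \<in> L" for l using Max_ge[OF assms(1) that] by simp
    then show ?thesis using True by (intro exI[of _ "Max L + 1"]) blast
  next
    case False
    have "Max L < Min U" using L False assms by simp
    then obtain w where "Max L < w" "w < Min U" using dense by blast
    then show ?thesis using L False assms by (intro exI[of _ w]) auto
  qed
qed

lemma sum_linear_combination:
  fixes c e :: real
  shows "(\<Sum>x\<in>X. (a x * c + b x * e) * w x) = c * (\<Sum>x\<in>X. a x * w x) + e * (\<Sum>x\<in>X. b x * w x)"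
  by (simp add: sum_distrib_left sum.distrib algebra_simps)

text \<open>Forms in the first set bound the value at \<open>y\<close> from below, those in the
  second from above, and each combined form says that one lower bound is less than one upper bound.
  For finitely many strict bounds this suffices to choose the value.\<close>

lemma lp_feasible_eliminate:
  assumes "finite X" "y \<notin> X" "finite \<A>"
  shows "lp_feasible \<A> (insert y X) z \<longleftrightarrow>
    lp_feasible (fm_eliminate \<A> y {a\<in>\<A>. a y z > 0} {a\<in>\<A>. a y z < 0}) X z"
    (is "_ \<longleftrightarrow> lp_feasible (fm_eliminate _ _ ?P ?N) X z")
proof
  assume "lp_feasible \<A> (insert y X) z"
  then obtain w where w: "\<And>a. a \<in> \<A> \<Longrightarrow> a y z * w y + (\<Sum>x\<in>X. a x z * w x) > 0"
    using assms by (auto simp: lp_feasible_def)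
  show "lp_feasible (fm_eliminate \<A> y ?P ?N) X z"
    unfolding lp_feasible_def
  proof (intro exI[of _ w] ballI)
    fix f assume "f \<in> fm_eliminate \<A> y ?P ?N"
    then consider "f \<in> \<A>" "f y z = 0"
      | a b where "a \<in> ?P" "b \<in> ?N" "f = (\<lambda>x z. a x z * (- b y z) + b x z * a y z)"
      by (fastforce simp: fm_eliminate_def)
    then show "(\<Sum>x\<in>X. f x z * w x) > 0"
    proof cases
      case 1
      then show ?thesis using w[of f] by simp
    next
      case 2
      have "a y z * ((- b y z) * w y) < a y z * (\<Sum>x\<in>X. b x z * w x)"
        using w[of b] 2 by (intro mult_strict_left_mono) auto
      moreover have "(- b y z) * (- (a y z * w y)) < (- b y z) * (\<Sum>x\<in>X. a x z * w x)"
        using w[of a] 2 by (intro mult_strict_left_mono) auto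
      moreover have "(\<Sum>x\<in>X. f x z * w x)
          = (- b y z) * (\<Sum>x\<in>X. a x z * w x) + a y z * (\<Sum>x\<in>X. b x z * w x)"
        unfolding 2 by (rule sum_linear_combination)
      ultimately show ?thesis by (simp add: algebra_simps)
    qed
  qed
next
  assume "lp_feasible (fm_eliminate \<A> y ?P ?N) X z"
  then obtain w where w: "\<And>f. f \<in> fm_eliminate \<A> y ?P ?N \<Longrightarrow> (\<Sum>x\<in>X. f x z * w x) > 0"
    by (auto simp: lp_feasible_def)
  define S where "S a = (\<Sum>x\<in>X. a x z * w x)" for a
  have "- S a / a y z < S b / (- b y z)" if ab: "a \<in> ?P" "b \<in> ?N" for a b
  proof -
    have "(\<lambda>x z. a x z * (- b y z) + b x z * a y z) \<in> fm_eliminate \<A> y ?P ?N"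
      unfolding fm_eliminate_def using ab by (intro UnI2 image_eqI[of _ _ "(a, b)"]) auto
    from w[OF this] have "0 < (- b y z) * S a + a y z * S b"
      unfolding S_def sum_linear_combination .
    then show ?thesis using ab by (simp add: field_simps)
  qed
  then have "\<exists>t. (\<forall>l\<in>(\<lambda>a. - S a / a y z) ` ?P. l < t) \<and> (\<forall>u\<in>(\<lambda>b. S b / (- b y z)) ` ?N. t < u)"
    using assms(3) by (intro finite_sets_between finite_imageI) (simp, simp, blast)
  then obtain t where t: "\<And>a. a \<in> ?P \<Longrightarrow> - S a / a y z < t" "\<And>b. b \<in> ?N \<Longrightarrow> t < S b / (- b y z)"
    by blast
  show "lp_feasible \<A> (insert y X) z"
    unfolding lp_feasible_def
  proof (intro exI[of _ "w(y := t)"] ballI)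
    fix a assume a: "a \<in> \<A>"
    have e: "(\<Sum>x\<in>insert y X. a x z * (w(y := t)) x) = a y z * t + S a"
    proof -
      have "(\<Sum>x\<in>X. a x z * (w(y := t)) x) = S a"
        unfolding S_def using assms(2) by (intro sum.cong) auto
      then show ?thesis using assms by simp
    qed
    consider "a y z > 0" | "a y z < 0" | "a y z = 0" by linarith
    then have "a y z * t + S a > 0"
    proof cases
      case 1
      then show ?thesis using t(1)[of a] a by (simp add: field_simps)
    next
      case 2
      then show ?thesis using t(2)[of a] a by (simp add: field_simps)
    next
      case 3
      then show ?thesis using w[of a] a by (simp add: S_def fm_eliminate_def)
    qed
    then show "(\<Sum>x\<in>insert y X. a x z * (w(y := t)) x) > 0" by (simp only: e)
  qed
qed

text \<open>The signs of the coefficients of the eliminated unknown select the pair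
  \<open>(P, N)\<close>. As this pair varies with \<open>z\<close>, the polynomials for all pairs of
  subsets of \<open>\<A>\<close> are collected, whence the factor \<open>2 ^ k * 2 ^ k\<close>. One
  elimination leaves at most \<open>k + k * k\<close> forms and doubles the degree, so the bounds
  are uniform in \<open>\<A>\<close>.\<close>

lemma lp_feasible_sign_determined:
  fixes X :: "'x set"
  assumes "finite X"
  shows "\<exists>M m. \<forall>\<A> :: ('x \<Rightarrow> real ^ 'v::finite \<Rightarrow> real) set.
    finite \<A> \<and> card \<A> \<le> k \<and> (\<forall>a\<in>\<A>. \<forall>x\<in>X. a x \<in> polyfun n) \<longrightarrow>
    (\<exists>G. finite G \<and> card G \<le> M \<and> G \<subseteq> polyfun m \<and>
      (\<forall>z z'. (\<forall>g\<in>G. g z > 0 \<longleftrightarrow> g z' > 0) \<longrightarrow> lp_feasible \<A> X z = lp_feasible \<A> X z'))"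
  using assms
proof (induction X arbitrary: k n rule: finite_induct)
  case empty
  show ?case by (intro exI[of _ 0] allI impI exI[of _ "{}"]) (auto simp: lp_feasible_def)
next
  case (insert y X)
  obtain M m where IH: "\<forall>\<A> :: ('x \<Rightarrow> real ^ 'v \<Rightarrow> real) set.
    finite \<A> \<and> card \<A> \<le> k + k * k \<and> (\<forall>a\<in>\<A>. \<forall>x\<in>X. a x \<in> polyfun (n + n)) \<longrightarrow>
    (\<exists>G. finite G \<and> card G \<le> M \<and> G \<subseteq> polyfun m \<and>
      (\<forall>z z'. (\<forall>g\<in>G. g z > 0 \<longleftrightarrow> g z' > 0) \<longrightarrow> lp_feasible \<A> X z = lp_feasible \<A> X z'))"
    using insert.IH[of "k + k * k" "n + n"] by (elim exE) (erule that)
  show ?case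
  proof (rule exI[of _ "k + k + 2 ^ k * 2 ^ k * M"], rule exI[of _ "n + m"], intro allI impI, elim conjE)
    fix \<A> :: "('x \<Rightarrow> real ^ 'v \<Rightarrow> real) set"
    assume \<A>: "finite \<A>" "card \<A> \<le> k" "\<forall>a\<in>\<A>. \<forall>x\<in>insert y X. a x \<in> polyfun n"
    have "\<exists>G. finite G \<and> card G \<le> M \<and> G \<subseteq> polyfun m \<and>
      (\<forall>z z'. (\<forall>g\<in>G. g z > 0 \<longleftrightarrow> g z' > 0) \<longrightarrow>
        lp_feasible (fm_eliminate \<A> y (fst Q) (snd Q)) X z = lp_feasible (fm_eliminate \<A> y (fst Q) (snd Q)) X z')"
      if Q: "Q \<in> Pow \<A> \<times> Pow \<A>" for Q
    proof (rule IH[THEN spec, THEN mp], intro conjI)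
      define P N where "P = fst Q" and "N = snd Q"
      have PN: "P \<subseteq> \<A>" "N \<subseteq> \<A>" using Q by (auto simp: P_def N_def)
      have fin: "finite P" "finite N" using PN \<A>(1) finite_subset by auto
      then show "finite (fm_eliminate \<A> y (fst Q) (snd Q))"
        unfolding fm_eliminate_def P_def[symmetric] N_def[symmetric] using \<A>(1) by auto
      have "card (fm_eliminate \<A> y P N) \<le> card (\<A> - P - N)
          + card ((\<lambda>(a, b) x z. a x z * (- b y z) + b x z * a y z) ` (P \<times> N))"
        unfolding fm_eliminate_def by (rule card_Un_le)
      also have "\<dots> \<le> card \<A> + card (P \<times> N)"
        using fin \<A>(1) by (intro add_mono card_mono card_image_le) auto
      also have "\<dots> \<le> k + k * k"
        unfolding card_cartesian_product using order_trans[OF card_mono[OF \<A>(1) PN(1)] \<A>(2)]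
          order_trans[OF card_mono[OF \<A>(1) PN(2)] \<A>(2)] \<A>(2)
        by (intro add_mono mult_le_mono)
      finally show "card (fm_eliminate \<A> y (fst Q) (snd Q)) \<le> k + k * k" by (simp add: P_def N_def)
      show "\<forall>a\<in>fm_eliminate \<A> y (fst Q) (snd Q). \<forall>x\<in>X. a x \<in> polyfun (n + n)"
      proof (intro ballI)
        fix f x assume "f \<in> fm_eliminate \<A> y (fst Q) (snd Q)" and x: "x \<in> X"
        then consider "f \<in> \<A>"
          | a b where "a \<in> \<A>" "b \<in> \<A>" "f = (\<lambda>x z. a x z * (- b y z) + b x z * a y z)"
          using PN unfolding fm_eliminate_def P_def[symmetric] N_def[symmetric] by auto
        then show "f x \<in> polyfun (n + n)"
        proof cases
          case 1
          then have "f x \<in> polyfun n" using \<A>(3) x by blast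
          then show ?thesis using polyfun_mono[of n "n + n"] by auto
        next
          case 2
          have "a x \<in> polyfun n" "b x \<in> polyfun n" "a y \<in> polyfun n" "b y \<in> polyfun n"
            using \<A>(3) x 2 by blast+
          then show ?thesis unfolding 2(3) by (intro polyfun_add polyfun_mult polyfun_uminus)
        qed
      qed
    qed
    then have "\<exists>H. \<forall>Q\<in>Pow \<A> \<times> Pow \<A>. finite (H Q) \<and> card (H Q) \<le> M \<and> H Q \<subseteq> polyfun m \<and>
      (\<forall>z z'. (\<forall>g\<in>H Q. g z > 0 \<longleftrightarrow> g z' > 0) \<longrightarrow>
        lp_feasible (fm_eliminate \<A> y (fst Q) (snd Q)) X z = lp_feasible (fm_eliminate \<A> y (fst Q) (snd Q)) X z')"
      by (intro bchoice ballI)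
    then obtain H where H0: "\<forall>Q\<in>Pow \<A> \<times> Pow \<A>. finite (H Q) \<and> card (H Q) \<le> M \<and> H Q \<subseteq> polyfun m \<and>
      (\<forall>z z'. (\<forall>g\<in>H Q. g z > 0 \<longleftrightarrow> g z' > 0) \<longrightarrow>
        lp_feasible (fm_eliminate \<A> y (fst Q) (snd Q)) X z = lp_feasible (fm_eliminate \<A> y (fst Q) (snd Q)) X z')"
      by (elim exE) (erule that)
    have H: "finite (H Q)" "card (H Q) \<le> M" "H Q \<subseteq> polyfun m"
      "(\<forall>g\<in>H Q. g z > 0 \<longleftrightarrow> g z' > 0) \<Longrightarrow>
        lp_feasible (fm_eliminate \<A> y (fst Q) (snd Q)) X z = lp_feasible (fm_eliminate \<A> y (fst Q) (snd Q)) X z'"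
      if "Q \<in> Pow \<A> \<times> Pow \<A>" for Q z z'
      using bspec[OF H0 that] by simp_all
    define G where "G = (\<lambda>a. a y) ` \<A> \<union> (\<lambda>a z. - a y z) ` \<A> \<union> (\<Union>Q\<in>Pow \<A> \<times> Pow \<A>. H Q)"
    have "finite G" unfolding G_def using \<A>(1) H(1) by (intro finite_UnI finite_imageI finite_UN_I) auto
    moreover have "card G \<le> k + k + 2 ^ k * 2 ^ k * M"
    proof -
      have "card (\<Union>Q\<in>Pow \<A> \<times> Pow \<A>. H Q) \<le> (\<Sum>Q\<in>Pow \<A> \<times> Pow \<A>. card (H Q))"
        using \<A>(1) by (intro card_UN_le) auto
      also have "\<dots> \<le> card (Pow \<A> \<times> Pow \<A>) * M"
        using sum_bounded_above[of "Pow \<A> \<times> Pow \<A>" "\<lambda>Q. card (H Q)" M, OF H(2)] by (simp only: of_nat_id)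
      also have "\<dots> = 2 ^ card \<A> * 2 ^ card \<A> * M" using \<A>(1) by (simp add: card_cartesian_product card_Pow)
      also have "\<dots> \<le> 2 ^ k * 2 ^ k * M"
        using \<A>(2) by (intro mult_le_mono power_increasing) auto
      finally have 3: "card (\<Union>Q\<in>Pow \<A> \<times> Pow \<A>. H Q) \<le> 2 ^ k * 2 ^ k * M" .
      have "card ((\<lambda>a. a y) ` \<A>) \<le> k" "card ((\<lambda>a z. - a y z) ` \<A>) \<le> k"
        using \<A>(1,2) card_image_le order_trans by blast+
      then show ?thesis unfolding G_def using 3
        by (intro order_trans[OF card_Un_le] add_mono) auto
    qed
    moreover have "G \<subseteq> polyfun (n + m)"
    proof -
      have "a y \<in> polyfun n" if "a \<in> \<A>" for a using \<A>(3) that by blast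
      then have 1: "(\<lambda>a. a y) ` \<A> \<union> (\<lambda>a z. - a y z) ` \<A> \<subseteq> polyfun n" by (auto intro: polyfun_uminus)
      have 2: "(\<Union>Q\<in>Pow \<A> \<times> Pow \<A>. H Q) \<subseteq> polyfun m" using H(3) by (rule UN_least)
      have 3: "polyfun n \<subseteq> (polyfun (n + m) :: (real ^ 'v \<Rightarrow> real) set)"
        "polyfun m \<subseteq> (polyfun (n + m) :: (real ^ 'v \<Rightarrow> real) set)"
        by (rule polyfun_mono, simp)+
      show ?thesis unfolding G_def using subset_trans[OF 1 3(1)] subset_trans[OF 2 3(2)] by (rule Un_least)
    qed
    moreover have "lp_feasible \<A> (insert y X) z = lp_feasible \<A> (insert y X) z'"
      if G: "\<forall>g\<in>G. g z > 0 \<longleftrightarrow> g z' > 0" for z z'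
    proof -
      have "a y z > 0 \<longleftrightarrow> a y z' > 0" "- a y z > 0 \<longleftrightarrow> - a y z' > 0" if "a \<in> \<A>" for a
      proof -
        have "a y \<in> G" "(\<lambda>z. - a y z) \<in> G" using that by (auto simp: G_def)
        then show "a y z > 0 \<longleftrightarrow> a y z' > 0" "- a y z > 0 \<longleftrightarrow> - a y z' > 0" using G by auto
      qed
      then have e: "{a\<in>\<A>. a y z > 0} = {a\<in>\<A>. a y z' > 0}" "{a\<in>\<A>. a y z < 0} = {a\<in>\<A>. a y z' < 0}"
        by auto
      let ?Q = "({a\<in>\<A>. a y z > 0}, {a\<in>\<A>. a y z < 0})"
      have Q: "?Q \<in> Pow \<A> \<times> Pow \<A>" by auto
      have "H ?Q \<subseteq> G" unfolding G_def using Q by (intro le_supI2 UN_upper)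
      then have "\<forall>g\<in>H ?Q. g z > 0 \<longleftrightarrow> g z' > 0" using G by (auto dest: subsetD)
      from H(4)[OF Q this] show ?thesis
        using lp_feasible_eliminate[OF insert.hyps \<A>(1), of z] lp_feasible_eliminate[OF insert.hyps \<A>(1), of z'] e
        by simp
    qed
    ultimately show "\<exists>G. finite G \<and> card G \<le> k + k + 2 ^ k * 2 ^ k * M \<and> G \<subseteq> polyfun (n + m) \<and>
      (\<forall>z z'. (\<forall>g\<in>G. g z > 0 \<longleftrightarrow> g z' > 0) \<longrightarrow> lp_feasible \<A> (insert y X) z = lp_feasible \<A> (insert y X) z')"
      by blast
  qed
qed

text \<open>Stated for vertex lists, so that it makes sense for tuples with repeated simplices:
  \<open>V c k\<close> is vertex \<open>k\<close> of the simplex of colour \<open>c\<close>, and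
  each hull omits one colour.\<close>

definition hull_loose :: "('c \<Rightarrow> 'w \<Rightarrow> real ^ 'd) \<Rightarrow> bool" where
  "hull_loose V \<longleftrightarrow> (\<Inter>c. convex hull (\<Union>c'\<in>UNIV - {c}. range (V c'))) \<noteq> {}"

primrec homog :: "real ^ 'd \<Rightarrow> 'd option \<Rightarrow> real" where
  "homog x None = 1"
| "homog x (Some t) = x $ t"

text \<open>A vector \<open>\<omega>\<close> encodes affine forms \<open>\<phi> s\<close>, one for each coordinate \<open>s\<close>: the pairing with \<open>sep_coeff (Some s) x\<close>
  is \<open>\<phi> s x\<close>, and with \<open>sep_coeff None x\<close> it is \<open>- (\<Sum>s. \<phi> s x)\<close>. The \<open>d + 1\<close> half spaces where these are
  positive have empty intersection.\<close>

primrec sep_coeff :: "'d option \<Rightarrow> real ^ 'd \<Rightarrow> 'd \<times> 'd option \<Rightarrow> real" where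
  "sep_coeff None x p = - homog x (snd p)"
| "sep_coeff (Some s) x p = (if fst p = s then homog x (snd p) else 0)"

text \<open>The weights are indexed by \<open>I\<close> and not by points, so repeated values of
  \<open>T\<close> cause no trouble.\<close>

lemma convex_hull_image_indexed:
  assumes "finite I"
  shows "convex hull (T ` I) \<subseteq> {\<Sum>i\<in>I. u i *\<^sub>R T i | u. (\<forall>i\<in>I. 0 \<le> u i) \<and> sum u I = (1::real)}"
proof (rule hull_minimal)
  show "T ` I \<subseteq> {\<Sum>i\<in>I. u i *\<^sub>R T i | u. (\<forall>i\<in>I. 0 \<le> u i) \<and> sum u I = (1::real)}"
  proof
    fix x assume "x \<in> T ` I"
    then obtain j where j: "j \<in> I" "x = T j" by blast
    have "x = (\<Sum>i\<in>I. (if i = j then 1 else 0) *\<^sub>R T i)"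
    proof -
      have "(\<Sum>i\<in>I. (if i = j then 1 else (0::real)) *\<^sub>R T i) = (\<Sum>i\<in>I. if i = j then T i else 0)"
        by (intro sum.cong) auto
      then show ?thesis using j assms by simp
    qed
    moreover have "(\<Sum>i\<in>I. if i = j then 1 else (0::real)) = 1" using j assms by simp
    ultimately show "x \<in> {\<Sum>i\<in>I. u i *\<^sub>R T i | u. (\<forall>i\<in>I. 0 \<le> u i) \<and> sum u I = (1::real)}"
      by (intro CollectI exI[of _ "\<lambda>i. if i = j then 1 else 0"]) simp
  qed
  show "convex {\<Sum>i\<in>I. u i *\<^sub>R T i | u. (\<forall>i\<in>I. 0 \<le> u i) \<and> sum u I = (1::real)}"
  proof (rule convexI)
    fix x y and a b :: real
    assume "x \<in> {\<Sum>i\<in>I. u i *\<^sub>R T i | u. (\<forall>i\<in>I. 0 \<le> u i) \<and> sum u I = (1::real)}"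
      "y \<in> {\<Sum>i\<in>I. u i *\<^sub>R T i | u. (\<forall>i\<in>I. 0 \<le> u i) \<and> sum u I = (1::real)}"
      and ab: "0 \<le> a" "0 \<le> b" "a + b = 1"
    then obtain u v where u: "x = (\<Sum>i\<in>I. u i *\<^sub>R T i)" "\<forall>i\<in>I. 0 \<le> u i" "sum u I = 1"
      and v: "y = (\<Sum>i\<in>I. v i *\<^sub>R T i)" "\<forall>i\<in>I. 0 \<le> v i" "sum v I = 1" by blast
    have "a *\<^sub>R x + b *\<^sub>R y = (\<Sum>i\<in>I. (a * u i + b * v i) *\<^sub>R T i)"
      by (simp add: u(1) v(1) scaleR_sum_right sum.distrib scaleR_left_distrib)
    moreover have "\<forall>i\<in>I. 0 \<le> a * u i + b * v i" using u(2) v(2) ab by simp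
    moreover have "(\<Sum>i\<in>I. a * u i + b * v i) = 1"
      using u(3) v(3) ab by (simp add: sum.distrib sum_distrib_left[symmetric])
    ultimately show "a *\<^sub>R x + b *\<^sub>R y \<in> {\<Sum>i\<in>I. u i *\<^sub>R T i | u. (\<forall>i\<in>I. 0 \<le> u i) \<and> sum u I = (1::real)}"
      by (intro CollectI exI[of _ "\<lambda>i. a * u i + b * v i"]) simp
  qed
qed

lemma homog_convex_combination:
  "a + b = 1 \<Longrightarrow> homog (a *\<^sub>R x + b *\<^sub>R y) j = a * homog x j + b * homog y j"
  by (cases j) auto

lemma sep_coeff_convex_combination:
  "a + b = 1 \<Longrightarrow> sep_coeff c (a *\<^sub>R x + b *\<^sub>R y) p = a * sep_coeff c x p + b * sep_coeff c y p"
  by (cases c) (auto simp: homog_convex_combination algebra_simps)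

lemma sum_sep_coeff: "(\<Sum>c\<in>UNIV. sep_coeff c x p) = 0" for x :: "real ^ 'd::finite"
  by (simp add: UNIV_option_conv sum.reindex)

lemma convex_sep_halfspace:
  fixes \<omega> :: "'d::finite \<times> 'd option \<Rightarrow> real"
  shows "convex {x. (\<Sum>p\<in>UNIV. sep_coeff c x p * \<omega> p) > 0}"
proof (rule convexI)
  fix x y :: "real ^ 'd" and a b :: real
  assume xy: "x \<in> {x. (\<Sum>p\<in>UNIV. sep_coeff c x p * \<omega> p) > 0}"
    "y \<in> {x. (\<Sum>p\<in>UNIV. sep_coeff c x p * \<omega> p) > 0}" and ab: "0 \<le> a" "0 \<le> b" "a + b = 1"
  have "(\<Sum>p\<in>UNIV. sep_coeff c (a *\<^sub>R x + b *\<^sub>R y) p * \<omega> p)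
      = a * (\<Sum>p\<in>UNIV. sep_coeff c x p * \<omega> p) + b * (\<Sum>p\<in>UNIV. sep_coeff c y p * \<omega> p)"
    by (simp add: sep_coeff_convex_combination[OF ab(3)] distrib_right sum.distrib sum_distrib_left mult.assoc)
  also have "\<dots> > 0"
  proof (cases "a = 0")
    case True
    then show ?thesis using xy ab by simp
  next
    case False
    then show ?thesis using xy ab by (intro add_pos_nonneg mult_pos_pos mult_nonneg_nonneg) auto
  qed
  finally show "a *\<^sub>R x + b *\<^sub>R y \<in> {x. (\<Sum>p\<in>UNIV. sep_coeff c x p * \<omega> p) > 0}" by simp
qed

text \<open>A theorem of the alternative. The forms of all colours add up to zero, so they cannot
  all be positive at a common point. Conversely, infeasibility puts 0 into the convex hull of the
  coefficient vectors; each coordinate of that relation equates a moment of the weights on two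
  facets, so after normalisation all facets have the same weighted mean, a common point.\<close>

lemma hull_loose_iff:
  fixes V :: "'d option \<Rightarrow> 'w::finite \<Rightarrow> real ^ 'd::finite"
  shows "hull_loose V \<longleftrightarrow>
    \<not> (\<exists>\<omega>. \<forall>c c' k. c' \<noteq> c \<longrightarrow> (\<Sum>p\<in>UNIV. sep_coeff c (V c' k) p * \<omega> p) > 0)"
proof
  assume "hull_loose V"
  then obtain x where x: "\<And>c. x \<in> convex hull (\<Union>c'\<in>UNIV - {c}. range (V c'))"
    unfolding hull_loose_def by blast
  show "\<not> (\<exists>\<omega>. \<forall>c c' k. c' \<noteq> c \<longrightarrow> (\<Sum>p\<in>UNIV. sep_coeff c (V c' k) p * \<omega> p) > 0)"
  proof (rule notI, elim exE)
    fix \<omega> assume w: "\<forall>c c' k. c' \<noteq> c \<longrightarrow> (\<Sum>p\<in>UNIV. sep_coeff c (V c' k) p * \<omega> p) > 0"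
    have "(\<Sum>p\<in>UNIV. sep_coeff c x p * \<omega> p) > 0" for c
    proof -
      have "convex hull (\<Union>c'\<in>UNIV - {c}. range (V c')) \<subseteq> {x. (\<Sum>p\<in>UNIV. sep_coeff c x p * \<omega> p) > 0}"
        by (intro hull_minimal convex_sep_halfspace) (use w in auto)
      then show ?thesis using x[of c] by blast
    qed
    then have "(\<Sum>c\<in>UNIV. \<Sum>p\<in>UNIV. sep_coeff c x p * \<omega> p) > 0" by (rule sum_pos[OF finite_class.finite_UNIV UNIV_not_empty])
    moreover have "(\<Sum>c\<in>UNIV. \<Sum>p\<in>UNIV. sep_coeff c x p * \<omega> p) = 0"
      by (subst sum.swap) (simp add: sum_distrib_right[symmetric] sum_sep_coeff)
    ultimately show False by simp
  qed
next
  assume inf: "\<not> (\<exists>\<omega>. \<forall>c c' k. c' \<noteq> c \<longrightarrow> (\<Sum>p\<in>UNIV. sep_coeff c (V c' k) p * \<omega> p) > 0)"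
  define I where "I = {(c, c', k). (c::'d option) \<noteq> (c'::'d option) \<and> k \<in> (UNIV :: 'w set)}"
  define T where "T = (\<lambda>(c, c', k). \<chi> p. sep_coeff c (V c' k) p)"
  have "0 \<in> convex hull (T ` I)"
  proof (rule ccontr)
    assume "0 \<notin> convex hull (T ` I)"
    moreover have "closed (convex hull (T ` I))" by (intro compact_imp_closed finite_imp_compact_convex_hull) simp
    ultimately obtain a b where ab: "0 < b" "\<And>x. x \<in> convex hull (T ` I) \<Longrightarrow> b < a \<bullet> x"
      using separating_hyperplane_closed_0[of "convex hull (T ` I)"] by (auto simp: convex_convex_hull)
    have "(\<Sum>p\<in>UNIV. sep_coeff c (V c' k) p * a $ p) > 0" if "c' \<noteq> c" for c c' k
    proof -
      have "T (c, c', k) \<in> convex hull (T ` I)" using that by (intro hull_inc) (auto simp: I_def)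
      then have "0 < a \<bullet> T (c, c', k)" using ab by fastforce
      then show ?thesis by (simp add: T_def inner_vec_def mult.commute)
    qed
    then show False using inf by blast
  qed
  then have "0 \<in> {\<Sum>i\<in>I. u i *\<^sub>R T i | u. (\<forall>i\<in>I. 0 \<le> u i) \<and> sum u I = (1::real)}"
    by (rule subsetD[OF convex_hull_image_indexed, rotated]) simp
  then obtain u where u': "\<forall>i\<in>I. 0 \<le> u i" "sum u I = 1" "0 = (\<Sum>i\<in>I. u i *\<^sub>R T i)" by blast
  note u = bspec[OF u'(1)] u'(2,3)
  define J where "J c = (UNIV - {c}) \<times> (UNIV :: 'w set)" for c :: "'d option"
  have I: "I = Sigma UNIV J" by (auto simp: I_def J_def)
  have fJ: "finite (J c)" for c by (simp add: J_def)
  \<comment> \<open>The total weight of facet \<open>c\<close> (for \<open>j = None\<close>) and the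
    coordinates of its weighted vertex sum.\<close>
  define m where "m c j = (\<Sum>(c', k)\<in>J c. u (c, c', k) * homog (V c' k) j)" for c j
  have m: "m (Some s) j = m None j" for s j
  proof -
    have "0 = (\<Sum>i\<in>I. u i *\<^sub>R T i) $ (s, j)" using u(3) by simp
    also have "\<dots> = (\<Sum>c\<in>UNIV. \<Sum>(c', k)\<in>J c. u (c, c', k) * sep_coeff c (V c' k) (s, j))"
      by (simp add: I T_def sum.Sigma fJ case_prod_beta)
    also have "\<dots> = (\<Sum>(c', k)\<in>J None. u (None, c', k) * sep_coeff None (V c' k) (s, j))
      + (\<Sum>t\<in>UNIV. \<Sum>(c', k)\<in>J (Some t). u (Some t, c', k) * sep_coeff (Some t) (V c' k) (s, j))"
      by (simp add: UNIV_option_conv sum.reindex)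
    also have "(\<Sum>(c', k)\<in>J None. u (None, c', k) * sep_coeff None (V c' k) (s, j)) = - m None j"
      by (simp add: m_def sum_negf case_prod_beta)
    also have "(\<Sum>t\<in>UNIV. \<Sum>(c', k)\<in>J (Some t). u (Some t, c', k) * sep_coeff (Some t) (V c' k) (s, j))
        = (\<Sum>t\<in>UNIV. if t = s then m (Some s) j else 0)"
      by (intro sum.cong) (auto simp: m_def case_prod_beta)
    finally show ?thesis by simp
  qed
  define \<mu> where "\<mu> = m None None"
  have m': "m c j = m None j" for c j using m by (cases c) auto
  have "1 = (\<Sum>c\<in>UNIV. m c None)"
    using u(2) by (simp add: I m_def fJ sum.Sigma case_prod_beta)
  also have "\<dots> = (\<Sum>c\<in>(UNIV :: 'd option set). \<mu>)"
    unfolding \<mu>_def by (intro sum.cong refl m')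
  also have "\<dots> = real CARD('d option) * \<mu>" by simp
  finally have "\<mu> > 0" by (metis mult_nonneg_nonpos not_le of_nat_0_le_iff zero_less_one)
  define x where "x = (\<chi> t. m None (Some t) / \<mu>)"
  have "x \<in> convex hull (\<Union>c'\<in>UNIV - {c}. range (V c'))" for c
  proof -
    have "x = (\<Sum>i\<in>J c. (u (c, fst i, snd i) / \<mu>) *\<^sub>R V (fst i) (snd i))"
    proof (subst vec_eq_iff, rule allI)
      fix t
      have "x $ t = m c (Some t) / \<mu>" by (simp add: x_def m'[of c])
      also have "\<dots> = (\<Sum>i\<in>J c. (u (c, fst i, snd i) / \<mu>) *\<^sub>R V (fst i) (snd i)) $ t"
        by (simp add: m_def case_prod_beta sum_divide_distrib)
      finally show "x $ t = (\<Sum>i\<in>J c. (u (c, fst i, snd i) / \<mu>) *\<^sub>R V (fst i) (snd i)) $ t" .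
    qed
    moreover have "(\<Sum>i\<in>J c. u (c, fst i, snd i) / \<mu>) = 1"
      using m'[of c None] \<open>\<mu> > 0\<close> by (simp add: m_def case_prod_beta \<mu>_def sum_divide_distrib[symmetric])
    moreover have "u (c, fst i, snd i) / \<mu> \<ge> 0" if "i \<in> J c" for i
      using u(1)[of "(c, fst i, snd i)"] that \<open>\<mu> > 0\<close> by (auto simp: I J_def)
    moreover have "V (fst i) (snd i) \<in> convex hull (\<Union>c'\<in>UNIV - {c}. range (V c'))" if "i \<in> J c" for i
      using that by (intro hull_inc UN_I[of "fst i"] rangeI) (auto simp: J_def)
    ultimately show ?thesis
      using convex_sum[of "J c" "convex hull (\<Union>c'\<in>UNIV - {c}. range (V c'))"
          "\<lambda>i. u (c, fst i, snd i) / \<mu>" "\<lambda>i. V (fst i) (snd i)"]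
      by (simp add: J_def convex_convex_hull)
  qed
  then show "hull_loose V" unfolding hull_loose_def by blast
qed

text \<open>Only the simplex of colour \<open>c0\<close> moves, so each coefficient in the system of
  \<open>hull_loose_iff\<close> is a constant or, up to sign, one of its coordinates: degree 1. The
  number of forms is the same for all positions of the other simplices, which is why
  \<open>M\<close> and \<open>m\<close> come before \<open>c0\<close> and \<open>V\<close>.\<close>

lemma hull_loose_sign_determined:
  "\<exists>M m. \<forall>(c0 :: 'd option) (V :: 'd option \<Rightarrow> 'w::finite \<Rightarrow> real ^ 'd::finite).
    \<exists>G :: (real ^ ('w \<times> 'd) \<Rightarrow> real) set. finite G \<and> card G \<le> M \<and> G \<subseteq> polyfun m \<and>
      (\<forall>z z'. (\<forall>g\<in>G. g z > 0 \<longleftrightarrow> g z' > 0) \<longrightarrow>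
        hull_loose (V(c0 := (\<lambda>k. \<chi> t. z $ (k, t)))) = hull_loose (V(c0 := (\<lambda>k. \<chi> t. z' $ (k, t)))))"
proof -
  define K where "K = CARD('d option \<times> 'd option \<times> 'w)"
  obtain M m where Mm: "\<forall>\<A> :: ('d \<times> 'd option \<Rightarrow> real ^ ('w \<times> 'd) \<Rightarrow> real) set.
    finite \<A> \<and> card \<A> \<le> K \<and> (\<forall>a\<in>\<A>. \<forall>x\<in>UNIV. a x \<in> polyfun 1) \<longrightarrow>
    (\<exists>G. finite G \<and> card G \<le> M \<and> G \<subseteq> polyfun m \<and>
      (\<forall>z z'. (\<forall>g\<in>G. g z > 0 \<longleftrightarrow> g z' > 0) \<longrightarrow> lp_feasible \<A> UNIV z = lp_feasible \<A> UNIV z'))"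
    using lp_feasible_sign_determined[OF finite_class.finite_UNIV, of K 1] by (elim exE) (erule that)
  show ?thesis
  proof (rule exI[of _ M], rule exI[of _ m], intro allI)
    fix c0 :: "'d option" and V :: "'d option \<Rightarrow> 'w \<Rightarrow> real ^ 'd"
    define ver where "ver z = (\<lambda>k. \<chi> t. z $ (k, t))" for z :: "real ^ ('w \<times> 'd)"
    define W where "W z = V(c0 := ver z)" for z
    define a where "a i p z = sep_coeff (fst i) (W z (fst (snd i)) (snd (snd i))) p"
      for i p and z :: "real ^ ('w \<times> 'd)"
    define I where "I = {i :: 'd option \<times> 'd option \<times> 'w. fst (snd i) \<noteq> fst i}"
    define \<A> where "\<A> = a ` I"
    have "finite \<A>" by (simp add: \<A>_def)
    moreover have "card \<A> \<le> K"
      unfolding \<A>_def K_def by (rule order_trans[OF card_image_le card_mono]) auto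
    moreover have "a i p \<in> polyfun 1" for i p
    proof -
      have h: "(\<lambda>z. homog (W z c k) j) \<in> polyfun 1" for c k j
      proof (cases "c = c0")
        case True
        then show ?thesis
          using polyfun_coordinate[of _ 0] by (cases j) (auto simp: W_def ver_def polyfun_const)
      next
        case False
        then show ?thesis by (simp add: W_def polyfun_const)
      qed
      show ?thesis
        unfolding a_def using h
        by (cases "fst i"; cases "Some (fst p) = fst i") (simp_all add: polyfun_const polyfun_uminus)
    qed
    ultimately obtain G where G: "finite G \<and> card G \<le> M \<and> G \<subseteq> polyfun m \<and>
      (\<forall>z z'. (\<forall>g\<in>G. g z > 0 \<longleftrightarrow> g z' > 0) \<longrightarrow> lp_feasible \<A> UNIV z = lp_feasible \<A> UNIV z')"
      using Mm[THEN spec, of \<A>] by (auto simp: \<A>_def)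
    have "hull_loose (W z) \<longleftrightarrow> \<not> lp_feasible \<A> UNIV z" for z
      unfolding hull_loose_iff lp_feasible_def \<A>_def I_def a_def by auto
    then show "\<exists>G :: (real ^ ('w \<times> 'd) \<Rightarrow> real) set. finite G \<and> card G \<le> M \<and> G \<subseteq> polyfun m \<and>
      (\<forall>z z'. (\<forall>g\<in>G. g z > 0 \<longleftrightarrow> g z' > 0) \<longrightarrow>
        hull_loose (V(c0 := (\<lambda>k. \<chi> t. z $ (k, t)))) = hull_loose (V(c0 := (\<lambda>k. \<chi> t. z' $ (k, t)))))"
      using G unfolding ver_def[symmetric] W_def[symmetric] by (intro exI[of _ G]) simp
  qed
qed

section \<open>Packing of simplices by their looseness patterns\<close>

text \<open>Greedy choice: some \<open>e\<close> separates a fraction \<open>\<delta>\<close> of the pairs that are still unseparated.\<close>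

lemma exists_separating_sample:
  assumes "finite E" "E \<noteq> {}" "finite PP" "\<delta> \<le> 1"
    and sep: "\<And>p. p \<in> PP \<Longrightarrow> \<delta> * real (card E) \<le> real (card {e\<in>E. sep e p})"
  shows "\<exists>A\<subseteq>E. card A \<le> m \<and> real (card {p\<in>PP. \<forall>e\<in>A. \<not> sep e p}) \<le> (1 - \<delta>) ^ m * real (card PP)"
proof (induction m)
  case 0
  show ?case by (intro exI[of _ "{}"]) simp
next
  case (Suc m)
  then obtain A where A: "A \<subseteq> E" "card A \<le> m"
    "real (card {p\<in>PP. \<forall>e\<in>A. \<not> sep e p}) \<le> (1 - \<delta>) ^ m * real (card PP)" by blast
  define Q where "Q = {p\<in>PP. \<forall>e\<in>A. \<not> sep e p}"
  have fQ: "finite Q" using assms(3) by (simp add: Q_def)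
  have "\<exists>e\<in>E. \<delta> * real (card Q) \<le> real (card {p\<in>Q. sep e p})"
  proof (rule ccontr)
    assume "\<not> ?thesis"
    then have "(\<Sum>e\<in>E. real (card {p\<in>Q. sep e p})) < (\<Sum>e\<in>E. \<delta> * real (card Q))"
      using assms(1,2) by (intro sum_strict_mono) auto
    also have "\<dots> = (\<Sum>p\<in>Q. \<delta> * real (card E))" by simp
    also have "\<dots> \<le> (\<Sum>p\<in>Q. real (card {e\<in>E. sep e p}))"
      by (intro sum_mono sep) (simp add: Q_def)
    also have "\<dots> = (\<Sum>e\<in>E. real (card {p\<in>Q. sep e p}))"
    proof -
      have "(\<Sum>p\<in>Q. card {e\<in>E. sep e p}) = (\<Sum>e\<in>E. card {p\<in>Q. sep e p})"
        using sum_card_image sum_multicount_gen[OF fQ assms(1), of "\<lambda>p e. sep e p" "\<lambda>e. card {p\<in>Q. sep e p}"] by simp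
      then show ?thesis by (metis (no_types, lifting) of_nat_sum sum.cong)
    qed
    finally show False by simp
  qed
  then obtain e where e: "e \<in> E" "\<delta> * real (card Q) \<le> real (card {p\<in>Q. sep e p})" by blast
  have fA: "finite A" using A(1) assms(1) finite_subset by blast
  have "{p\<in>PP. \<forall>e'\<in>insert e A. \<not> sep e' p} = Q - {p\<in>Q. sep e p}" by (auto simp: Q_def)
  then have "real (card {p\<in>PP. \<forall>e'\<in>insert e A. \<not> sep e' p}) = real (card Q) - real (card {p\<in>Q. sep e p})"
    using fQ by (simp add: card_Diff_subset card_mono of_nat_diff)
  also have "\<dots> \<le> (1 - \<delta>) * real (card Q)" using e(2) by (simp add: algebra_simps)
  also have "\<dots> \<le> (1 - \<delta>) * ((1 - \<delta>) ^ m * real (card PP))"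
    using A(3) assms(4) by (intro mult_left_mono) (auto simp: Q_def)
  finally have "real (card {p\<in>PP. \<forall>e'\<in>insert e A. \<not> sep e' p}) \<le> (1 - \<delta>) ^ Suc m * real (card PP)" by simp
  moreover have "card (insert e A) \<le> Suc m" using A(2) fA card_insert_le_m1 by (auto simp: card_insert_if)
  ultimately show ?case using e(1) A(1) by (intro exI[of _ "insert e A"]) simp
qed

text \<open>Here \<open>\<gamma>\<close> equals \<open>1 / D - 1 / D'\<close>. Since
  \<open>ln N \<le> N powr \<gamma> / \<gamma>\<close>, the logarithm costs a factor
  \<open>N powr (\<gamma> * D)\<close>; moving it to the left leaves
  \<open>N powr (D / D')\<close>.\<close>

lemma le_of_log_power_bound:
  fixes N K \<delta> :: real
  assumes "1 \<le> N" "K > 0" "\<delta> > 0" "0 < D" "D < D'"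
    and N: "N \<le> (K * (1 + ln N) / \<delta>) ^ D"
  defines "\<gamma> \<equiv> (real D' - real D) / (real D * real D')"
  shows "N \<le> (K * (1 + 1 / \<gamma>) / \<delta>) ^ D'"
proof -
  have g: "\<gamma> > 0" "1 - \<gamma> * real D = real D / real D'"
    using assms(4,5) by (simp_all add: \<gamma>_def field_simps)
  define t where "t = K * (1 + 1 / \<gamma>) / \<delta>"
  have t: "t > 0" using g assms by (simp add: t_def add_pos_pos)
  have "ln (N powr \<gamma>) \<le> N powr \<gamma> - 1" using assms(1) by (intro ln_le_minus_one) simp
  then have "ln N \<le> N powr \<gamma> / \<gamma>" using assms(1) g(1) by (simp add: ln_powr field_simps)
  moreover have "1 \<le> N powr \<gamma>" using assms(1) g(1) by (simp add: ge_one_powr_ge_zero)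
  ultimately have l: "1 + ln N \<le> (1 + 1 / \<gamma>) * N powr \<gamma>" by (simp add: distrib_right)
  have "K * (1 + ln N) / \<delta> \<le> K * ((1 + 1 / \<gamma>) * N powr \<gamma>) / \<delta>"
    using l assms(2,3) by (intro divide_right_mono mult_left_mono) auto
  also have "\<dots> = t * N powr \<gamma>" by (simp add: t_def)
  finally have "K * (1 + ln N) / \<delta> \<le> t * N powr \<gamma>" .
  then have "(K * (1 + ln N) / \<delta>) ^ D \<le> (t * N powr \<gamma>) ^ D"
    using assms(1-3) by (intro power_mono) auto
  also have "\<dots> = t ^ D * N powr (\<gamma> * real D)"
    using assms(1) by (simp add: power_mult_distrib powr_powr[symmetric] powr_realpow)
  finally have "N \<le> t ^ D * N powr (\<gamma> * real D)" using N by simp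
  then have "N powr 1 / N powr (\<gamma> * real D) \<le> t ^ D" using assms(1) by (simp add: field_simps)
  then have "N powr (real D / real D') \<le> t powr real D"
    unfolding powr_diff[symmetric] g(2) using t by (simp add: powr_realpow)
  then have "(N powr (real D / real D')) powr (real D' / real D) \<le> (t powr real D) powr (real D' / real D)"
    by (intro powr_mono2) auto
  then have "N \<le> t powr real D'" using assms(1,4,5) by (simp add: powr_powr)
  then show ?thesis using t by (simp add: powr_realpow t_def)
qed

text \<open>Any exponent above \<open>CARD('v)\<close> absorbs the logarithm lost in the sampling.\<close>

lemma card_separated_le:
  assumes "CARD('v::finite) < D'"
  shows "\<exists>K>0. \<forall>(R :: 'e \<Rightarrow> 'i \<Rightarrow> bool) (z :: 'i \<Rightarrow> real ^ 'v) E S (\<delta>::real).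
    finite E \<longrightarrow> E \<noteq> {} \<longrightarrow> finite S \<longrightarrow> 0 < \<delta> \<longrightarrow> \<delta> \<le> 1 \<longrightarrow>
    (\<forall>e\<in>E. \<exists>G. finite G \<and> card G \<le> M \<and> G \<subseteq> polyfun n \<and>
      (\<forall>i\<in>S. \<forall>j\<in>S. (\<forall>g\<in>G. g (z i) > 0 \<longleftrightarrow> g (z j) > 0) \<longrightarrow> R e i = R e j)) \<longrightarrow>
    (\<forall>i\<in>S. \<forall>j\<in>S. i \<noteq> j \<longrightarrow> \<delta> * real (card E) \<le> real (card {e\<in>E. R e i \<noteq> R e j})) \<longrightarrow>
    real (card S) \<le> (K / \<delta>) ^ D'"
proof -
  define D where "D = CARD('v)"
  have D: "0 < D" "D < D'" using assms by (auto simp: D_def)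
  define \<gamma> where "\<gamma> = (real D' - real D) / (real D * real D')"
  \<comment> \<open>Collects the terms of \<open>D * (m * M * n + 2) + 1\<close> after inserting
    \<open>m \<le> 2 * ln N / \<delta> + 1\<close> and \<open>1 \<le> 1 / \<delta>\<close>.\<close>
  define K0 where "K0 = 2 * real (D * M * n) + real (D * M * n) + real (2 * D + 1)"
  have K0: "K0 > 0" by (simp add: K0_def add_nonneg_pos)
  have g: "\<gamma> > 0" using D by (simp add: \<gamma>_def)
  show ?thesis
  proof (rule exI[of _ "K0 * (1 + 1 / \<gamma>)"], intro conjI allI impI)
    show "K0 * (1 + 1 / \<gamma>) > 0" using K0 g by (simp add: add_pos_pos)
    fix R :: "'e \<Rightarrow> 'i \<Rightarrow> bool" and z :: "'i \<Rightarrow> real ^ 'v" and E S and \<delta> :: real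
    assume fin: "finite E" "E \<noteq> {}" "finite S" and \<delta>: "0 < \<delta>" "\<delta> \<le> 1"
      and G: "\<forall>e\<in>E. \<exists>G. finite G \<and> card G \<le> M \<and> G \<subseteq> polyfun n \<and>
      (\<forall>i\<in>S. \<forall>j\<in>S. (\<forall>g\<in>G. g (z i) > 0 \<longleftrightarrow> g (z j) > 0) \<longrightarrow> R e i = R e j)"
      and sep: "\<forall>i\<in>S. \<forall>j\<in>S. i \<noteq> j \<longrightarrow> \<delta> * real (card E) \<le> real (card {e\<in>E. R e i \<noteq> R e j})"
    show "real (card S) \<le> (K0 * (1 + 1 / \<gamma>) / \<delta>) ^ D'"
    proof (cases "S = {}")
      case True
      then show ?thesis using K0 g \<delta> by simp
    next
      case False
      define N where "N = card S"
      have N1: "N \<ge> 1" using False fin by (simp add: N_def Suc_le_eq card_gt_0_iff)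
      \<comment> \<open>A sample size just above \<open>2 * ln N / \<delta>\<close>: then
        \<open>(1 - \<delta>) ^ m * N ^ 2 < 1\<close>, so no pair stays unseparated.\<close>
      define m where "m = nat \<lfloor>2 * ln N / \<delta>\<rfloor> + 1"
      have "0 \<le> 2 * ln N / \<delta>" using N1 \<delta> by simp
      then have m: "2 * ln N / \<delta> < real m" "real m \<le> 2 * ln N / \<delta> + 1"
        unfolding m_def by linarith+
      define PP where "PP = {p\<in>S \<times> S. fst p \<noteq> snd p}"
      have fPP: "finite PP" using fin by (simp add: PP_def)
      obtain A where A: "A \<subseteq> E" "card A \<le> m"
        "real (card {p\<in>PP. \<forall>e\<in>A. \<not> R e (fst p) \<noteq> R e (snd p)}) \<le> (1 - \<delta>) ^ m * real (card PP)"
        using exists_separating_sample[OF fin(1,2) fPP \<delta>(2), of "\<lambda>e p. R e (fst p) \<noteq> R e (snd p)" m] sep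
        by (auto simp: PP_def)
      have "real (card PP) \<le> real N ^ 2"
      proof -
        have "card PP \<le> card (S \<times> S)" using fin by (intro card_mono) (auto simp: PP_def)
        then show ?thesis by (simp add: card_cartesian_product N_def power2_eq_square flip: of_nat_mult)
      qed
      moreover have "(1 - \<delta>) ^ m * real N ^ 2 < 1"
      proof -
        have "1 - \<delta> \<le> exp (- \<delta>)" using exp_ge_add_one_self[of "- \<delta>"] by simp
        then have "(1 - \<delta>) ^ m \<le> exp (- \<delta>) ^ m" using \<delta> by (intro power_mono) auto
        also have "\<dots> = exp (- (\<delta> * real m))" by (simp add: exp_of_nat_mult[symmetric] mult.commute)
        finally have 1: "(1 - \<delta>) ^ m * real N ^ 2 \<le> exp (- (\<delta> * real m)) * real N ^ 2"
          by (simp add: mult_right_mono)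
        have "real N ^ 2 = exp (2 * ln N)" using N1 exp_of_nat_mult[of 2 "ln (real N)"] by simp
        then have "exp (- (\<delta> * real m)) * real N ^ 2 = exp (2 * ln N - \<delta> * real m)" by (simp add: exp_add[symmetric])
        also have "\<dots> < 1" using m(1) \<delta> by (simp add: field_simps)
        finally show ?thesis using 1 by simp
      qed
      ultimately have "(1 - \<delta>) ^ m * real (card PP) < 1"
        using \<delta> by (smt (verit) mult_left_mono zero_le_power)
      then have "card {p\<in>PP. \<forall>e\<in>A. \<not> R e (fst p) \<noteq> R e (snd p)} = 0" using A(3) by linarith
      then have all: "\<exists>e\<in>A. R e i \<noteq> R e j" if "i \<in> S" "j \<in> S" "i \<noteq> j" for i j
      proof -
        have "{p\<in>PP. \<forall>e\<in>A. \<not> R e (fst p) \<noteq> R e (snd p)} = {}" using fPP \<open>card _ = 0\<close> by simp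
        moreover have "(i, j) \<in> PP" using that by (simp add: PP_def)
        ultimately show ?thesis by fastforce
      qed
      have "\<exists>H. \<forall>e\<in>E. finite (H e) \<and> card (H e) \<le> M \<and> H e \<subseteq> polyfun n \<and>
        (\<forall>i\<in>S. \<forall>j\<in>S. (\<forall>g\<in>H e. g (z i) > 0 \<longleftrightarrow> g (z j) > 0) \<longrightarrow> R e i = R e j)"
        using G by (rule bchoice)
      then obtain H where H0: "\<forall>e\<in>E. finite (H e) \<and> card (H e) \<le> M \<and> H e \<subseteq> polyfun n \<and>
        (\<forall>i\<in>S. \<forall>j\<in>S. (\<forall>g\<in>H e. g (z i) > 0 \<longleftrightarrow> g (z j) > 0) \<longrightarrow> R e i = R e j)"
        by (elim exE) (erule that)
      have H: "finite (H e)" "card (H e) \<le> M" "H e \<subseteq> polyfun n"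
        "i \<in> S \<Longrightarrow> j \<in> S \<Longrightarrow> (\<forall>g\<in>H e. g (z i) > 0 \<longleftrightarrow> g (z j) > 0) \<Longrightarrow> R e i = R e j" if "e \<in> A" for e i j
      proof -
        note b = bspec[OF H0 subsetD[OF A(1) that]]
        show "finite (H e)" "card (H e) \<le> M" "H e \<subseteq> polyfun n" 
          by (rule b[THEN conjunct1], rule b[THEN conjunct2, THEN conjunct1], rule b[THEN conjunct2, THEN conjunct2, THEN conjunct1])
        show "R e i = R e j" if "i \<in> S" "j \<in> S" "\<forall>g\<in>H e. g (z i) > 0 \<longleftrightarrow> g (z j) > 0"
          by (rule b[THEN conjunct2, THEN conjunct2, THEN conjunct2, THEN bspec, THEN bspec, THEN mp, OF that])
      qed
      have fA: "finite A" using A(1) fin(1) finite_subset by blast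
      \<comment> \<open>All polynomials of the sampled tests: distinct elements of \<open>S\<close>
        have distinct positivity patterns on \<open>U\<close>, and \<open>card U\<close> is at most
        \<open>m * M\<close>.\<close>
      define U where "U = (\<Union>e\<in>A. H e)"
      have U: "finite U" "U \<subseteq> polyfun n" using fA H by (auto simp: U_def)
      have "card U \<le> (\<Sum>e\<in>A. card (H e))" unfolding U_def by (rule card_UN_le[OF fA])
      also have "\<dots> \<le> card A * M"
        using sum_bounded_above[of A "\<lambda>e. card (H e)" M, OF H(2)] by (simp only: of_nat_id)
      also have "\<dots> \<le> m * M" using A(2) by simp
      finally have cU: "card U \<le> m * M" .
      have inj: "inj_on (\<lambda>i. {g\<in>U. g (z i) > 0}) S"
      proof (rule inj_onI, rule ccontr)
        fix i j assume ij: "i \<in> S" "j \<in> S" "{g\<in>U. g (z i) > 0} = {g\<in>U. g (z j) > 0}" "i \<noteq> j"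
        obtain e where e: "e \<in> A" "R e i \<noteq> R e j" using all ij by blast
        have "\<forall>g\<in>H e. g (z i) > 0 \<longleftrightarrow> g (z j) > 0" using ij(3) e(1) by (auto simp: U_def)
        then show False using H(4)[OF e(1) ij(1,2)] e(2) by blast
      qed
      have iz: "inj_on z S" using inj by (auto simp: inj_on_def)
      have "inj_on (\<lambda>x. {g\<in>U. g x > 0}) (z ` S)" using inj by (auto simp: inj_on_def)
      then have "card (z ` S) \<le> (D * (card U * n + 2) + 1) ^ D"
        unfolding D_def using U fin by (intro card_positivity_patterns) auto
      also have "\<dots> \<le> (D * (m * M * n + 2) + 1) ^ D"
        using cU by (intro power_mono add_mono mult_le_mono) auto
      finally have "N \<le> (D * (m * M * n + 2) + 1) ^ D" using iz by (simp only: card_image N_def)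
      then have "real N \<le> real (D * (m * M * n + 2) + 1) ^ D" unfolding of_nat_power[symmetric] by (rule of_nat_mono)
      also have "\<dots> \<le> (K0 * (1 + ln N) / \<delta>) ^ D"
      proof (rule power_mono)
        have l: "0 \<le> ln (real N)" using N1 by simp
        define A where "A = real (D * M * n)"
        define B where "B = real (2 * D + 1)"
        have AB: "A \<ge> 0" "B \<ge> 0" by (auto simp: A_def B_def)
        have "real (D * (m * M * n + 2) + 1) = A * real m + B" by (simp add: A_def B_def algebra_simps)
        also have "\<dots> \<le> A * (2 * ln N / \<delta> + 1) + B" using m(2) AB by (intro add_mono mult_left_mono) auto
        also have "\<dots> \<le> A * (2 * ln N / \<delta> + 1 / \<delta>) + B / \<delta>"
          using \<delta> AB by (intro add_mono mult_left_mono) (auto simp: field_simps mult_left_le)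
        also have "\<dots> = (2 * A * ln N + A + B) / \<delta>" by (simp add: distrib_left add_divide_distrib)
        also have "\<dots> \<le> K0 * (1 + ln N) / \<delta>"
        proof (rule divide_right_mono)
          have "K0 = 2 * A + A + B" by (simp add: K0_def A_def B_def)
          moreover have "A * ln N \<ge> 0" "B * ln N \<ge> 0" using AB l by auto
          ultimately show "2 * A * ln N + A + B \<le> K0 * (1 + ln N)" using AB by (simp add: algebra_simps)
        qed (use \<delta> in simp)
        finally show "real (D * (m * M * n + 2) + 1) \<le> K0 * (1 + ln N) / \<delta>" .
      qed simp
      finally have "real N \<le> (K0 * (1 + ln N) / \<delta>) ^ D" .
      then have "real N \<le> (K0 * (1 + 1 / \<gamma>) / \<delta>) ^ D'"
        unfolding \<gamma>_def using N1 K0 \<delta> D by (intro le_of_log_power_bound) auto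
      then show ?thesis by (simp add: N_def)
    qed
  qed
qed

section \<open>Cofillings modulo 2 in the complete multipartite complex\<close>

text \<open>By default the simplifier turns addition of bits into exclusive disjunction.\<close>

declare add_bit_eq_xor [simp del] mult_bit_eq_and [simp del] bit_not_zero_iff [simp del] bit_not_one_iff [simp del]

lemma bit_double [simp]: "x + x = (0::bit)"
  by (cases x) (simp_all add: add_bit_eq_xor)

lemma bit_double_left [simp]: "x + (x + y) = (y::bit)"
  by (simp only: add.assoc[symmetric] bit_double add_0)

text \<open>The terms for \<open>(x, y)\<close> and \<open>(y, x)\<close> cancel mod 2. The
  vanishing of a double coboundary and of a double cubical boundary both rest on this.\<close>

lemma symmetric_double_sum_bit:
  fixes g :: "'a \<Rightarrow> 'a \<Rightarrow> bit"
  assumes "finite S" "\<And>x y. g x y = g y x"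
  shows "(\<Sum>x\<in>S. \<Sum>y\<in>S - {x}. g x y) = 0"
  using assms(1)
proof (induction S rule: finite_induct)
  case (insert a S)
  have "(\<Sum>x\<in>insert a S. \<Sum>y\<in>insert a S - {x}. g x y)
      = (\<Sum>y\<in>S. g a y) + (\<Sum>x\<in>S. \<Sum>y\<in>insert a S - {x}. g x y)"
    using insert.hyps by (simp add: insert_Diff_if)
  also have "(\<Sum>x\<in>S. \<Sum>y\<in>insert a S - {x}. g x y) = (\<Sum>x\<in>S. g x a + (\<Sum>y\<in>S - {x}. g x y))"
  proof (intro sum.cong refl)
    fix x assume "x \<in> S"
    then have "insert a S - {x} = insert a (S - {x})" using insert.hyps by auto
    then show "(\<Sum>y\<in>insert a S - {x}. g x y) = g x a + (\<Sum>y\<in>S - {x}. g x y)"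
      using insert.hyps by simp
  qed
  also have "\<dots> = (\<Sum>x\<in>S. g x a)" using insert.IH by (simp add: sum.distrib)
  also have "(\<Sum>x\<in>S. g x a) = (\<Sum>y\<in>S. g a y)" by (intro sum.cong refl assms(2))
  finally show ?case by simp
qed simp

text \<open>A face of the complete multipartite complex has at most one vertex per colour and is
  encoded as a partial map; the empty face is included, so the complex is augmented. One function
  carries cochains of every dimension.\<close>

definition coboundary :: "(('c::finite \<Rightarrow> 'i option) \<Rightarrow> bit) \<Rightarrow> ('c \<Rightarrow> 'i option) \<Rightarrow> bit" where
  "coboundary A f = (\<Sum>x\<in>dom f. A (f(x := None)))"

definition cone_at :: "'c \<Rightarrow> 'i \<Rightarrow> (('c::finite \<Rightarrow> 'i option) \<Rightarrow> bit) \<Rightarrow> ('c \<Rightarrow> 'i option) \<Rightarrow> bit" where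
  "cone_at c v A f = (if c \<in> dom f then 0 else A (f(c := Some v)))"

definition pushed :: "'c \<Rightarrow> 'i \<Rightarrow> (('c::finite \<Rightarrow> 'i option) \<Rightarrow> bit) \<Rightarrow> ('c \<Rightarrow> 'i option) \<Rightarrow> bit" where
  "pushed c v A f = (if c \<in> dom f then A f + A (f(c := Some v)) else 0)"

lemma coboundary_add: "coboundary (\<lambda>f. A f + B f) f = coboundary A f + coboundary B f"
  by (simp add: coboundary_def sum.distrib)

lemma coboundary_zero [simp]: "coboundary (\<lambda>f. 0) f = 0"
  by (simp add: coboundary_def)

lemma coboundary_sum: "coboundary (\<lambda>f. \<Sum>i\<in>I. A i f) f = (\<Sum>i\<in>I. coboundary (A i) f)"
  unfolding coboundary_def by (rule sum.swap)

lemma coboundary_coboundary [simp]: "coboundary (coboundary A) f = 0"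
proof -
  have "coboundary (coboundary A) f = (\<Sum>x\<in>dom f. \<Sum>y\<in>dom f - {x}. A (f(x := None, y := None)))"
    unfolding coboundary_def by (intro sum.cong) auto
  also have "\<dots> = 0"
  proof (rule symmetric_double_sum_bit)
    show "A (f(x := None, y := None)) = A (f(y := None, x := None))" for x y
      by (cases "x = y") (simp_all add: fun_upd_twist)
  qed simp
  finally show ?thesis .
qed

text \<open>The contraction towards the vertex \<open>v\<close> of colour \<open>c\<close>; faces that already have colour \<open>c\<close>
  leave a remainder supported on such faces.\<close>

lemma cone_homotopy: "A f = coboundary (cone_at c v A) f + cone_at c v (coboundary A) f + pushed c v A f"
proof (cases "c \<in> dom f")
  case False
  have "coboundary (cone_at c v A) f = (\<Sum>x\<in>dom f. A (f(c := Some v, x := None)))"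
    unfolding coboundary_def
  proof (intro sum.cong refl)
    fix x assume "x \<in> dom f"
    then have "x \<noteq> c" using False by blast
    then have "f(x := None, c := Some v) = f(c := Some v, x := None)" by (rule fun_upd_twist)
    then show "cone_at c v A (f(x := None)) = A (f(c := Some v, x := None))"
      using False by (simp add: cone_at_def)
  qed
  moreover have "cone_at c v (coboundary A) f = A f + (\<Sum>x\<in>dom f. A (f(c := Some v, x := None)))"
  proof -
    have "f(c := None) = f" using False by auto
    moreover have "dom (f(c := Some v)) = insert c (dom f)" by auto
    ultimately show ?thesis using False by (simp add: cone_at_def coboundary_def)
  qed
  ultimately show ?thesis using False by (simp add: pushed_def add.commute)
next
  case True
  have "coboundary (cone_at c v A) f = (\<Sum>x\<in>dom f. if x = c then A (f(c := Some v)) else 0)"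
    unfolding coboundary_def using True by (intro sum.cong) (auto simp: cone_at_def)
  then show ?thesis using True by (simp add: cone_at_def pushed_def add_ac)
qed

section \<open>Normalised sizes and the cofilling inequality\<close>

locale partite_complex =
  fixes W :: "'c::finite \<Rightarrow> 'i set"
  assumes finite_W: "finite (W c)" and W_nonempty: "W c \<noteq> {}"
begin

definition faces :: "('c \<Rightarrow> 'i option) set" where
  "faces = {f. \<forall>c\<in>dom f. the (f c) \<in> W c}"

text \<open>Among the faces with a given set of colours this is the uniform probability, see
  \<open>density_dom\<close>; \<open>size_of\<close> adds these probabilities over all sets of
  colours.\<close>

definition weight :: "('c \<Rightarrow> 'i option) \<Rightarrow> real" where
  "weight f = (\<Prod>c\<in>dom f. 1 / real (card (W c)))"

definition size_of :: "(('c \<Rightarrow> 'i option) \<Rightarrow> bit) \<Rightarrow> real" where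
  "size_of A = (\<Sum>f\<in>faces. if A f = 0 then 0 else weight f)"

lemma card_W_pos: "real (card (W c)) > 0"
  using finite_W W_nonempty by (simp add: card_gt_0_iff)

lemma weight_pos: "weight f > 0"
  unfolding weight_def using card_W_pos by (intro prod_pos) simp

lemma finite_faces: "finite faces"
proof -
  have "faces \<subseteq> (UNIV :: 'c set) \<rightarrow>\<^sub>E insert None (Some ` (\<Union>c. W c))"
  proof
    fix f assume f: "f \<in> faces"
    have "f c \<in> insert None (Some ` (\<Union>c. W c))" for c
    proof (cases "f c")
      case (Some i)
      then have "i \<in> W c" using f by (force simp: faces_def)
      then show ?thesis using Some by blast
    qed simp
    then show "f \<in> (UNIV :: 'c set) \<rightarrow>\<^sub>E insert None (Some ` (\<Union>c. W c))" by (simp add: PiE_def)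
  qed
  moreover have "finite ((UNIV :: 'c set) \<rightarrow>\<^sub>E insert None (Some ` (\<Union>c. W c)))"
    using finite_W by (intro finite_PiE) auto
  ultimately show ?thesis by (rule finite_subset)
qed

lemma face_delete: "f \<in> faces \<Longrightarrow> f(c := None) \<in> faces"
  by (auto simp: faces_def)

lemma face_insert: "f \<in> faces \<Longrightarrow> v \<in> W c \<Longrightarrow> f(c := Some v) \<in> faces"
  by (auto simp: faces_def)

lemma weight_insert: "c \<notin> dom f \<Longrightarrow> weight (f(c := Some v)) = weight f / real (card (W c))"
  by (simp add: weight_def)

lemma size_of_nonneg: "size_of A \<ge> 0"
  unfolding size_of_def using weight_pos by (intro sum_nonneg) (simp add: less_imp_le)

lemma size_of_add: "size_of (\<lambda>f. A f + B f) \<le> size_of A + size_of B"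
  unfolding size_of_def sum.distrib[symmetric] using weight_pos
  by (intro sum_mono) (auto simp: less_imp_le intro: order_trans)

lemma size_of_sum: "finite I \<Longrightarrow> size_of (\<lambda>f. \<Sum>i\<in>I. A i f) \<le> (\<Sum>i\<in>I. size_of (A i))"
proof (induction I rule: finite_induct)
  case (insert i I)
  then show ?case using size_of_add[of "A i" "\<lambda>f. \<Sum>i\<in>I. A i f"] by simp
qed (simp add: size_of_def)

lemma sum_faces_with_colour:
  "(\<Sum>g\<in>{g\<in>faces. c \<in> dom g}. h g) = (\<Sum>v\<in>W c. \<Sum>f\<in>{f\<in>faces. c \<notin> dom f}. h (f(c := Some v)))"
proof -
  define S where "S = {f\<in>faces. c \<notin> dom f}"
  have "bij_betw (\<lambda>p. (snd p)(c := Some (fst p))) (W c \<times> S) {g\<in>faces. c \<in> dom g}"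
  proof (rule bij_betwI')
    fix p q assume pq: "p \<in> W c \<times> S" "q \<in> W c \<times> S"
    show "((snd p)(c := Some (fst p)) = (snd q)(c := Some (fst q))) = (p = q)"
    proof
      assume eq: "(snd p)(c := Some (fst p)) = (snd q)(c := Some (fst q))"
      have "snd p x = snd q x" for x
      proof (cases "x = c")
        case True
        then show ?thesis using pq by (simp add: S_def mem_Times_iff domIff)
      next
        case False
        then show ?thesis using fun_cong[OF eq, of x] by simp
      qed
      moreover have "fst p = fst q" using fun_cong[OF eq, of c] by simp
      ultimately show "p = q" by (simp add: prod_eq_iff fun_eq_iff)
    qed simp
  next
    fix p assume "p \<in> W c \<times> S"
    then show "(snd p)(c := Some (fst p)) \<in> {g\<in>faces. c \<in> dom g}"
      by (auto simp: S_def intro!: face_insert)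
  next
    fix g assume g: "g \<in> {g\<in>faces. c \<in> dom g}"
    then have "the (g c) \<in> W c" by (simp add: faces_def)
    moreover have "g(c := None) \<in> S" using g by (simp add: S_def face_delete)
    moreover have "g = (g(c := None))(c := Some (the (g c)))" using g by auto
    ultimately show "\<exists>p\<in>W c \<times> S. g = (snd p)(c := Some (fst p))"
      by (intro bexI[of _ "(the (g c), g(c := None))"]) simp_all
  qed
  then have "(\<Sum>p\<in>W c \<times> S. h ((snd p)(c := Some (fst p)))) = (\<Sum>g\<in>{g\<in>faces. c \<in> dom g}. h g)"
    by (rule sum.reindex_bij_betw)
  then show ?thesis unfolding S_def[symmetric] by (simp add: sum.cartesian_product case_prod_beta)
qed

lemma size_of_cone:
  "size_of (cone_at c v A) = (\<Sum>f\<in>{f\<in>faces. c \<notin> dom f}. if A (f(c := Some v)) = 0 then 0 else weight f)"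
  unfolding size_of_def using finite_faces
  by (intro sum.mono_neutral_cong_right) (auto simp: cone_at_def)

text \<open>A face without colour \<open>c\<close> weighs \<open>card (W c)\<close> times as much as
  its extension by a vertex of \<open>W c\<close>. Hence for a random vertex the expected size of
  the cone is at most that of \<open>A\<close>.\<close>

lemma sum_cone_size: "(\<Sum>v\<in>W c. size_of (cone_at c v A)) \<le> real (card (W c)) * size_of A"
proof -
  define S where "S = {f\<in>faces. c \<notin> dom f}"
  have "(\<Sum>v\<in>W c. size_of (cone_at c v A))
      = (\<Sum>v\<in>W c. \<Sum>f\<in>S. real (card (W c)) * (if A (f(c := Some v)) = 0 then 0 else weight (f(c := Some v))))"
    unfolding size_of_cone S_def[symmetric] using card_W_pos[of c]
    by (intro sum.cong refl) (simp add: S_def weight_insert)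
  also have "\<dots> = real (card (W c)) * (\<Sum>g\<in>{g\<in>faces. c \<in> dom g}. if A g = 0 then 0 else weight g)"
    unfolding sum_faces_with_colour S_def[symmetric] by (simp add: sum_distrib_left)
  also have "\<dots> \<le> real (card (W c)) * size_of A"
    unfolding size_of_def using finite_faces weight_pos
    by (intro mult_left_mono sum_mono2) (auto simp: less_imp_le)
  finally show ?thesis .
qed

text \<open>The second summand of \<open>pushed\<close> does not depend on which vertex of colour
  \<open>c\<close> the face had; summing its weight over these vertices gives exactly the size of
  the cone.\<close>

lemma size_of_pushed: "size_of (pushed c v A) \<le> size_of A + size_of (cone_at c v A)"
proof -
  define S where "S = {f\<in>faces. c \<in> dom f}"
  have "size_of (pushed c v A) = (\<Sum>f\<in>S. if A f + A (f(c := Some v)) = 0 then 0 else weight f)"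
    unfolding size_of_def S_def using finite_faces
    by (intro sum.mono_neutral_cong_right) (auto simp: pushed_def)
  also have "\<dots> \<le> (\<Sum>f\<in>S. (if A f = 0 then 0 else weight f) + (if A (f(c := Some v)) = 0 then 0 else weight f))"
    using weight_pos by (intro sum_mono) (auto simp: less_imp_le)
  also have "\<dots> = (\<Sum>f\<in>S. if A f = 0 then 0 else weight f) + (\<Sum>f\<in>S. if A (f(c := Some v)) = 0 then 0 else weight f)"
    by (simp add: sum.distrib)
  also have "(\<Sum>f\<in>S. if A f = 0 then 0 else weight f) \<le> size_of A"
    unfolding size_of_def using finite_faces weight_pos by (intro sum_mono2) (auto simp: S_def less_imp_le)
  also have "(\<Sum>f\<in>S. if A (f(c := Some v)) = 0 then 0 else weight f) = size_of (cone_at c v A)"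
  proof -
    have "(\<Sum>f\<in>S. if A (f(c := Some v)) = 0 then 0 else weight f)
      = (\<Sum>w\<in>W c. \<Sum>f\<in>{f\<in>faces. c \<notin> dom f}. (if A (f(c := Some v)) = 0 then 0 else weight f) / real (card (W c)))"
      unfolding S_def sum_faces_with_colour by (intro sum.cong refl) (simp add: weight_insert)
    also have "\<dots> = size_of (cone_at c v A)"
      unfolding size_of_cone using card_W_pos[of c] by (simp add: sum_divide_distrib[symmetric])
    finally show ?thesis .
  qed
  finally show ?thesis by simp
qed

lemma exists_good_vertex:
  "\<exists>v\<in>W c. size_of (cone_at c v A) \<le> size_of A \<and> size_of (pushed c v A) \<le> 2 * size_of A"
proof -
  have "\<exists>v\<in>W c. size_of (cone_at c v A) \<le> size_of A"
  proof (rule ccontr)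
    assume "\<not> ?thesis"
    then have "(\<Sum>v\<in>W c. size_of A) < (\<Sum>v\<in>W c. size_of (cone_at c v A))"
      using finite_W W_nonempty by (intro sum_strict_mono) auto
    then show False using sum_cone_size[of c A] by simp
  qed
  then obtain v where "v \<in> W c" "size_of (cone_at c v A) \<le> size_of A" by blast
  then show ?thesis using size_of_pushed[of c v A] by (intro bexI[of _ v]) auto
qed

definition homogeneous :: "nat \<Rightarrow> (('c \<Rightarrow> 'i option) \<Rightarrow> bit) \<Rightarrow> bool" where
  "homogeneous n A \<longleftrightarrow> (\<forall>f\<in>faces. A f \<noteq> 0 \<longrightarrow> card (dom f) = n)"

text \<open>Contract towards a good vertex of one colour after another. Every step moves the
  remainder onto faces that contain this colour and at most doubles it; the cones add up to
  \<open>2 ^ card S - 1\<close> times \<open>A\<close> as a geometric sum. The last clause carries a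
  primitive of \<open>A\<close> along: in top dimension every cochain is a cocycle, so there the
  vanishing of the remainder has to come from a primitive.\<close>

lemma cofilling_step:
  fixes A :: "('c \<Rightarrow> 'i option) \<Rightarrow> bit"
  assumes "finite S" "homogeneous (Suc n) A" "\<forall>f\<in>faces. coboundary A f = 0"
  shows "\<exists>D B. (\<forall>f\<in>faces. A f = coboundary D f + B f) \<and> homogeneous n D \<and> homogeneous (Suc n) B \<and>
    (\<forall>f\<in>faces. coboundary B f = 0) \<and> (\<forall>f\<in>faces. B f \<noteq> 0 \<longrightarrow> S \<subseteq> dom f) \<and>
    size_of D \<le> (2 ^ card S - 1) * size_of A \<and> size_of B \<le> 2 ^ card S * size_of A \<and>
    (\<forall>A'. homogeneous n A' \<longrightarrow> (\<forall>f\<in>faces. A f = coboundary A' f) \<longrightarrow>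
      (\<exists>B'. homogeneous n B' \<and> (\<forall>f\<in>faces. B f = coboundary B' f) \<and> (\<forall>f\<in>faces. B' f \<noteq> 0 \<longrightarrow> S \<subseteq> dom f)))"
  using assms(1)
proof (induction S rule: finite_induct)
  case empty
  show ?case using assms
    by (intro exI[of _ "\<lambda>f. 0"] exI[of _ A]) (auto simp: homogeneous_def size_of_def)
next
  case (insert c S)
  from insert.IH obtain D B where DB: "\<forall>f\<in>faces. A f = coboundary D f + B f" "homogeneous n D" "homogeneous (Suc n) B"
    "\<forall>f\<in>faces. coboundary B f = 0" "\<forall>f\<in>faces. B f \<noteq> 0 \<longrightarrow> S \<subseteq> dom f"
    "size_of D \<le> (2 ^ card S - 1) * size_of A" "size_of B \<le> 2 ^ card S * size_of A"
    "\<forall>A'. homogeneous n A' \<longrightarrow> (\<forall>f\<in>faces. A f = coboundary A' f) \<longrightarrow>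
      (\<exists>B'. homogeneous n B' \<and> (\<forall>f\<in>faces. B f = coboundary B' f) \<and> (\<forall>f\<in>faces. B' f \<noteq> 0 \<longrightarrow> S \<subseteq> dom f))"
    by (elim exE conjE) (rule that; assumption)
  obtain v where v: "v \<in> W c" "size_of (cone_at c v B) \<le> size_of B" "size_of (pushed c v B) \<le> 2 * size_of B"
    using exists_good_vertex by blast
  have cone0: "cone_at c v (coboundary E) f = 0" if "f \<in> faces" "\<forall>f\<in>faces. coboundary E f = 0" for E f
    using that face_insert[OF _ v(1)] by (simp add: cone_at_def)
  have "A f = coboundary (\<lambda>f. D f + cone_at c v B f) f + pushed c v B f" if f: "f \<in> faces" for f
    using DB(1) f cone_homotopy[of B f c v] cone0[OF f DB(4)] by (simp add: coboundary_add add.assoc)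
  moreover have "homogeneous n (cone_at c v B)"
    unfolding homogeneous_def
  proof (intro ballI impI)
    fix f assume f: "f \<in> faces" "cone_at c v B f \<noteq> 0"
    then have "c \<notin> dom f" "B (f(c := Some v)) \<noteq> 0" by (auto simp: cone_at_def split: if_splits)
    moreover have "f(c := Some v) \<in> faces" using f(1) v(1) by (rule face_insert)
    ultimately have "card (dom (f(c := Some v))) = Suc n" using DB(3) unfolding homogeneous_def by blast
    then show "card (dom f) = n" using \<open>c \<notin> dom f\<close> by simp
  qed
  then have "homogeneous n (\<lambda>f. D f + cone_at c v B f)"
    using DB(2) unfolding homogeneous_def by (metis add.right_neutral)
  moreover have "homogeneous (Suc n) (pushed c v B)"
    unfolding homogeneous_def
  proof (intro ballI impI)
    fix f assume f: "f \<in> faces" "pushed c v B f \<noteq> 0"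
    then have c: "c \<in> dom f" and nz: "B f \<noteq> 0 \<or> B (f(c := Some v)) \<noteq> 0"
      by (auto simp: pushed_def split: if_splits)
    have "f(c := Some v) \<in> faces" using f(1) v(1) by (rule face_insert)
    then show "card (dom f) = Suc n"
      using nz DB(3) f(1) c unfolding homogeneous_def by (metis dom_fun_upd insert_absorb option.distinct(1))
  qed
  moreover have cB: "coboundary (pushed c v B) f = 0" if f: "f \<in> faces" for f
  proof -
    have e: "pushed c v B g = B g + coboundary (cone_at c v B) g" if "g \<in> faces" for g
      using cone_homotopy[of B g c v] cone0[OF that DB(4)] by (simp add: add.commute add.left_commute)
    have "coboundary (pushed c v B) f = coboundary (\<lambda>g. B g + coboundary (cone_at c v B) g) f"
      unfolding coboundary_def using e face_delete[OF f] by (intro sum.cong refl) (simp add: coboundary_def)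
    then show ?thesis using DB(4) f by (simp add: coboundary_add)
  qed
  moreover have "insert c S \<subseteq> dom f" if f: "f \<in> faces" "pushed c v B f \<noteq> 0" for f
  proof -
    have c: "c \<in> dom f" and nz: "B f \<noteq> 0 \<or> B (f(c := Some v)) \<noteq> 0"
      using f by (auto simp: pushed_def split: if_splits)
    have "f(c := Some v) \<in> faces" using f(1) v(1) by (rule face_insert)
    then have "S \<subseteq> dom f \<or> S \<subseteq> dom (f(c := Some v))" using nz DB(5) f(1) by blast
    then show ?thesis using c by auto
  qed
  moreover have "size_of (\<lambda>f. D f + cone_at c v B f) \<le> (2 ^ card (insert c S) - 1) * size_of A"
    using size_of_add[of D "cone_at c v B"] v(2) DB(6,7) insert.hyps by (simp add: algebra_simps)
  moreover have "size_of (pushed c v B) \<le> 2 ^ card (insert c S) * size_of A"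
    using v(3) DB(7) insert.hyps by simp
  moreover have "\<exists>B'. homogeneous n B' \<and> (\<forall>f\<in>faces. pushed c v B f = coboundary B' f) \<and> (\<forall>f\<in>faces. B' f \<noteq> 0 \<longrightarrow> insert c S \<subseteq> dom f)"
    if A': "homogeneous n A'" "\<forall>f\<in>faces. A f = coboundary A' f" for A'
  proof -
    from DB(8)[THEN spec, THEN mp, THEN mp, OF A']
    obtain B' where B': "homogeneous n B'" "\<forall>f\<in>faces. B f = coboundary B' f" "\<forall>f\<in>faces. B' f \<noteq> 0 \<longrightarrow> S \<subseteq> dom f"
      by (elim exE conjE) (rule that; assumption)
    have "pushed c v B f = coboundary (pushed c v B') f" if f: "f \<in> faces" for f
    proof -
      \<comment> \<open>Applying \<open>cone_homotopy\<close> to \<open>B'\<close> shows that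
        \<open>pushed\<close> commutes with the coboundary here, so the pushed primitive belongs to
        the pushed remainder.\<close>
      have e: "pushed c v B' = (\<lambda>g. B' g + coboundary (cone_at c v B') g + cone_at c v (coboundary B') g)"
      proof
        fix g show "pushed c v B' g = B' g + coboundary (cone_at c v B') g + cone_at c v (coboundary B') g"
          using cone_homotopy[of B' g c v] by (simp add: add_ac)
      qed
      have "coboundary (pushed c v B') f = coboundary B' f + coboundary (cone_at c v (coboundary B')) f"
        unfolding e coboundary_add by simp
      also have "coboundary (cone_at c v (coboundary B')) f = coboundary (cone_at c v B) f"
        unfolding coboundary_def[of "cone_at c v (coboundary B')"] coboundary_def[of "cone_at c v B"]
        using B'(2) face_delete[OF f] face_insert[OF _ v(1)] by (intro sum.cong refl) (simp add: cone_at_def)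
      also have "coboundary B' f + coboundary (cone_at c v B) f = pushed c v B f"
        using cone_homotopy[of B f c v] cone0[OF f DB(4)] B'(2) f by (simp add: add.commute add.left_commute)
      finally show ?thesis by simp
    qed
    moreover have "homogeneous n (pushed c v B')"
      unfolding homogeneous_def
    proof (intro ballI impI)
      fix f assume f: "f \<in> faces" "pushed c v B' f \<noteq> 0"
      then have c: "c \<in> dom f" and nz: "B' f \<noteq> 0 \<or> B' (f(c := Some v)) \<noteq> 0"
        by (auto simp: pushed_def split: if_splits)
      have "f(c := Some v) \<in> faces" using f(1) v(1) by (rule face_insert)
      then show "card (dom f) = n"
        using nz B'(1) f(1) c unfolding homogeneous_def by (metis dom_fun_upd insert_absorb option.distinct(1))
    qed
    moreover have "insert c S \<subseteq> dom f" if f: "f \<in> faces" "pushed c v B' f \<noteq> 0" for f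
    proof -
      have c: "c \<in> dom f" and nz: "B' f \<noteq> 0 \<or> B' (f(c := Some v)) \<noteq> 0"
        using f by (auto simp: pushed_def split: if_splits)
      have "f(c := Some v) \<in> faces" using f(1) v(1) by (rule face_insert)
      then have "S \<subseteq> dom f \<or> S \<subseteq> dom (f(c := Some v))" using nz B'(3) f(1) by blast
      then show ?thesis using c by auto
    qed
    ultimately show ?thesis by blast
  qed
  ultimately show ?case by (intro exI[of _ "\<lambda>f. D f + cone_at c v B f"] exI[of _ "pushed c v B"]) (intro conjI ballI allI impI, simp_all)
qed

text \<open>Contract all colours, so that the remainder lives on faces with every colour. Below top
  dimension homogeneity excludes such faces. In top dimension the primitive of the remainder has too
  small a degree to live on them, so it is zero and the remainder with it.\<close>

lemma cofilling:
  assumes A: "homogeneous (Suc n) A" "\<forall>f\<in>faces. coboundary A f = 0"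
    and ex: "Suc n < CARD('c) \<or> (Suc n = CARD('c) \<and> (\<exists>A'. homogeneous n A' \<and> (\<forall>f\<in>faces. A f = coboundary A' f)))"
  shows "\<exists>D. (\<forall>f\<in>faces. A f = coboundary D f) \<and> homogeneous n D \<and> size_of D \<le> 2 ^ CARD('c) * size_of A"
proof -
  obtain D B where DB: "\<forall>f\<in>faces. A f = coboundary D f + B f" "homogeneous n D" "homogeneous (Suc n) B"
    "\<forall>f\<in>faces. coboundary B f = 0" "\<forall>f\<in>faces. B f \<noteq> 0 \<longrightarrow> UNIV \<subseteq> dom f"
    "size_of D \<le> (2 ^ CARD('c) - 1) * size_of A" "size_of B \<le> 2 ^ CARD('c) * size_of A"
    "\<forall>A'. homogeneous n A' \<longrightarrow> (\<forall>f\<in>faces. A f = coboundary A' f) \<longrightarrow>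
      (\<exists>B'. homogeneous n B' \<and> (\<forall>f\<in>faces. B f = coboundary B' f) \<and> (\<forall>f\<in>faces. B' f \<noteq> 0 \<longrightarrow> UNIV \<subseteq> dom f))"
    using cofilling_step[OF finite_class.finite_UNIV A] by (elim exE conjE) (rule that; assumption)
  have "B f = 0" if f: "f \<in> faces" for f
    using ex
  proof
    assume "Suc n < CARD('c)"
    show ?thesis
    proof (rule ccontr)
      assume nz: "B f \<noteq> 0"
      then have "dom f = UNIV" using DB(5) f by blast
      moreover have "card (dom f) = Suc n" using DB(3) f nz unfolding homogeneous_def by blast
      ultimately show False using \<open>Suc n < CARD('c)\<close> by simp
    qed
  next
    assume n: "Suc n = CARD('c) \<and> (\<exists>A'. homogeneous n A' \<and> (\<forall>f\<in>faces. A f = coboundary A' f))"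
    then obtain A' where A': "homogeneous n A'" "\<forall>f\<in>faces. A f = coboundary A' f" by blast
    from DB(8)[THEN spec, THEN mp, THEN mp, OF A']
    obtain B' where B': "homogeneous n B'" "\<forall>f\<in>faces. B f = coboundary B' f" "\<forall>f\<in>faces. B' f \<noteq> 0 \<longrightarrow> UNIV \<subseteq> dom f"
      by (elim exE conjE) (rule that; assumption)
    have "B' g = 0" if g: "g \<in> faces" for g
    proof (rule ccontr)
      assume nz: "B' g \<noteq> 0"
      then have "dom g = UNIV" using B'(3) g by blast
      moreover have "card (dom g) = n" using B'(1) g nz unfolding homogeneous_def by blast
      ultimately show False using n by simp
    qed
    then show ?thesis using B'(2) f face_delete[OF f] by (simp add: coboundary_def)
  qed
  moreover have "size_of D \<le> 2 ^ CARD('c) * size_of A"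
    using DB(6) size_of_nonneg[of A] by (simp add: algebra_simps)
  ultimately show ?thesis using DB(1,2) by (intro exI[of _ D]) simp
qed

end

section \<open>Cells of a cubical grid and the fillings attached to them\<close>

definition facet_sum :: "(('d::finite \<Rightarrow> nat) \<Rightarrow> 'd set \<Rightarrow> 'f \<Rightarrow> bit) \<Rightarrow> ('d \<Rightarrow> nat) \<Rightarrow> 'd set \<Rightarrow> 'f \<Rightarrow> bit" where
  "facet_sum G b I f = (\<Sum>v\<in>I. G b (I - {v}) f + G (b(v := Suc (b v))) (I - {v}) f)"

text \<open>The boundary of the boundary of a cube: two distinct directions \<open>v\<close> and
  \<open>w\<close> contribute four faces, and this contribution is symmetric in \<open>v\<close> and
  \<open>w\<close>.\<close>

lemma facet_sum_facet_sum:
  "(\<Sum>v\<in>I. facet_sum G b (I - {v}) f + facet_sum G (b(v := Suc (b v))) (I - {v}) f) = 0"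
proof -
  define g where "g v w = G b (I - {v} - {w}) f + G (b(w := Suc (b w))) (I - {v} - {w}) f
    + (G (b(v := Suc (b v))) (I - {v} - {w}) f + G (b(v := Suc (b v), w := Suc (b w))) (I - {v} - {w}) f)" for v w
  have "(\<Sum>v\<in>I. facet_sum G b (I - {v}) f + facet_sum G (b(v := Suc (b v))) (I - {v}) f)
      = (\<Sum>v\<in>I. \<Sum>w\<in>I - {v}. g v w)"
    unfolding facet_sum_def sum.distrib[symmetric] g_def by (intro sum.cong refl) simp
  also have "\<dots> = 0"
  proof (rule symmetric_double_sum_bit)
    show "g v w = g w v" for v w
    proof (cases "v = w")
      case False
      have "I - {v} - {w} = I - {w} - {v}" by auto
      moreover have "b(v := Suc (b v), w := Suc (b w)) = b(w := Suc (b w), v := Suc (b v))"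
        using False by (rule fun_upd_twist)
      ultimately show ?thesis by (simp add: g_def add_ac)
    qed simp
  qed simp
  finally show ?thesis .
qed

text \<open>The pair \<open>(b, I)\<close> stands for the cell of a cubical grid with lowest vertex \<open>b\<close> and edges in the
  directions of \<open>I\<close>, and \<open>F b I\<close> for the cochain of the faces that cross this cell. If all of them were small,
  cofilling the cells in order of dimension would give small cochains \<open>G\<close> with
  \<open>coboundary G = F + facet_sum G\<close>. On top cells \<open>G\<close> lives on the empty face, hence vanishes,
  and summing over the top cells would contradict \<open>F_vertex\<close>.\<close>

locale cubical_crossing = partite_complex W for W :: "'c::finite \<Rightarrow> 'i set" +
  fixes F :: "('d::finite \<Rightarrow> nat) \<Rightarrow> 'd set \<Rightarrow> ('c \<Rightarrow> 'i option) \<Rightarrow> bit" and N :: nat and s :: real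
  assumes card_c: "CARD('c) = Suc CARD('d)"
    and F_homogeneous: "homogeneous (CARD('c) - card I) (F b I)"
    and F_boundary: "(\<And>v. v \<notin> I \<Longrightarrow> b v \<le> N) \<Longrightarrow> (\<And>v. v \<in> I \<Longrightarrow> b v < N) \<Longrightarrow> I \<noteq> {} \<Longrightarrow> f \<in> faces \<Longrightarrow>
        coboundary (F b I) f = facet_sum F b I f"
    and F_outer: "v \<notin> I \<Longrightarrow> b v = 0 \<or> b v = N \<Longrightarrow> f \<in> faces \<Longrightarrow> F b I f = 0"
    and F_size: "(\<And>v. v \<notin> I \<Longrightarrow> b v \<le> N) \<Longrightarrow> (\<And>v. v \<in> I \<Longrightarrow> b v < N) \<Longrightarrow> size_of (F b I) \<le> s"
    and F_vertex: "i \<in> W c \<Longrightarrow> (\<Sum>b\<in>{b. \<forall>v. b v < N}. F b UNIV [c \<mapsto> i]) = 1"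
begin

definition cell :: "('d \<Rightarrow> nat) \<Rightarrow> 'd set \<Rightarrow> bool" where
  "cell b I \<longleftrightarrow> (\<forall>v. v \<notin> I \<longrightarrow> b v \<le> N) \<and> (\<forall>v\<in>I. b v < N)"

text \<open>Growth per dimension: cofilling costs \<open>2 ^ CARD('c)\<close>, and the cochain to be
  filled consists of \<open>F\<close> and of two facet fillings for each of at most
  \<open>CARD('c)\<close> directions.\<close>

definition ratio :: real where
  "ratio = 2 ^ CARD('c) * (2 * real CARD('c) + 1)"

text \<open>The last clause makes fillings vanish on cells in the outer boundary of the grid, so
  that no boundary terms survive the summation over top cells.\<close>

definition filling :: "(('d \<Rightarrow> nat) \<Rightarrow> 'd set \<Rightarrow> ('c \<Rightarrow> 'i option) \<Rightarrow> bit) \<Rightarrow> ('d \<Rightarrow> nat) \<Rightarrow> 'd set \<Rightarrow> bool" where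
  "filling G b I \<longleftrightarrow>
     (\<forall>f\<in>faces. coboundary (G b I) f = F b I f + facet_sum G b I f) \<and>
     homogeneous (CARD('d) - card I) (G b I) \<and> size_of (G b I) \<le> ratio ^ Suc (card I) * s \<and>
     ((\<exists>v. v \<notin> I \<and> (b v = 0 \<or> b v = N)) \<longrightarrow> (\<forall>f\<in>faces. G b I f = 0))"

lemma cell_facets: "cell b I \<Longrightarrow> v \<in> I \<Longrightarrow> cell b (I - {v}) \<and> cell (b(v := Suc (b v))) (I - {v})"
  unfolding cell_def
  by (intro conjI allI impI ballI) (metis DiffI less_imp_le singletonD, simp, metis DiffI Suc_le_eq fun_upd_apply singletonD, simp)

lemma ratio_ge_1: "ratio \<ge> 1"
proof -
  have "(1::real) \<le> 2 ^ CARD('c)" by simp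
  then have "1 * 1 \<le> 2 ^ CARD('c) * (2 * real CARD('c) + 1)" by (intro mult_mono) auto
  then show ?thesis by (simp add: ratio_def)
qed

lemma s_nonneg: "s \<ge> 0"
  using F_size[of "{}" "\<lambda>_. 0"] size_of_nonneg by (auto intro: order_trans)

text \<open>Along a grid line in direction \<open>v0\<close> the values at neighbouring vertices
  differ by the coboundary of the value on the edge between them, and at the outer end the value is
  0. This supplies the primitive that \<open>cofilling\<close> asks for in top dimension.\<close>

lemma F_vertices_coboundary:
  assumes "\<And>v. b v \<le> N"
  shows "\<exists>A. homogeneous CARD('d) A \<and> (\<forall>f\<in>faces. F b {} f = coboundary A f)"
proof -
  fix v0 :: 'd
  have "\<exists>A. homogeneous CARD('d) A \<and> (\<forall>f\<in>faces. F (b(v0 := n)) {} f = coboundary A f)" if "n \<le> N" for n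
    using that
  proof (induction n)
    case 0
    have "F (b(v0 := 0)) {} f = 0" if "f \<in> faces" for f
      by (rule F_outer[of v0]) (use that in auto)
    then have "\<forall>f\<in>faces. F (b(v0 := 0)) {} f = coboundary (\<lambda>_. 0) f" unfolding coboundary_zero by blast
    moreover have "homogeneous CARD('d) (\<lambda>_. 0)" by (simp add: homogeneous_def)
    ultimately show ?case by blast
  next
    case (Suc n)
    have "n \<le> N" using Suc.prems by simp
    from Suc.IH[OF this] obtain A
      where A: "homogeneous CARD('d) A" "\<And>f. f \<in> faces \<Longrightarrow> F (b(v0 := n)) {} f = coboundary A f"
      by blast
    have e: "coboundary (F (b(v0 := n)) {v0}) f = F (b(v0 := n)) {} f + F (b(v0 := Suc n)) {} f" if "f \<in> faces" for f
      using F_boundary[of "{v0}" "b(v0 := n)" f] assms Suc.prems that by (simp add: facet_sum_def)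
    have "homogeneous CARD('d) (F (b(v0 := n)) {v0})"
      using F_homogeneous[of "{v0}"] by (simp add: card_c)
    then have "homogeneous CARD('d) (\<lambda>f. A f + F (b(v0 := n)) {v0} f)"
      using A(1) unfolding homogeneous_def by (metis add_0)
    moreover have "F (b(v0 := Suc n)) {} f = coboundary (\<lambda>f. A f + F (b(v0 := n)) {v0} f) f" if "f \<in> faces" for f
      using A(2)[OF that] e[OF that] by (simp add: coboundary_add)
    ultimately show ?case by blast
  qed
  from this[of "b v0"] show ?thesis using assms by simp
qed

lemma exists_filling:
  assumes "k \<le> CARD('d)"
  shows "\<exists>G. \<forall>b I. cell b I \<longrightarrow> card I \<le> k \<longrightarrow> filling G b I"
  using assms
proof (induction k)
  case 0
  have "\<exists>D. (\<forall>f\<in>faces. coboundary D f = F b {} f) \<and> homogeneous CARD('d) D \<and> size_of D \<le> ratio * s \<and>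
      ((\<exists>v. b v = 0 \<or> b v = N) \<longrightarrow> (\<forall>f\<in>faces. D f = 0))" if b: "cell b {}" for b
  proof (cases "\<exists>v. b v = 0 \<or> b v = N")
    case True
    then have "F b {} f = 0" if "f \<in> faces" for f using F_outer[of _ "{}" b f] that by auto
    then show ?thesis using s_nonneg ratio_ge_1
      by (intro exI[of _ "\<lambda>_. 0"]) (simp add: homogeneous_def size_of_def)
  next
    case False
    have bN: "b v \<le> N" for v using b by (simp add: cell_def)
    have h: "homogeneous (Suc CARD('d)) (F b {})" using F_homogeneous[of "{}" b] by (simp add: card_c)
    have "coboundary (F b {}) f = 0" if f: "f \<in> faces" for f
    proof -
      have "F b {} (f(x := None)) = 0" for x
      proof (rule ccontr)
        assume "F b {} (f(x := None)) \<noteq> 0"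
        then have "card (dom (f(x := None))) = CARD('c)"
          using h face_delete[OF f] unfolding homogeneous_def card_c by blast
        then have "dom (f(x := None)) = UNIV" using card_subset_eq[of UNIV "dom (f(x := None))"] by simp
        then show False by auto
      qed
      then show ?thesis by (simp add: coboundary_def)
    qed
    then obtain D where D: "\<forall>f\<in>faces. F b {} f = coboundary D f" "homogeneous CARD('d) D"
      "size_of D \<le> 2 ^ CARD('c) * size_of (F b {})"
      using cofilling[OF h] F_vertices_coboundary[of b] bN card_c by auto
    have "size_of (F b {}) \<le> s" using F_size[of "{}" b] bN by auto
    then have "2 ^ CARD('c) * size_of (F b {}) \<le> 2 ^ CARD('c) * s" by simp
    also have "\<dots> \<le> ratio * s"
      using s_nonneg by (intro mult_right_mono) (auto simp: ratio_def)
    finally have 1: "size_of D \<le> ratio * s" using D(3) by simp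
    have 2: "\<forall>f\<in>faces. coboundary D f = F b {} f" using D(1) by simp
    show ?thesis by (intro exI[of _ D] conjI impI 1 2 D(2)) (use False in blast)
  qed
  then have "\<exists>D. \<forall>b. cell b {} \<longrightarrow> (\<forall>f\<in>faces. coboundary (D b) f = F b {} f) \<and> homogeneous CARD('d) (D b) \<and>
      size_of (D b) \<le> ratio * s \<and> ((\<exists>v. b v = 0 \<or> b v = N) \<longrightarrow> (\<forall>f\<in>faces. D b f = 0))"
    by (intro choice allI) (auto simp del: not_ex)
  then obtain D where D: "\<forall>b. cell b {} \<longrightarrow> (\<forall>f\<in>faces. coboundary (D b) f = F b {} f) \<and> homogeneous CARD('d) (D b) \<and>
      size_of (D b) \<le> ratio * s \<and> ((\<exists>v. b v = 0 \<or> b v = N) \<longrightarrow> (\<forall>f\<in>faces. D b f = 0))"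
    by (elim exE) (erule that)
  have "filling (\<lambda>b I. D b) b I" if "cell b I" "card I \<le> 0" for b I
  proof -
    have "I = {}" using that(2) by simp
    then show ?thesis using D[THEN spec, of b] that(1) by (simp add: filling_def facet_sum_def)
  qed
  then show ?case by (intro exI[of _ "\<lambda>b I. D b"]) blast
next
  case (Suc k)
  then obtain G where G: "\<forall>b I. cell b I \<longrightarrow> card I \<le> k \<longrightarrow> filling G b I" by auto
  define A where "A b I f = F b I f + facet_sum G b I f" for b I f
  have extend: "\<exists>D. (\<forall>f\<in>faces. coboundary D f = A b I f) \<and> homogeneous (CARD('d) - card I) D \<and>
      size_of D \<le> ratio ^ Suc (card I) * s \<and>
      ((\<exists>v. v \<notin> I \<and> (b v = 0 \<or> b v = N)) \<longrightarrow> (\<forall>f\<in>faces. D f = 0))"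
    if bI: "cell b I" "card I = Suc k" for b I
  proof -
    have fin: "finite I" by simp
    have fill: "filling G b (I - {v})" "filling G (b(v := Suc (b v))) (I - {v})" if "v \<in> I" for v
      using G cell_facets[OF bI(1) that] bI(2) that by simp_all
    \<comment> \<open>The facet fillings turn the coboundary of \<open>facet_sum G\<close> into
      \<open>facet_sum F\<close> plus a double boundary, which is 0; this cancels the coboundary of
      \<open>F\<close>.\<close>
    have cob: "coboundary (A b I) f = 0" if f: "f \<in> faces" for f
    proof -
      have "coboundary (A b I) f = facet_sum F b I f + coboundary (facet_sum G b I) f"
      proof -
        have "A b I = (\<lambda>f. F b I f + facet_sum G b I f)" by (rule ext) (simp add: A_def)
        moreover have "coboundary (F b I) f = facet_sum F b I f"
        proof -
          have "I \<noteq> {}" using bI(2) by auto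
          then show ?thesis using F_boundary[of I b f] bI(1) f by (auto simp: cell_def)
        qed
        ultimately show ?thesis by (simp add: coboundary_add)
      qed
      also have "coboundary (facet_sum G b I) f
          = (\<Sum>v\<in>I. coboundary (G b (I - {v})) f + coboundary (G (b(v := Suc (b v))) (I - {v})) f)"
        unfolding facet_sum_def[abs_def] coboundary_sum coboundary_add ..
      also have "\<dots> = (\<Sum>v\<in>I. (F b (I - {v}) f + F (b(v := Suc (b v))) (I - {v}) f)
          + (facet_sum G b (I - {v}) f + facet_sum G (b(v := Suc (b v))) (I - {v}) f))"
      proof (intro sum.cong refl)
        fix v assume "v \<in> I"
        note fill[OF this]
        then have "coboundary (G b (I - {v})) f = F b (I - {v}) f + facet_sum G b (I - {v}) f"
          "coboundary (G (b(v := Suc (b v))) (I - {v})) f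
            = F (b(v := Suc (b v))) (I - {v}) f + facet_sum G (b(v := Suc (b v))) (I - {v}) f"
          using f unfolding filling_def by blast+
        then show "coboundary (G b (I - {v})) f + coboundary (G (b(v := Suc (b v))) (I - {v})) f
          = (F b (I - {v}) f + F (b(v := Suc (b v))) (I - {v}) f)
          + (facet_sum G b (I - {v}) f + facet_sum G (b(v := Suc (b v))) (I - {v}) f)"
          by (simp only: add_ac)
      qed
      also have "\<dots> = facet_sum F b I f"
        unfolding sum.distrib[of "\<lambda>v. F b (I - {v}) f + F (b(v := Suc (b v))) (I - {v}) f"] facet_sum_facet_sum
        by (simp add: facet_sum_def)
      finally show ?thesis by simp
    qed
    have dk: "CARD('d) - k = Suc (CARD('d) - Suc k)" using Suc.prems by simp
    have hF: "homogeneous (Suc (CARD('d) - Suc k)) (F b I)"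
      using F_homogeneous[of I b] bI(2) by (simp add: card_c dk)
    have hG: "homogeneous (Suc (CARD('d) - Suc k)) (G b (I - {v}))"
      "homogeneous (Suc (CARD('d) - Suc k)) (G (b(v := Suc (b v))) (I - {v}))" if "v \<in> I" for v
      using fill[OF that] bI(2) that by (simp_all add: filling_def dk)
    have hA: "homogeneous (Suc (CARD('d) - Suc k)) (A b I)"
      unfolding homogeneous_def
    proof (intro ballI impI, rule ccontr)
      fix f assume f: "f \<in> faces" "A b I f \<noteq> 0" "card (dom f) \<noteq> Suc (CARD('d) - Suc k)"
      have "F b I f = 0" using hF f unfolding homogeneous_def by blast
      moreover have "G b (I - {v}) f = 0" "G (b(v := Suc (b v))) (I - {v}) f = 0" if "v \<in> I" for v
        using hG[OF that] f unfolding homogeneous_def by blast+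
      ultimately show False using f(2) by (simp add: A_def facet_sum_def)
    qed
    show ?thesis
    proof (cases "\<exists>v. v \<notin> I \<and> (b v = 0 \<or> b v = N)")
      case True
      then obtain w where w: "w \<notin> I" "b w = 0 \<or> b w = N" by blast
      have "A b I f = 0" if f: "f \<in> faces" for f
      proof -
        have "F b I f = 0" using F_outer[of w I b f] w f by blast
        moreover have "G b (I - {v}) f = 0" "G (b(v := Suc (b v))) (I - {v}) f = 0" if v: "v \<in> I" for v
        proof -
          have "w \<notin> I - {v}" "(b(v := Suc (b v))) w = b w" using w v by auto
          then show "G b (I - {v}) f = 0" "G (b(v := Suc (b v))) (I - {v}) f = 0"
            using fill[OF v] f w(2) unfolding filling_def by metis+
        qed
        ultimately show ?thesis by (simp add: A_def facet_sum_def)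
      qed
      then show ?thesis using s_nonneg ratio_ge_1
        by (intro exI[of _ "\<lambda>_. 0"]) (simp add: homogeneous_def size_of_def)
    next
      case False
      have "Suc (CARD('d) - Suc k) < CARD('c)" using Suc.prems card_c by simp
      then obtain D where D: "\<forall>f\<in>faces. A b I f = coboundary D f" "homogeneous (CARD('d) - Suc k) D"
        "size_of D \<le> 2 ^ CARD('c) * size_of (A b I)"
        using cofilling[OF hA] cob by auto
      have "size_of (A b I) \<le> s + real CARD('c) * (2 * (ratio ^ Suc k * s))"
      proof -
        have nn: "ratio ^ Suc k * s \<ge> 0" using ratio_ge_1 s_nonneg by simp
        have "size_of (A b I) \<le> size_of (F b I) + size_of (facet_sum G b I)"
          unfolding A_def[abs_def] by (rule size_of_add)
        also have "size_of (F b I) \<le> s" using F_size[of I b] bI(1) by (auto simp: cell_def)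
        also have "size_of (facet_sum G b I)
            \<le> (\<Sum>v\<in>I. size_of (\<lambda>f. G b (I - {v}) f + G (b(v := Suc (b v))) (I - {v}) f))"
          unfolding facet_sum_def[abs_def] by (rule size_of_sum[OF fin])
        also have "\<dots> \<le> (\<Sum>v\<in>I. 2 * (ratio ^ Suc k * s))"
        proof (intro sum_mono)
          fix v assume v: "v \<in> I"
          then have "size_of (G b (I - {v})) \<le> ratio ^ Suc k * s" "size_of (G (b(v := Suc (b v))) (I - {v})) \<le> ratio ^ Suc k * s"
            using fill[OF v] bI(2) by (simp_all add: filling_def)
          then show "size_of (\<lambda>f. G b (I - {v}) f + G (b(v := Suc (b v))) (I - {v}) f) \<le> 2 * (ratio ^ Suc k * s)"
            using size_of_add[of "G b (I - {v})" "G (b(v := Suc (b v))) (I - {v})"] by linarith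
        qed
        also have "\<dots> = real (card I) * (2 * (ratio ^ Suc k * s))" by simp
        also have "\<dots> \<le> real CARD('c) * (2 * (ratio ^ Suc k * s))"
          using nn bI(2) Suc.prems card_c by (intro mult_right_mono) auto
        finally show ?thesis by simp
      qed
      moreover have "s \<le> ratio ^ Suc k * s"
        using mult_right_mono[OF one_le_power[OF ratio_ge_1, of "Suc k"] s_nonneg] by simp
      ultimately have "size_of (A b I) \<le> (2 * real CARD('c) + 1) * (ratio ^ Suc k * s)"
        by (simp add: algebra_simps)
      then have "2 ^ CARD('c) * size_of (A b I) \<le> 2 ^ CARD('c) * ((2 * real CARD('c) + 1) * (ratio ^ Suc k * s))"
        by (intro mult_left_mono) auto
      also have "\<dots> = ratio ^ Suc (Suc k) * s" by (simp add: ratio_def)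
      finally have 1: "size_of D \<le> ratio ^ Suc (card I) * s" using D(3) bI(2) by simp
      have 2: "\<forall>f\<in>faces. coboundary D f = A b I f" using D(1) by simp
      have 3: "homogeneous (CARD('d) - card I) D" using D(2) bI(2) by simp
      show ?thesis by (intro exI[of _ D] conjI impI 1 2 3) (use False in blast)
    qed
  qed
  then have "\<exists>D. \<forall>p. cell (fst p) (snd p) \<longrightarrow> card (snd p) = Suc k \<longrightarrow>
      (\<forall>f\<in>faces. coboundary (D p) f = A (fst p) (snd p) f) \<and> homogeneous (CARD('d) - card (snd p)) (D p) \<and>
      size_of (D p) \<le> ratio ^ Suc (card (snd p)) * s \<and>
      ((\<exists>v. v \<notin> snd p \<and> (fst p v = 0 \<or> fst p v = N)) \<longrightarrow> (\<forall>f\<in>faces. D p f = 0))"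
  proof (intro choice allI)
    fix p :: "('d \<Rightarrow> nat) \<times> 'd set"
    show "\<exists>D. cell (fst p) (snd p) \<longrightarrow> card (snd p) = Suc k \<longrightarrow>
      (\<forall>f\<in>faces. coboundary D f = A (fst p) (snd p) f) \<and> homogeneous (CARD('d) - card (snd p)) D \<and>
      size_of D \<le> ratio ^ Suc (card (snd p)) * s \<and>
      ((\<exists>v. v \<notin> snd p \<and> (fst p v = 0 \<or> fst p v = N)) \<longrightarrow> (\<forall>f\<in>faces. D f = 0))"
    proof (cases "cell (fst p) (snd p) \<and> card (snd p) = Suc k")
      case True
      show ?thesis
        by (rule ex_forward[OF extend[OF True[THEN conjunct1] True[THEN conjunct2]]]) (intro impI)
    next
      case False
      show ?thesis by (intro exI[of _ "\<lambda>_. 0"] impI, rule False[THEN notE], rule conjI)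
    qed
  qed
  then obtain D where D: "\<forall>p. cell (fst p) (snd p) \<longrightarrow> card (snd p) = Suc k \<longrightarrow>
      (\<forall>f\<in>faces. coboundary (D p) f = A (fst p) (snd p) f) \<and> homogeneous (CARD('d) - card (snd p)) (D p) \<and>
      size_of (D p) \<le> ratio ^ Suc (card (snd p)) * s \<and>
      ((\<exists>v. v \<notin> snd p \<and> (fst p v = 0 \<or> fst p v = N)) \<longrightarrow> (\<forall>f\<in>faces. D p f = 0))"
    by (elim exE) (erule that)
  define G' where "G' b I = (if card I \<le> k then G b I else D (b, I))" for b I
  have fs: "facet_sum G' b I f = facet_sum G b I f" if "card I \<le> Suc k" for b I f
    unfolding facet_sum_def
  proof (intro sum.cong refl)
    fix v assume "v \<in> I"
    then have "card (I - {v}) \<le> k" using that by simp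
    then show "G' b (I - {v}) f + G' (b(v := Suc (b v))) (I - {v}) f
      = G b (I - {v}) f + G (b(v := Suc (b v))) (I - {v}) f"
      by (simp only: G'_def if_True)
  qed
  have "filling G' b I" if bI: "cell b I" "card I \<le> Suc k" for b I
  proof (cases "card I \<le> k")
    case True
    then have "filling G b I" using G bI by blast
    then show ?thesis using True fs[OF bI(2)] by (simp add: filling_def G'_def)
  next
    case False
    then have "card I = Suc k" using bI by simp
    then show ?thesis using D[THEN spec, of "(b, I)"] bI False fs[OF bI(2)] by (simp add: filling_def G'_def A_def)
  qed
  then show ?case by (intro exI[of _ G']) blast
qed

theorem crossing_size_bound: "ratio ^ Suc CARD('d) * s \<ge> 1"
proof (rule ccontr)
  assume small: "\<not> ratio ^ Suc CARD('d) * s \<ge> 1"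
  obtain G where G: "\<And>b I. cell b I \<Longrightarrow> filling G b I"
    using exists_filling[of "CARD('d)"] card_mono[of "UNIV :: 'd set"] by auto
  define B where "B = {b :: 'd \<Rightarrow> nat. \<forall>v. b v < N}"
  have B: "B = (UNIV :: 'd set) \<rightarrow>\<^sub>E {..<N}" by (auto simp: B_def PiE_def)
  have fB: "finite B" unfolding B by (intro finite_PiE) auto
  obtain c :: 'c where True by blast
  obtain i where i: "i \<in> W c" using W_nonempty by blast
  define f where "f = [c \<mapsto> i]"
  have f: "f \<in> faces" using i by (simp add: f_def faces_def)
  have FG: "F b UNIV f = facet_sum G b UNIV f" if b: "b \<in> B" for b
  proof -
    have fl: "filling G b UNIV" using G b by (simp add: B_def cell_def)
    have e: "Map.empty \<in> faces" by (simp add: faces_def)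
    \<comment> \<open>The empty face alone has weight 1, and the assumption \<open>small\<close>
      makes the whole filling smaller than that.\<close>
    have "G b UNIV Map.empty = 0"
    proof (rule ccontr)
      assume "G b UNIV Map.empty \<noteq> 0"
      then have "(\<Sum>f\<in>{Map.empty}. if G b UNIV f = 0 then 0 else weight f) = 1" by (simp add: weight_def)
      moreover have "(\<Sum>f\<in>{Map.empty}. if G b UNIV f = 0 then 0 else weight f) \<le> size_of (G b UNIV)"
        unfolding size_of_def using e finite_faces weight_pos by (intro sum_mono2) (auto simp: less_imp_le)
      moreover have "size_of (G b UNIV) \<le> ratio ^ Suc CARD('d) * s" using fl by (simp add: filling_def)
      ultimately show False using small by simp
    qed
    then have "coboundary (G b UNIV) f = 0"
      by (simp add: coboundary_def f_def)
    then have "F b UNIV f + facet_sum G b UNIV f = 0" using fl f by (simp add: filling_def)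
    then show ?thesis by (metis add.right_neutral bit_double_left)
  qed
  have "(\<Sum>b\<in>B. facet_sum G b UNIV f) = (\<Sum>v\<in>UNIV. \<Sum>b\<in>B. G b (UNIV - {v}) f + G (b(v := Suc (b v))) (UNIV - {v}) f)"
    unfolding facet_sum_def by (rule sum.swap)
  \<comment> \<open>In each direction every inner facet belongs to two cells and cancels, while on
    outer facets the filling is 0.\<close>
  also have "\<dots> = 0"
  proof (rule sum.neutral, rule ballI)
    fix v :: 'd
    define J where "J = UNIV - {v}"
    define B1 where "B1 = {b\<in>B. b v > 0}"
    have z: "G b J f = 0" if "cell b J" "b v = 0 \<or> b v = N" for b
      using G[OF that(1)] that(2) f unfolding filling_def J_def by blast
    have cJ: "cell b J" if "\<forall>w. w \<noteq> v \<longrightarrow> b w < N" "b v \<le> N" for b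
      using that by (auto simp: cell_def J_def)
    have 1: "(\<Sum>b\<in>B. G b J f) = (\<Sum>b\<in>B1. G b J f)"
    proof (rule sum.mono_neutral_right[OF fB])
      show "\<forall>b\<in>B - B1. G b J f = 0"
      proof
        fix b assume b: "b \<in> B - B1"
        then have "\<forall>w. b w < N" "b v = 0" by (auto simp: B1_def B_def)
        then show "G b J f = 0" by (intro z cJ) (auto simp: less_imp_le)
      qed
    qed (auto simp: B1_def)
    define B2 where "B2 = {b\<in>B. Suc (b v) < N}"
    have "(\<Sum>b\<in>B. G (b(v := Suc (b v))) J f) = (\<Sum>b\<in>B2. G (b(v := Suc (b v))) J f)"
    proof (rule sum.mono_neutral_right[OF fB])
      show "\<forall>b\<in>B - B2. G (b(v := Suc (b v))) J f = 0"
      proof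
        fix b assume b: "b \<in> B - B2"
        then have "b v < N" "\<not> Suc (b v) < N" "\<forall>w. b w < N" by (auto simp: B2_def B_def)
        then have "\<forall>w. b w < N" "Suc (b v) = N" by (simp_all add: Suc_leI le_antisym not_less)
        then show "G (b(v := Suc (b v))) J f = 0" by (intro z cJ) auto
      qed
    qed (auto simp: B2_def)
    also have "\<dots> = (\<Sum>b\<in>B1. G b J f)"
    proof (rule sum.reindex_bij_betw[where h = "\<lambda>b. b(v := Suc (b v))" and g = "\<lambda>b. G b J f"])
      show "bij_betw (\<lambda>b. b(v := Suc (b v))) B2 B1"
      proof (rule bij_betw_byWitness[where f' = "\<lambda>b. b(v := b v - 1)"])
        show "\<forall>b\<in>B2. (b(v := Suc (b v)))(v := (b(v := Suc (b v))) v - 1) = b" by simp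
        show "\<forall>b\<in>B1. (b(v := b v - 1))(v := Suc ((b(v := b v - 1)) v)) = b" by (simp add: B1_def)
        show "(\<lambda>b. b(v := Suc (b v))) ` B2 \<subseteq> B1" by (auto simp: B1_def B2_def B_def)
        show "(\<lambda>b. b(v := b v - 1)) ` B1 \<subseteq> B2" by (auto simp: B1_def B2_def B_def less_imp_diff_less)
      qed
    qed
    finally show "(\<Sum>b\<in>B. G b (UNIV - {v}) f + G (b(v := Suc (b v))) (UNIV - {v}) f) = 0"
      unfolding J_def[symmetric] using 1 by (simp add: sum.distrib)
  qed
  finally have "(\<Sum>b\<in>B. F b UNIV f) = 0" using FG by simp
  then show False using F_vertex[OF i] by (simp add: f_def B_def)
qed

end

section \<open>A generic grid and the colourful selection theorem\<close>

locale coloured_points = partite_complex W for W :: "'c::finite \<Rightarrow> 'i set" +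
  fixes p :: "'c \<Rightarrow> 'i \<Rightarrow> real ^ 'd::finite"
begin

definition comb :: "('c \<Rightarrow> 'i option) \<Rightarrow> ('c \<Rightarrow> real) \<Rightarrow> real ^ 'd" where
  "comb f l = (\<Sum>c\<in>dom f. l c *\<^sub>R p c (the (f c)))"

text \<open>Coefficients of either sign are allowed, since genericity concerns affine hulls;
  nonnegativity enters in \<open>hits\<close>.\<close>

definition solution :: "('c \<Rightarrow> 'i option) \<Rightarrow> 'd set \<Rightarrow> ('d \<Rightarrow> real) \<Rightarrow> ('c \<Rightarrow> real) \<Rightarrow> bool" where
  "solution f J t l \<longleftrightarrow> sum l (dom f) = 1 \<and> (\<forall>v\<in>J. comb f l $ v = t v)"

lemma comb_add_scale: "comb f (\<lambda>c. l c + k * m c) = comb f l + k *\<^sub>R comb f m"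
  by (simp add: comb_def scaleR_left_distrib sum.distrib scaleR_sum_right)

lemma sum_delete: "l q = 0 \<Longrightarrow> sum l (dom (f(q := None))) = sum l (dom f)"
  for l :: "'c \<Rightarrow> real"
  by (intro sum.mono_neutral_left) auto

lemma comb_delete: "l q = 0 \<Longrightarrow> comb (f(q := None)) l = comb f l"
  unfolding comb_def by (intro sum.mono_neutral_cong_left) auto

lemma solution_delete: "l q = 0 \<Longrightarrow> solution (f(q := None)) J t l = solution f J t l"
  by (simp only: solution_def sum_delete comb_delete)

lemma solution_cong: "(\<And>c. c \<in> dom f \<Longrightarrow> l c = l' c) \<Longrightarrow> solution f J t l = solution f J t l'"
proof -
  assume "\<And>c. c \<in> dom f \<Longrightarrow> l c = l' c"
  then have "sum l (dom f) = sum l' (dom f)" "comb f l = comb f l'"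
    unfolding comb_def by (auto intro!: sum.cong)
  then show ?thesis by (simp add: solution_def)
qed

lemma solution_line:
  assumes "solution f J t l" "sum m (dom f) = 0" "\<And>v. v \<in> J \<Longrightarrow> comb f m $ v = 0"
  shows "solution f J t (\<lambda>c. l c + k * m c)"
  using assms by (simp add: solution_def comb_add_scale sum.distrib sum_distrib_left[symmetric])

text \<open>Move from \<open>l\<close> along \<open>m\<close> until the coefficient of
  \<open>q\<close> is 0; the remaining colours still solve the system.\<close>

lemma solution_eliminate:
  assumes l: "solution f J t l" and m: "sum m (dom f) = 0" "\<And>v. v \<in> J \<Longrightarrow> comb f m $ v = 0" "m q \<noteq> 0"
  shows "\<exists>l'. solution (f(q := None)) J t l'"
proof -
  let ?l = "\<lambda>c. l c + (- l q / m q) * m c"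
  have "solution f J t ?l" by (rule solution_line[OF l m(1,2)])
  then have "solution (f(q := None)) J t ?l" by (subst solution_delete) (use m(3) in auto)
  then show ?thesis by blast
qed

text \<open>At most \<open>card J\<close> points span no affine combination whose \<open>J\<close>-coordinates are grid values. The combinations
  are indexed by colours, so coinciding points do no harm.\<close>

definition generic :: "nat \<Rightarrow> 'd set \<Rightarrow> ('d \<Rightarrow> nat \<Rightarrow> real) \<Rightarrow> bool" where
  "generic N A g \<longleftrightarrow> (\<forall>J b f l. J \<subseteq> A \<longrightarrow> (\<forall>v\<in>J. b v \<le> N) \<longrightarrow> f \<in> faces \<longrightarrow> card (dom f) \<le> card J \<longrightarrow>
     \<not> solution f J (\<lambda>v. g v (b v)) l)"

lemma genericD:
  "generic N A g \<Longrightarrow> J \<subseteq> A \<Longrightarrow> (\<And>v. v \<in> J \<Longrightarrow> b v \<le> N) \<Longrightarrow> f \<in> faces \<Longrightarrow> card (dom f) \<le> card J \<Longrightarrow>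
    solution f J (\<lambda>v. g v (b v)) l \<Longrightarrow> False"
  unfolding generic_def by blast

text \<open>A line of combinations in \<open>f\<close> would reach one in which a colour has coefficient \<open>0\<close>; so each grid value of a new
  coordinate has only finitely many values to avoid.\<close>

lemma exists_generic:
  assumes U: "\<And>v n. infinite (U v n)"
  shows "\<exists>g. (\<forall>v n. g v n \<in> U v n) \<and> generic N UNIV g"
proof -
  have "\<exists>g. (\<forall>v n. g v n \<in> U v n) \<and> generic N A g" if "finite A" for A
    using that
  proof (induction A rule: finite_induct)
    case empty
    have "\<exists>y. y \<in> U (fst x) (snd x)" for x
      using U[THEN infinite_imp_nonempty] by blast
    then have "\<exists>g. \<forall>x. g x \<in> U (fst x) (snd x)" by (intro choice) blast
    then obtain g where "\<forall>x. g x \<in> U (fst x) (snd x)" by (elim exE) (rule that)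
    moreover have "generic N {} g" for g
      by (auto simp: generic_def solution_def)
    ultimately show ?case by (intro exI[of _ "\<lambda>v n. g (v, n)"]) simp
  next
    case (insert v A)
    from insert.IH obtain g where g: "\<forall>v n. g v n \<in> U v n" "generic N A g"
      by (elim exE conjE) (rule that)
    \<comment> \<open>The values to be avoided by the new coordinate: those taken at combinations
      already fixed in \<open>J\<close>. For \<open>card (dom f) \<le> Suc (card J)\<close> there is
      at most one, by genericity of \<open>g\<close>.\<close>
    define X where "X J b f = {comb f l $ v |l. solution f J (\<lambda>v. g v (b v)) l}" for J b f
    define bad where "bad = (\<Union>J\<in>Pow A. \<Union>b\<in>PiE J (\<lambda>_. {..N}). \<Union>f\<in>{f\<in>faces. card (dom f) \<le> Suc (card J)}. X J b f)"
    have "finite (X J b f)" if J: "J \<subseteq> A" "b \<in> PiE J (\<lambda>_. {..N})" "f \<in> faces" "card (dom f) \<le> Suc (card J)" for J b f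
    proof -
      have eq: "comb f l = comb f l'" if l: "solution f J (\<lambda>v. g v (b v)) l" "solution f J (\<lambda>v. g v (b v)) l'" for l l'
      proof (rule ccontr)
        assume "comb f l \<noteq> comb f l'"
        moreover have "comb f l = comb f l'" if "\<forall>q\<in>dom f. l q = l' q"
          unfolding comb_def by (intro sum.cong refl) (use that in simp)
        ultimately obtain q where q: "q \<in> dom f" "l q \<noteq> l' q" by fast
        have c: "comb f (\<lambda>c. l' c - l c) = comb f l' - comb f l"
          using comb_add_scale[of f l' "-1" l] by simp
        have "\<exists>l'. solution (f(q := None)) J (\<lambda>v. g v (b v)) l'"
          by (rule solution_eliminate[OF l(1), of "\<lambda>c. l' c - l c"])
            (use l q c in \<open>simp_all add: solution_def sum_subtractf\<close>)
        then obtain l'' where "solution (f(q := None)) J (\<lambda>v. g v (b v)) l''" by blast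
        moreover have "card (dom (f(q := None))) \<le> card J" using q(1) J(4) by simp
        moreover have "b v \<le> N" if "v \<in> J" for v using J(2) that by (auto simp: PiE_def Pi_def)
        ultimately show False
          by (intro genericD[OF g(2) J(1) _ face_delete[OF J(3)]])
      qed
      show ?thesis
      proof (cases "\<exists>l. solution f J (\<lambda>v. g v (b v)) l")
        case False
        then show ?thesis by (simp add: X_def)
      next
        case True
        then obtain l where l: "solution f J (\<lambda>v. g v (b v)) l" by (elim exE) (rule that)
        have "X J b f \<subseteq> {comb f l $ v}"
        proof
          fix x assume "x \<in> X J b f"
          then obtain l' where "x = comb f l' $ v" "solution f J (\<lambda>v. g v (b v)) l'"
            unfolding X_def mem_Collect_eq by (elim exE conjE) (rule that)
          then show "x \<in> {comb f l $ v}" using eq[OF l, of l'] by simp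
        qed
        then show ?thesis by (rule finite_subset) simp
      qed
    qed
    then have "finite bad"
      unfolding bad_def using insert.hyps finite_faces
      by (intro finite_UN_I finite_PiE) (auto intro: finite_subset)
    then have "\<exists>x. x \<in> U v n - bad" for n
      using U[of v n] by (metis ex_in_conv Diff_infinite_finite finite.emptyI)
    then obtain h where h: "h n \<in> U v n - bad" for n by metis
    have "generic N (insert v A) (g(v := h))"
      unfolding generic_def
    proof (intro allI impI notI)
      fix J b f l
      assume J: "J \<subseteq> insert v A" "\<forall>v\<in>J. b v \<le> N" "f \<in> faces" "card (dom f) \<le> card J"
        "solution f J (\<lambda>w. (g(v := h)) w (b w)) l"
      have s: "solution f (J - {v}) (\<lambda>w. g w (b w)) l" using J(5) by (simp add: solution_def)
      show False
      proof (cases "v \<in> J")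
        case False
        then show False using genericD[OF g(2) _ _ J(3), of J b l] J s by auto
      next
        case True
        define b' where "b' = restrict b (J - {v})"
        have "solution f (J - {v}) (\<lambda>w. g w (b' w)) l" using s by (simp add: solution_def b'_def)
        moreover have "comb f l $ v = h (b v)" using J(5) True by (simp add: solution_def)
        ultimately have x: "h (b v) \<in> X (J - {v}) b' f" unfolding X_def by force
        have "finite J" by simp
        then have "card (dom f) \<le> Suc (card (J - {v}))" using J(4) True by (simp add: card_Suc_Diff1)
        moreover have "b' \<in> PiE (J - {v}) (\<lambda>_. {..N})" using J(2) by (auto simp: b'_def)
        ultimately have "h (b v) \<in> bad" unfolding bad_def using x J(1,3) by blast
        then show False using h by blast
      qed
    qed
    moreover have "\<forall>w n. (g(v := h)) w n \<in> U w n" using g(1) h by auto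
    ultimately show ?case by blast
  qed
  then show ?thesis by simp
qed

end

text \<open>The set of feasible \<open>s\<close> is empty or a compact interval, bounded because
  slopes of both signs occur. Its ends are the largest root with positive slope and the smallest
  with negative slope; by \<open>sep\<close> no other constraint is tight there, and those of slope
  0 stay strictly positive. So the count is 0 or 2.\<close>

lemma segment_parity:
  fixes a m :: "'k \<Rightarrow> real"
  assumes fin: "finite K" and sep: "\<And>k k' s. k \<in> K \<Longrightarrow> k' \<in> K \<Longrightarrow> k \<noteq> k' \<Longrightarrow> a k + s * m k = 0 \<Longrightarrow> a k' + s * m k' = 0 \<Longrightarrow> False"
    and pos: "\<exists>k\<in>K. m k > 0" and neg: "\<exists>k\<in>K. m k < 0"
  shows "(\<Sum>k\<in>K. of_bool (\<exists>s. (\<forall>j\<in>K. a j + s * m j \<ge> 0) \<and> a k + s * m k = 0)) = (0::bit)"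
proof -
  define feas where "feas s \<longleftrightarrow> (\<forall>j\<in>K. a j + s * m j \<ge> 0)" for s
  define Z where "Z = {k\<in>K. \<exists>s. feas s \<and> a k + s * m k = 0}"
  have "(\<Sum>k\<in>K. of_bool (\<exists>s. feas s \<and> a k + s * m k = 0)) = (of_nat (card Z) :: bit)"
    using fin by (simp add: Z_def Int_def of_bool_def sum.If_cases)
  also have "card Z = 0 \<or> card Z = 2"
  proof (cases "\<exists>s. feas s")
    case False
    then show ?thesis by (simp add: Z_def)
  next
    case True
    then obtain s0 where s0: "feas s0" by blast
    define r where "r k = - a k / m k" for k
    have root: "a k + s * m k = 0 \<longleftrightarrow> s = r k" if "m k \<noteq> 0" for k s
      using that by (auto simp: r_def field_simps)
    have r_pos: "a k + s * m k \<ge> 0 \<longleftrightarrow> s \<ge> r k" if "m k > 0" for k s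
      using that by (auto simp: r_def field_simps)
    have r_neg: "a k + s * m k \<ge> 0 \<longleftrightarrow> s \<le> r k" if "m k < 0" for k s
      using that by (auto simp: r_def field_simps)
    have const: "a k > 0" if "k \<in> K" "m k = 0" for k
    proof -
      obtain k' where k': "k' \<in> K" "m k' > 0" using pos by blast
      then have "k \<noteq> k'" using \<open>m k = 0\<close> by auto
      then have "a k \<noteq> 0" using k'  sep[OF that(1) k'(1), of "r k'"] root[of k' "r k'"] that by auto
      moreover have "a k \<ge> 0" using s0 that by (auto simp: feas_def)
      ultimately show ?thesis by simp
    qed
    obtain k1 where k1: "k1 \<in> K" "m k1 > 0" "\<And>k. k \<in> K \<Longrightarrow> m k > 0 \<Longrightarrow> r k \<le> r k1"
    proof -
      have "Max (r ` {k\<in>K. m k > 0}) \<in> r ` {k\<in>K. m k > 0}"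
        using fin pos by (intro Max_in) auto
      then obtain k1 where "k1 \<in> K" "m k1 > 0" "r k1 = Max (r ` {k\<in>K. m k > 0})" by auto
      moreover then have "r k \<le> r k1" if "k \<in> K" "m k > 0" for k
        using fin that by (auto intro: Max_ge)
      ultimately show ?thesis using that by blast
    qed
    obtain k2 where k2: "k2 \<in> K" "m k2 < 0" "\<And>k. k \<in> K \<Longrightarrow> m k < 0 \<Longrightarrow> r k2 \<le> r k"
    proof -
      have "Min (r ` {k\<in>K. m k < 0}) \<in> r ` {k\<in>K. m k < 0}"
        using fin neg by (intro Min_in) auto
      then obtain k2 where "k2 \<in> K" "m k2 < 0" "r k2 = Min (r ` {k\<in>K. m k < 0})" by auto
      moreover then have "r k2 \<le> r k" if "k \<in> K" "m k < 0" for k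
        using fin that by (auto intro: Min_le)
      ultimately show ?thesis using that by blast
    qed
    have feas: "feas s \<longleftrightarrow> r k1 \<le> s \<and> s \<le> r k2" for s
    proof
      assume "feas s" then show "r k1 \<le> s \<and> s \<le> r k2"
        using k1(1,2) k2(1,2) r_pos r_neg by (auto simp: feas_def)
    next
      assume s: "r k1 \<le> s \<and> s \<le> r k2"
      show "feas s"
        unfolding feas_def
      proof
        fix k assume k: "k \<in> K"
        consider "m k = 0" | "m k > 0" | "m k < 0" by linarith
        then show "a k + s * m k \<ge> 0"
        proof cases
          case 1 then show ?thesis using const[OF k] by simp
        next
          case 2 then show ?thesis using k1(3)[OF k 2] s r_pos[OF 2] by simp
        next
          case 3 then show ?thesis using k2(3)[OF k 3] s r_neg[OF 3] by simp
        qed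
      qed
    qed
    have "r k1 \<le> r k2" using s0 feas by auto
    have "Z = {k1, k2}"
    proof (intro equalityI subsetI)
      fix k assume "k \<in> Z"
      then obtain s where k: "k \<in> K" "feas s" "a k + s * m k = 0" by (auto simp: Z_def)
      have "m k \<noteq> 0" using const[OF k(1)] k(3) by auto
      then have s: "s = r k" using k(3) root by blast
      consider "m k > 0" | "m k < 0" using \<open>m k \<noteq> 0\<close> by linarith
      then have "r k = r k1 \<or> r k = r k2"
        using k1(3)[OF k(1)] k2(3)[OF k(1)] k(2) s feas by (cases; force)
      then have "a k1 + s * m k1 = 0 \<or> a k2 + s * m k2 = 0" using root k1(2) k2(2) s by auto
      then show "k \<in> {k1, k2}" using sep[OF k(1) k1(1) _ k(3)] sep[OF k(1) k2(1) _ k(3)] by blast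
    next
      fix k assume "k \<in> {k1, k2}"
      then show "k \<in> Z" using k1(1,2) k2(1,2) root[of k "r k"] feas \<open>r k1 \<le> r k2\<close>
        by (auto simp: Z_def root)
    qed
    moreover have "k1 \<noteq> k2" using k1(2) k2(2) by auto
    ultimately show ?thesis by simp
  qed
  then have "of_nat (card Z) = (0::bit)" by (elim disjE) simp_all
  finally show ?thesis by (simp add: feas_def)
qed

lemma sum_Plus_bool_bit:
  fixes h :: "'a + 'b \<times> bool \<Rightarrow> bit"
  assumes "finite A" "finite B"
  shows "sum h (A <+> B \<times> UNIV) = (\<Sum>x\<in>A. h (Inl x)) + (\<Sum>v\<in>B. h (Inr (v, False)) + h (Inr (v, True)))"
proof -
  have "sum h (A <+> B \<times> UNIV) = (\<Sum>x\<in>A. h (Inl x)) + (\<Sum>q\<in>B \<times> UNIV. h (Inr q))"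
    using assms by (subst sum.Plus) (simp_all add: o_def)
  also have "(\<Sum>q\<in>B \<times> UNIV. h (Inr q)) = (\<Sum>v\<in>B. \<Sum>i\<in>UNIV. h (Inr (v, i)))"
    by (simp add: sum.cartesian_product)
  finally show ?thesis by (simp add: UNIV_bool)
qed

section \<open>Intersection numbers of faces with the cells of a generic grid\<close>

locale grid_crossing = coloured_points W p for W :: "'c::finite \<Rightarrow> 'i set" and p :: "'c \<Rightarrow> 'i \<Rightarrow> real ^ 'd::finite" +
  fixes g :: "'d \<Rightarrow> nat \<Rightarrow> real" and N :: nat
  assumes card_c: "CARD('c) = Suc CARD('d)"
    and g_generic: "generic N UNIV g"
    and g_strict_mono: "strict_mono (g v)"
    and g_outer: "i \<in> W c \<Longrightarrow> g v 0 < p c i $ v \<and> p c i $ v < g v N"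
begin

definition hits :: "('d \<Rightarrow> nat) \<Rightarrow> 'd set \<Rightarrow> ('c \<Rightarrow> 'i option) \<Rightarrow> ('c \<Rightarrow> real) \<Rightarrow> bool" where
  "hits b I f l \<longleftrightarrow> (\<forall>c\<in>dom f. l c \<ge> 0) \<and> solution f (- I) (\<lambda>v. g v (b v)) l \<and>
     (\<forall>v\<in>I. g v (b v) \<le> comb f l $ v \<and> comb f l $ v \<le> g v (Suc (b v)))"

text \<open>A face has nominal dimension \<open>card (dom f) - 1\<close>, complementary to that of
  the cell in \<open>CARD('d)\<close>-dimensional space. In a generic grid the two then have at most
  one common point, so its existence is the mod 2 intersection number.\<close>

definition F :: "('d \<Rightarrow> nat) \<Rightarrow> 'd set \<Rightarrow> ('c \<Rightarrow> 'i option) \<Rightarrow> bit" where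
  "F b I f = of_bool (card (dom f) + card I = CARD('c) \<and> (\<exists>l. hits b I f l))"

lemma hits_cong: "(\<And>c. c \<in> dom f \<Longrightarrow> l c = l' c) \<Longrightarrow> hits b I f l = hits b I f l'"
proof -
  assume eq: "\<And>c. c \<in> dom f \<Longrightarrow> l c = l' c"
  then have "comb f l = comb f l'" unfolding comb_def by (auto intro!: sum.cong)
  then show ?thesis using eq solution_cong[of f l l' "- I"] by (simp add: hits_def)
qed

lemma hits_delete: "l q = 0 \<Longrightarrow> hits b I (f(q := None)) l = hits b I f l"
proof -
  assume q: "l q = 0"
  have "(\<forall>c\<in>dom (f(q := None)). l c \<ge> 0) = (\<forall>c\<in>dom f. l c \<ge> 0)" using q by auto
  then show ?thesis unfolding hits_def comb_delete[where f = f and l = l and q = q, OF q] solution_delete[where f = f and l = l and q = q, OF q] by blast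
qed

lemma solution_insert:
  "solution f (insert v J) t l \<longleftrightarrow> solution f J t l \<and> comb f l $ v = t v"
  by (auto simp: solution_def)

lemma g_Suc: "g v n < g v (Suc n)"
  using g_strict_mono by (simp add: strict_mono_def)

lemma hits_facet:
  assumes "v \<in> I"
  shows "hits b (I - {v}) f l \<longleftrightarrow> hits b I f l \<and> comb f l $ v = g v (b v)"
proof -
  have "- (I - {v}) = insert v (- I)" using assms by auto
  then show ?thesis unfolding hits_def solution_insert[symmetric]
    using assms g_Suc[of v "b v"] by (auto simp: solution_insert)
qed

lemma hits_facet_Suc:
  assumes "v \<in> I"
  shows "hits (b(v := Suc (b v))) (I - {v}) f l \<longleftrightarrow> hits b I f l \<and> comb f l $ v = g v (Suc (b v))"
proof -
  have "- (I - {v}) = insert v (- I)" using assms by auto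
  moreover have "solution f (- I) (\<lambda>w. g w ((b(v := Suc (b v))) w)) l = solution f (- I) (\<lambda>w. g w (b w)) l"
    using assms by (auto simp: solution_def)
  ultimately show ?thesis unfolding hits_def
    using assms g_Suc[of v "b v"] by (auto simp: solution_insert)
qed

text \<open>With one constraint too few the combinations form a line, and the feasible ones a segment;
  each of its two ends satisfies exactly one of the constraints with equality. These constraints are
  the terms of the two sums.\<close>

lemma F_boundary:
  assumes outside: "\<And>v. v \<notin> I \<Longrightarrow> b v \<le> N" and inside: "\<And>v. v \<in> I \<Longrightarrow> b v < N" and f: "f \<in> faces"
  shows "coboundary (F b I) f = facet_sum F b I f"
proof (cases "card (dom f) + card I = Suc CARD('c)")
  case False
  have "F b I (f(x := None)) = 0" if x: "x \<in> dom f" for x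
  proof -
    have "card (dom f) \<ge> 1" using x by (simp add: Suc_le_eq card_gt_0_iff) blast
    moreover have "card (dom (f(x := None))) = card (dom f) - 1" using x by simp
    ultimately have "card (dom (f(x := None))) + card I \<noteq> CARD('c)" using False by linarith
    then show ?thesis unfolding F_def by simp
  qed
  moreover have "F b' (I - {v}) f = 0" if v: "v \<in> I" for v b'
  proof -
    have "card I \<ge> 1" using v by (simp add: Suc_le_eq card_gt_0_iff) blast
    moreover have "card (I - {v}) = card I - 1" using v by simp
    ultimately have "card (dom f) + card (I - {v}) \<noteq> CARD('c)" using False by linarith
    then show ?thesis unfolding F_def by simp
  qed
  ultimately show ?thesis by (simp add: coboundary_def facet_sum_def)
next
  case True
  define J where "J = - I"
  define t where "t v = g v (b v)" for v
  have cJ: "card (dom f) = Suc (Suc (card J))"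
  proof -
    have "card I + card J = CARD('d)" unfolding J_def by (metis Compl_partition card_Un_disjoint disjoint_iff ComplD finite)
    then show ?thesis using True card_c by simp
  qed
  have Fx: "F b I (f(x := None)) = of_bool (\<exists>l. hits b I (f(x := None)) l)" if "x \<in> dom f" for x
    using True that card_Suc_Diff1[of "dom f" x] by (simp add: F_def)
  have Fv: "F b' (I - {v}) f = of_bool (\<exists>l. hits b' (I - {v}) f l)" if "v \<in> I" for v b'
    using True that card_Suc_Diff1[of I v] by (simp add: F_def)
  have Fx': "F b I (f(x := None)) = of_bool (\<exists>l. hits b I f l \<and> l x = 0)" if x: "x \<in> dom f" for x
  proof -
    have "(\<exists>l. hits b I (f(x := None)) l) = (\<exists>l. hits b I f l \<and> l x = 0)"
    proof
      assume "\<exists>l. hits b I (f(x := None)) l"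
      then obtain l where l: "hits b I (f(x := None)) l" by (elim exE) (rule that)
      have "hits b I (f(x := None)) (l(x := 0)) = hits b I (f(x := None)) l"
        by (rule hits_cong) auto
      then have "hits b I f (l(x := 0))" using l hits_delete[of "l(x := 0)" x b I f] by simp
      then show "\<exists>l. hits b I f l \<and> l x = 0" by (intro exI[of _ "l(x := 0)"]) simp
    next
      assume "\<exists>l. hits b I f l \<and> l x = 0"
      then show "\<exists>l. hits b I (f(x := None)) l" using hits_delete[of _ x b I f] by auto
    qed
    then show ?thesis using Fx[OF x] by simp
  qed
  have sol: "solution f J t l" if "hits b I f l" for l using that by (simp add: hits_def J_def t_def[abs_def])
  show ?thesis
  proof (cases "\<exists>l. solution f J t l")
    case False
    then have no: "\<not> hits b I f l" for l using sol by auto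
    then have "F b (I - {v}) f = 0" "F (b(v := Suc (b v))) (I - {v}) f = 0" if v: "v \<in> I" for v
      unfolding Fv[OF v] hits_facet[OF v, of b] hits_facet_Suc[OF v, of b] by simp_all
    then show ?thesis using Fx' no by (simp add: coboundary_def facet_sum_def)
  next
    case ex: True
    then obtain l0 where l0: "solution f J t l0" by (elim exE) (rule that)
    \<comment> \<open>\<open>card J + 1\<close> equations in \<open>card J + 2\<close> coefficients
      have a nonzero solution: the direction of the line of combinations.\<close>
    obtain m q where m: "sum m (dom f) = 0" "\<And>v. v \<in> J \<Longrightarrow> comb f m $ v = 0" and q: "q \<in> dom f" "m q \<noteq> 0"
    proof -
      define eqn where "eqn e c = (case e of None \<Rightarrow> 1 | Some v \<Rightarrow> p c (the (f c)) $ v)" for e c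
      have "card (insert None (Some ` J)) < card (dom f)" using cJ by (simp add: card_image)
      from homogeneous_system_solution[OF _ _ this, of "\<lambda>c e. eqn e c"]
      obtain m where m: "\<exists>c\<in>dom f. m c \<noteq> 0" "\<forall>e\<in>insert None (Some ` J). (\<Sum>c\<in>dom f. m c * eqn e c) = 0"
        by auto
      have "sum m (dom f) = 0" using m(2) by (simp add: eqn_def)
      moreover have "comb f m $ v = 0" if "v \<in> J" for v
        using m(2) that by (simp add: eqn_def comb_def)
      ultimately show ?thesis using m(1) that by blast
    qed
    define ls where "ls s c = l0 c + s * m c" for s c
    have sol_ls: "solution f J t (ls s)" for s
      unfolding ls_def[abs_def] by (rule solution_line[OF l0 m])
    have comb_ls: "comb f (ls s) = comb f l0 + s *\<^sub>R comb f m" for s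
      unfolding ls_def[abs_def] by (rule comb_add_scale)
    have tJ: "b v \<le> N" if "v \<in> J" for v using outside that by (simp add: J_def)
    \<comment> \<open>A solution off this line would give a second independent direction;
      eliminating two colours would then contradict genericity.\<close>
    have line: "\<exists>s. \<forall>c\<in>dom f. l c = ls s c" if l: "solution f J t l" for l
    proof (rule ccontr)
      assume no: "\<not> ?thesis"
      define s where "s = (l q - l0 q) / m q"
      define n where "n c = (l c + (-1) * l0 c) + (- s) * m c" for c
      obtain e where e: "e \<in> dom f" "l e \<noteq> ls s e" using no by blast
      have nq: "n q = 0" using q by (simp add: n_def s_def)
      have ne: "n e \<noteq> 0" using e(2) by (simp add: n_def ls_def)
      have n0: "sum n (dom f) = 0" using l l0 m(1)
        by (simp add: n_def sum.distrib sum_subtractf sum_distrib_left[symmetric] solution_def)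
      have nJ: "comb f n $ v = 0" if "v \<in> J" for v
        unfolding n_def[abs_def] comb_add_scale using l l0 m(2) that by (simp add: solution_def)
      obtain l1 where l1: "solution (f(q := None)) J t l1"
        using solution_eliminate[OF l0 m q(2)] by blast
      obtain l2 where l2: "solution (f(q := None, e := None)) J t l2"
        using solution_eliminate[OF l1, of n e] n0 nJ ne sum_delete[of n q f] comb_delete[of n q f] nq by auto
      have "e \<noteq> q" using nq ne by auto
      then have "card (dom (f(q := None, e := None))) = card J"
        using cJ q(1) e(1) by (simp add: card_Diff_singleton)
      then show False
        using genericD[OF g_generic, of J b "f(q := None, e := None)" l2] l2 tJ f
        by (simp add: face_delete t_def[abs_def])
    qed
    \<comment> \<open>The constraints: \<open>Inl\<close> for nonnegative coefficients,
      \<open>Inr\<close> for the lower (\<open>False\<close>) and upper (\<open>True\<close>) wall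
      in each direction of \<open>I\<close>.\<close>
    define K where "K = dom f <+> I \<times> (UNIV :: bool set)"
    define gb where "gb i v = (if i then g v (Suc (b v)) else g v (b v))" for i :: bool and v
    define sg where "sg i = (if i then - 1 else 1 :: real)" for i :: bool
    define a where "a k = (case k of Inl c \<Rightarrow> l0 c | Inr (v, i) \<Rightarrow> sg i * (comb f l0 $ v - gb i v))" for k
    define M where "M k = (case k of Inl c \<Rightarrow> m c | Inr (v, i) \<Rightarrow> sg i * (comb f m $ v))" for k
    have val: "a (Inl c) + s * M (Inl c) = ls s c" "a (Inr (v, i)) + s * M (Inr (v, i)) = sg i * (comb f (ls s) $ v - gb i v)" for c v i s
      by (simp_all add: a_def M_def ls_def comb_ls algebra_simps)
    have zero: "a (Inr (v, i)) + s * M (Inr (v, i)) = 0 \<longleftrightarrow> comb f (ls s) $ v = gb i v" for v i s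
      unfolding val by (simp add: sg_def)
    have feas: "(\<forall>k\<in>K. a k + s * M k \<ge> 0) \<longleftrightarrow> hits b I f (ls s)" for s
    proof -
      have "(\<forall>k\<in>K. a k + s * M k \<ge> 0) \<longleftrightarrow> (\<forall>c\<in>dom f. ls s c \<ge> 0) \<and>
          (\<forall>v\<in>I. sg False * (comb f (ls s) $ v - gb False v) \<ge> 0 \<and> sg True * (comb f (ls s) $ v - gb True v) \<ge> 0)"
        unfolding K_def val[symmetric] by (auto simp: Plus_def UNIV_bool)
      then show ?thesis using sol_ls[of s] by (simp add: hits_def J_def t_def[abs_def] gb_def sg_def)
    qed
    have ex_hits: "(\<exists>l. hits b I f l \<and> Q l) \<longleftrightarrow> (\<exists>s. hits b I f (ls s) \<and> Q (ls s))"
      if Q: "\<And>l l'. (\<And>c. c \<in> dom f \<Longrightarrow> l c = l' c) \<Longrightarrow> Q l = Q l'" for Q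
    proof
      assume "\<exists>l. hits b I f l \<and> Q l"
      then obtain l where l: "hits b I f l" "Q l" by (elim exE conjE) (rule that)
      obtain s where "\<forall>c\<in>dom f. l c = ls s c" using line[OF sol[OF l(1)]] by (elim exE) (rule that)
      then have "hits b I f (ls s)" "Q (ls s)" using l hits_cong[of f l "ls s" b I] Q[of l "ls s"] by auto
      then show "\<exists>s. hits b I f (ls s) \<and> Q (ls s)" by (intro exI[of _ s] conjI)
    next
      assume "\<exists>s. hits b I f (ls s) \<and> Q (ls s)"
      then obtain s where "hits b I f (ls s)" "Q (ls s)" by (elim exE conjE) (rule that)
      then show "\<exists>l. hits b I f l \<and> Q l" by (intro exI[of _ "ls s"] conjI)
    qed
    define h where "h k = (of_bool (\<exists>s. (\<forall>j\<in>K. a j + s * M j \<ge> 0) \<and> a k + s * M k = 0) :: bit)" for k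
    have "F b I (f(x := None)) = h (Inl x)" if x: "x \<in> dom f" for x
    proof -
      have "(\<exists>l. hits b I f l \<and> l x = 0) \<longleftrightarrow> (\<exists>s. hits b I f (ls s) \<and> ls s x = 0)"
        by (rule ex_hits) (use x in simp)
      then show ?thesis unfolding h_def feas val Fx'[OF x] by simp
    qed
    moreover have "F b (I - {v}) f = h (Inr (v, False))" "F (b(v := Suc (b v))) (I - {v}) f = h (Inr (v, True))" if v: "v \<in> I" for v
    proof -
      have "(\<exists>l. hits b I f l \<and> comb f l $ v = y) \<longleftrightarrow> (\<exists>s. hits b I f (ls s) \<and> comb f (ls s) $ v = y)" for y
      proof (rule ex_hits)
        fix l l' :: "'c \<Rightarrow> real" assume "\<And>c. c \<in> dom f \<Longrightarrow> l c = l' c"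
        then have "comb f l = comb f l'" unfolding comb_def by (auto intro!: sum.cong)
        then show "(comb f l $ v = y) = (comb f l' $ v = y)" by simp
      qed
      then show "F b (I - {v}) f = h (Inr (v, False))" "F (b(v := Suc (b v))) (I - {v}) f = h (Inr (v, True))"
        unfolding h_def feas zero Fv[OF v] hits_facet[OF v, of b] hits_facet_Suc[OF v, of b] by (simp_all add: gb_def)
    qed
    ultimately have "coboundary (F b I) f + facet_sum F b I f = sum h K"
      unfolding K_def by (subst sum_Plus_bool_bit) (simp_all add: coboundary_def facet_sum_def)
    also have "sum h K = 0"
      unfolding h_def
    proof (rule segment_parity)
      show "finite K" by (simp add: K_def)
      have pos_neg: "\<exists>c\<in>dom f. r * m c > 0" if "r \<noteq> 0" for r
      proof (rule ccontr)
        assume "\<not> ?thesis"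
        then have le: "\<forall>c\<in>dom f. - (r * m c) \<ge> 0" by (auto simp: not_less)
        have "(\<Sum>c\<in>dom f. - (r * m c)) = 0" using m(1) by (simp add: sum_negf sum_distrib_left[symmetric])
        then have "- (r * m q) = 0" using sum_nonneg_eq_0_iff[of "dom f" "\<lambda>c. - (r * m c)"] le q(1) by auto
        then show False using q(2) that by simp
      qed
      obtain c where "c \<in> dom f" "m c > 0" using pos_neg[of 1] by auto
      then show "\<exists>k\<in>K. M k > 0" by (intro bexI[of _ "Inl c"]) (auto simp: M_def K_def)
      obtain c where "c \<in> dom f" "m c < 0" using pos_neg[of "-1"] by auto
      then show "\<exists>k\<in>K. M k < 0" by (intro bexI[of _ "Inl c"]) (auto simp: M_def K_def)
      \<comment> \<open>Two constraints tight at once leave too few colours for the prescribed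
        coordinates. The cases of two coefficients, of a coefficient and a wall, and of two walls
        follow in turn.\<close>
      have two: False if "x \<in> dom f" "y \<in> dom f" "x \<noteq> y" "ls s x = 0" "ls s y = 0" for x y s
      proof -
        have "solution (f(x := None, y := None)) J t (ls s)"
          using sol_ls[of s] that by (simp only: solution_delete)
        moreover have "card (dom (f(x := None, y := None))) = card J"
          using cJ that by (simp add: card_Diff_singleton)
        ultimately show False
          using genericD[OF g_generic, of J b "f(x := None, y := None)" "ls s"] tJ f
          by (simp add: face_delete t_def[abs_def])
      qed
      have one: False if "x \<in> dom f" "v \<in> I" "ls s x = 0" "comb f (ls s) $ v = gb i v" for x v i s
      proof -
        define b' where "b' = b(v := b v + of_bool i)"
        have "solution f (insert v J) (\<lambda>v. g v (b' v)) (ls s)"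
          using sol_ls[of s] that by (auto simp: solution_def b'_def J_def t_def gb_def)
        then have "solution (f(x := None)) (insert v J) (\<lambda>v. g v (b' v)) (ls s)"
          using that by (simp only: solution_delete)
        moreover have "card (dom (f(x := None))) = card (insert v J)"
          using cJ that by (simp add: card_Diff_singleton J_def)
        moreover have "b' w \<le> N" if "w \<in> insert v J" for w
          using that tJ[of w] inside[OF \<open>v \<in> I\<close>] by (auto simp: b'_def)
        ultimately show False
          using genericD[OF g_generic, of "insert v J" b' "f(x := None)" "ls s"] f
          by (simp add: face_delete)
      qed
      have none: False if "v \<in> I" "w \<in> I" "(v, i) \<noteq> (w, j)" "comb f (ls s) $ v = gb i v" "comb f (ls s) $ w = gb j w" for v w i j s
      proof (cases "v = w")
        case True
        then show False using that g_Suc[of v "b v"] by (auto simp: gb_def split: if_splits)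
      next
        case False
        define b' where "b' = b(v := b v + of_bool i, w := b w + of_bool j)"
        have "solution f (insert v (insert w J)) (\<lambda>v. g v (b' v)) (ls s)"
          using sol_ls[of s] that False by (auto simp: solution_def b'_def J_def t_def gb_def)
        moreover have "card (dom f) = card (insert v (insert w J))"
          using cJ that False by (simp add: J_def)
        moreover have "b' u \<le> N" if "u \<in> insert v (insert w J)" for u
          using that tJ[of u] inside[OF \<open>v \<in> I\<close>] inside[OF \<open>w \<in> I\<close>] by (auto simp: b'_def)
        ultimately show False
          using genericD[OF g_generic, of "insert v (insert w J)" b' f "ls s"] f by simp
      qed
      show False if k: "k \<in> K" "k' \<in> K" "k \<noteq> k'" "a k + s * M k = 0" "a k' + s * M k' = 0" for k k' s
      proof (cases k)
        case k1: (Inl x)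
        show False
        proof (cases k')
          case (Inl y)
          then show False using k k1 two[of x y s] val(1) by (auto simp: K_def)
        next
          case (Inr u)
          obtain v i where "u = (v, i)" by (cases u)
          then show False using k k1 Inr one[of x v s i] val(1) zero by (auto simp: K_def)
        qed
      next
        case k1: (Inr u)
        obtain v i where u: "u = (v, i)" by (cases u)
        show False
        proof (cases k')
          case (Inl y)
          then show False using k k1 u one[of y v s i] val(1) zero by (auto simp: K_def)
        next
          case (Inr u')
          obtain w j where "u' = (w, j)" by (cases u')
          then show False using k k1 u Inr none[of v w i j s] zero by (auto simp: K_def)
        qed
      qed
    qed
    finally show ?thesis by (metis add.right_neutral bit_double_left)
  qed
qed

lemma F_homogeneous: "homogeneous (CARD('c) - card I) (F b I)"
  by (auto simp: homogeneous_def F_def)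

text \<open>All points lie strictly between the outer walls, hence so do their convex
  combinations.\<close>

lemma F_outer:
  assumes "v \<notin> I" "b v = 0 \<or> b v = N" "f \<in> faces"
  shows "F b I f = 0"
proof -
  have "\<not> hits b I f l" for l
  proof
    assume h: "hits b I f l"
    then have l: "sum l (dom f) = 1" "comb f l $ v = g v (b v)" "\<And>c. c \<in> dom f \<Longrightarrow> l c \<ge> 0"
      using assms(1) by (auto simp: hits_def solution_def)
    obtain c where c: "c \<in> dom f" "l c > 0"
      using l(1,3) by (metis less_eq_real_def sum.neutral zero_neq_one)
    have x: "g v 0 < p c (the (f c)) $ v" "p c (the (f c)) $ v < g v N" if "c \<in> dom f" for c
      using g_outer[of "the (f c)" c v] assms(3) that by (auto simp: faces_def)
    have e: "comb f l $ v = (\<Sum>c\<in>dom f. l c * p c (the (f c)) $ v)" by (simp add: comb_def)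
    have s: "(\<Sum>c\<in>dom f. l c * y) = y" for y using l(1) by (simp add: sum_distrib_right[symmetric])
    have "(\<Sum>c\<in>dom f. l c * g v 0) < comb f l $ v" unfolding e
      by (intro sum_strict_mono_ex1 ballI bexI[of _ c] c(1) mult_left_mono mult_strict_left_mono c(2) l(3) less_imp_le[OF x(1)] x(1)) simp_all
    moreover have "comb f l $ v < (\<Sum>c\<in>dom f. l c * g v N)" unfolding e
      by (intro sum_strict_mono_ex1 ballI bexI[of _ c] c(1) mult_left_mono mult_strict_left_mono c(2) l(3) less_imp_le[OF x(2)] x(2)) simp_all
    ultimately show False using assms(2) l(2) s by auto
  qed
  then show ?thesis by (simp add: F_def)
qed

text \<open>Genericity, applied to a single point, keeps it off the walls, so it lies inside exactly
  one top cell. \<open>n v\<close> is the first wall beyond it, which gives this cell the index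
  \<open>n v - 1\<close>.\<close>

lemma F_vertex:
  assumes i: "i \<in> W c"
  shows "(\<Sum>b\<in>{b. \<forall>v. b v < N}. F b UNIV [c \<mapsto> i]) = 1"
proof -
  let ?f = "[c \<mapsto> i]"
  have f: "?f \<in> faces" using i by (simp add: faces_def)
  have comb: "comb ?f l = l c *\<^sub>R p c i" for l by (simp add: comb_def)
  have ne: "g v n \<noteq> p c i $ v" if "n \<le> N" for v n
  proof
    assume "g v n = p c i $ v"
    then have "solution ?f {v} (\<lambda>v. g v n) (\<lambda>_. 1)" by (simp add: solution_def comb)
    then show False using genericD[OF g_generic, of "{v}" "\<lambda>_. n" ?f "\<lambda>_. 1"] that f by simp
  qed
  define n where "n v = (LEAST n. p c i $ v < g v n)" for v
  have n: "p c i $ v < g v (n v)" "\<And>k. k < n v \<Longrightarrow> g v k \<le> p c i $ v" "n v \<le> N" "n v > 0" for v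
  proof -
    show 1: "p c i $ v < g v (n v)" unfolding n_def by (rule LeastI[of _ N]) (use g_outer[OF i] in blast)
    show "g v k \<le> p c i $ v" if "k < n v" for k
      using not_less_Least[of k "\<lambda>n. p c i $ v < g v n"] that by (simp add: n_def not_less)
    show "n v \<le> N" unfolding n_def by (rule Least_le) (use g_outer[OF i] in blast)
    show "n v > 0" using 1 g_outer[OF i, of v] by (cases "n v") auto
  qed
  have "F b UNIV ?f = of_bool (b = (\<lambda>v. n v - 1))" if b: "\<forall>v. b v < N" for b
  proof -
    have "F b UNIV ?f = of_bool (\<forall>v. g v (b v) \<le> p c i $ v \<and> p c i $ v \<le> g v (Suc (b v)))"
    proof -
      have "(\<exists>l. hits b UNIV ?f l) \<longleftrightarrow> (\<forall>v. g v (b v) \<le> p c i $ v \<and> p c i $ v \<le> g v (Suc (b v)))"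
        unfolding hits_def solution_def comb by (auto intro!: exI[of _ "\<lambda>_. 1"])
      then show ?thesis by (simp add: F_def card_c)
    qed
    also have "(\<forall>v. g v (b v) \<le> p c i $ v \<and> p c i $ v \<le> g v (Suc (b v))) \<longleftrightarrow> b = (\<lambda>v. n v - 1)"
    proof
      assume h: "\<forall>v. g v (b v) \<le> p c i $ v \<and> p c i $ v \<le> g v (Suc (b v))"
      have "b v = n v - 1" for v
      proof -
        have "g v (Suc (b v)) \<noteq> p c i $ v" using b by (intro ne) (simp add: Suc_le_eq)
        then have "p c i $ v < g v (Suc (b v))" using h by (simp add: order_less_le)
        then have "n v \<le> Suc (b v)" unfolding n_def by (rule Least_le)
        moreover have "b v < n v"
        proof -
          have "g v (b v) < g v (n v)" using h n(1) le_less_trans by blast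
          then show ?thesis using g_strict_mono strict_mono_less by blast
        qed
        ultimately show ?thesis by simp
      qed
      then show "b = (\<lambda>v. n v - 1)" by blast
    next
      assume "b = (\<lambda>v. n v - 1)"
      then show "\<forall>v. g v (b v) \<le> p c i $ v \<and> p c i $ v \<le> g v (Suc (b v))"
        using n by (auto simp: less_imp_le)
    qed
    finally show ?thesis .
  qed
  then have "(\<Sum>b\<in>{b. \<forall>v. b v < N}. F b UNIV ?f) = (\<Sum>b\<in>{b. \<forall>v. b v < N}. of_bool (b = (\<lambda>v. n v - 1)))"
    by (intro sum.cong) auto
  also have "\<dots> = 1"
  proof -
    have "{b :: 'd \<Rightarrow> nat. \<forall>v. b v < N} = UNIV \<rightarrow>\<^sub>E {..<N}" by (auto simp: PiE_def)
    then have "finite {b :: 'd \<Rightarrow> nat. \<forall>v. b v < N}" by (simp add: finite_PiE)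
    moreover have "n v - 1 < N" for v using n(3,4)[of v] by linarith
    ultimately show ?thesis by (simp add: of_bool_def sum.delta)
  qed
  finally show ?thesis .
qed

end

text \<open>Lebesgue numbers: if a subfamily has no common point, the complements of its members
  cover one of them, so a small enough \<open>Q\<close> cannot meet them all. One size works for the
  finitely many subfamilies, and the subfamily met by \<open>Q\<close> then has a common
  point.\<close>

lemma compact_family_small_sets:
  fixes K :: "'k \<Rightarrow> 'a::metric_space set"
  assumes X: "finite X" and K: "\<And>k. k \<in> X \<Longrightarrow> compact (K k)"
  shows "\<exists>e>0. \<forall>Q. (\<forall>x\<in>Q. \<forall>y\<in>Q. dist x y < e) \<longrightarrow> (\<exists>z. \<forall>k\<in>X. K k \<inter> Q \<noteq> {} \<longrightarrow> z \<in> K k)"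
proof -
  define bad where "bad Y e \<longleftrightarrow> (\<exists>Q. (\<forall>x\<in>Q. \<forall>y\<in>Q. dist x y < e) \<and> (\<forall>k\<in>Y. K k \<inter> Q \<noteq> {}))" for Y e
  have "eventually (\<lambda>e. \<not> bad Y e) (at_right 0)" if Y: "Y \<subseteq> X" "(\<Inter>k\<in>Y. K k) = {}" for Y
  proof -
    obtain k0 where k0: "k0 \<in> Y" using Y(2) by fastforce
    have op: "open G" if "G \<in> (\<lambda>k. - K k) ` Y" for G
      using that Y(1) K by (auto intro!: open_Compl compact_imp_closed)
    have cov: "K k0 \<subseteq> \<Union>((\<lambda>k. - K k) ` Y)" using Y(2) by blast
    have "compact (K k0)" using K k0 Y(1) by blast
    from Heine_Borel_lemma[OF this cov op] obtain e
      where e: "e > 0" "\<And>x. x \<in> K k0 \<Longrightarrow> \<exists>G\<in>(\<lambda>k. - K k) ` Y. ball x e \<subseteq> G" by blast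
    have "\<not> bad Y e'" if e': "e' \<le> e" for e'
    proof
      assume "bad Y e'"
      then obtain Q where Q: "\<forall>x\<in>Q. \<forall>y\<in>Q. dist x y < e'" "\<forall>k\<in>Y. K k \<inter> Q \<noteq> {}"
        unfolding bad_def by (elim exE conjE) (rule that)
      obtain q where q: "q \<in> K k0" "q \<in> Q" using Q(2) k0 by blast
      obtain k where k: "k \<in> Y" "ball q e \<subseteq> - K k" using e(2)[OF q(1)] by blast
      obtain x where x: "x \<in> K k" "x \<in> Q" using Q(2) k(1) by blast
      have "dist q x < e'" using Q(1) q(2) x(2) by blast
      then have "x \<in> ball q e" using e' by simp
      then show False using k(2) x(1) by blast
    qed
    then show ?thesis unfolding eventually_at_right_field using e(1) by (intro exI[of _ e]) auto
  qed
  then have "eventually (\<lambda>e. \<forall>Y\<in>{Y\<in>Pow X. (\<Inter>k\<in>Y. K k) = {}}. \<not> bad Y e) (at_right 0)"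
    using X by (intro eventually_ball_finite) auto
  moreover have "eventually (\<lambda>e::real. e > 0) (at_right 0)" by (rule eventually_at_right_less)
  ultimately have "eventually (\<lambda>e. e > 0 \<and> (\<forall>Y\<in>{Y\<in>Pow X. (\<Inter>k\<in>Y. K k) = {}}. \<not> bad Y e)) (at_right 0)"
    by (rule eventually_conj[rotated])
  then obtain e :: real where e: "e > 0" "\<forall>Y\<in>{Y\<in>Pow X. (\<Inter>k\<in>Y. K k) = {}}. \<not> bad Y e"
    using eventually_happens'[OF trivial_limit_at_right_real] by blast
  have "\<exists>z. \<forall>k\<in>X. K k \<inter> Q \<noteq> {} \<longrightarrow> z \<in> K k" if Q: "\<forall>x\<in>Q. \<forall>y\<in>Q. dist x y < e" for Q
  proof (rule ccontr)
    assume no: "\<not> ?thesis"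
    define Y where "Y = {k\<in>X. K k \<inter> Q \<noteq> {}}"
    have "(\<Inter>k\<in>Y. K k) = {}" using no by (auto simp: Y_def)
    then have "\<not> bad Y e" using e(2) by (auto simp: Y_def)
    moreover have "bad Y e" unfolding bad_def by (intro exI[of _ Q]) (use Q in \<open>auto simp: Y_def\<close>)
    ultimately show False by blast
  qed
  then show ?thesis using e(1) by blast
qed

section \<open>Densities of sets of faces\<close>

context partite_complex
begin

definition density :: "(('c \<Rightarrow> 'i option) \<Rightarrow> bool) \<Rightarrow> real" where
  "density P = (\<Sum>f\<in>{f\<in>faces. P f}. weight f)"

lemma density_mono:
  assumes "\<And>f. f \<in> faces \<Longrightarrow> P f \<Longrightarrow> Q f"
  shows "density P \<le> density Q"
  unfolding density_def using assms finite_faces weight_pos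
  by (intro sum_mono2) (auto simp: less_imp_le)

lemma density_Bex: "finite J \<Longrightarrow> density (\<lambda>f. \<exists>j\<in>J. P j f) \<le> (\<Sum>j\<in>J. density (P j))"
proof (induction J rule: finite_induct)
  case empty
  then show ?case by (simp add: density_def)
next
  case (insert a J)
  have "{f\<in>faces. \<exists>j\<in>insert a J. P j f} = {f\<in>faces. P a f} \<union> {f\<in>faces. \<exists>j\<in>J. P j f}" by auto
  then have "density (\<lambda>f. \<exists>j\<in>insert a J. P j f) \<le> density (P a) + density (\<lambda>f. \<exists>j\<in>J. P j f)"
    unfolding density_def using finite_faces sum_nonneg[of "{f\<in>faces. P a f} \<inter> {f\<in>faces. \<exists>j\<in>J. P j f}" weight] weight_pos
    by (simp only:) (simp add: sum_Un less_imp_le)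
  then show ?case using insert by simp
qed

lemma size_of_eq_density: "size_of A = density (\<lambda>f. A f \<noteq> 0)"
  unfolding size_of_def density_def using finite_faces
  by (intro sum.mono_neutral_cong_right) auto

lemma density_dom: "density (\<lambda>f. dom f = T) = 1"
proof -
  have "finite T" by simp
  then show ?thesis
  proof (induction T rule: finite_induct)
    case empty
    have "{f\<in>faces. dom f = {}} = {Map.empty}" by (auto simp: faces_def)
    then show ?case by (simp add: density_def weight_def)
  next
    case (insert c T)
    have "density (\<lambda>f. dom f = insert c T) = (\<Sum>g\<in>{g\<in>faces. c \<in> dom g}. if dom g = insert c T then weight g else 0)"
      unfolding density_def using finite_faces by (intro sum.mono_neutral_cong_left) auto
    also have "\<dots> = (\<Sum>v\<in>W c. \<Sum>f\<in>{f\<in>faces. c \<notin> dom f}. if dom f = T then weight f / real (card (W c)) else 0)"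
      unfolding sum_faces_with_colour
    proof (intro sum.cong refl)
      fix v f assume "f \<in> {f\<in>faces. c \<notin> dom f}"
      then have c: "c \<notin> dom f" by simp
      then have "insert c (dom f) = insert c T \<longleftrightarrow> dom f = T" using insert.hyps(2) by (metis insert_ident)
      then show "(if dom (f(c := Some v)) = insert c T then weight (f(c := Some v)) else 0)
        = (if dom f = T then weight f / real (card (W c)) else 0)"
        using weight_insert[OF c] by simp
    qed
    also have "\<dots> = (\<Sum>f\<in>{f\<in>faces. c \<notin> dom f}. if dom f = T then weight f else 0)"
      using card_W_pos[of c] by (simp add: sum_distrib_left if_distrib[of "\<lambda>x. _ * x"] cong: if_cong)
    also have "\<dots> = density (\<lambda>f. dom f = T)"
      unfolding density_def using finite_faces insert.hyps(2) by (intro sum.mono_neutral_cong_right) auto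
    finally show ?case using insert.IH by simp
  qed
qed

text \<open>Fubini: for each choice of the other colours, given as the face without
  \<open>j\<close>, at most a fraction \<open>\<eta>\<close> of the vertices of colour
  \<open>j\<close> is bad.\<close>

lemma density_transversal:
  assumes "j \<in> T" and B: "\<And>f. f \<in> faces \<Longrightarrow> dom f = T - {j} \<Longrightarrow> real (card {v\<in>W j. B f v}) \<le> \<eta> * real (card (W j))"
  shows "density (\<lambda>f. dom f = T \<and> B (f(j := None)) (the (f j))) \<le> \<eta>"
proof -
  define S where "S = {f\<in>faces. j \<notin> dom f}"
  have fS: "finite S" using finite_faces by (simp add: S_def)
  have "density (\<lambda>f. dom f = T \<and> B (f(j := None)) (the (f j)))
      = (\<Sum>g\<in>{g\<in>faces. j \<in> dom g}. if dom g = T \<and> B (g(j := None)) (the (g j)) then weight g else 0)"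
    unfolding density_def using finite_faces assms(1) by (intro sum.mono_neutral_cong_left) auto
  also have "\<dots> = (\<Sum>v\<in>W j. \<Sum>f\<in>S. if dom f = T - {j} \<and> B f v then weight f / real (card (W j)) else 0)"
    unfolding sum_faces_with_colour S_def[symmetric]
  proof (intro sum.cong refl)
    fix v f assume "f \<in> S"
    then have c: "j \<notin> dom f" by (simp add: S_def)
    then have "f(j := None) = f" by auto
    moreover have "insert j (dom f) = T \<longleftrightarrow> dom f = T - {j}" using c assms(1) by auto
    ultimately show "(if dom (f(j := Some v)) = T \<and> B (f(j := Some v, j := None)) (the ((f(j := Some v)) j)) then weight (f(j := Some v)) else 0)
      = (if dom f = T - {j} \<and> B f v then weight f / real (card (W j)) else 0)"
      using weight_insert[OF c] by simp
  qed
  also have "\<dots> = (\<Sum>f\<in>S. \<Sum>v\<in>W j. if dom f = T - {j} \<and> B f v then weight f / real (card (W j)) else 0)"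
    by (rule sum.swap)
  also have "\<dots> \<le> (\<Sum>f\<in>S. if dom f = T - {j} then weight f * \<eta> else 0)"
  proof (intro sum_mono)
    fix f assume f: "f \<in> S"
    show "(\<Sum>v\<in>W j. if dom f = T - {j} \<and> B f v then weight f / real (card (W j)) else 0)
      \<le> (if dom f = T - {j} then weight f * \<eta> else 0)"
    proof (cases "dom f = T - {j}")
      case True
      have "(\<Sum>v\<in>W j. if B f v then weight f / real (card (W j)) else 0)
          = real (card {v\<in>W j. B f v}) * (weight f / real (card (W j)))"
        using finite_W by (simp add: sum.If_cases Int_def)
      also have "\<dots> \<le> (\<eta> * real (card (W j))) * (weight f / real (card (W j)))"
        using B[of f] f True weight_pos[of f] by (intro mult_right_mono) (auto simp: S_def less_imp_le)
      also have "\<dots> = weight f * \<eta>" using card_W_pos[of j] by simp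
      finally show ?thesis using True by simp
    qed simp
  qed
  also have "\<dots> = (\<Sum>f\<in>S. if dom f = T - {j} then weight f else 0) * \<eta>"
    by (simp add: sum_distrib_right if_distrib[of "\<lambda>x. x * _"] cong: if_cong)
  also have "(\<Sum>f\<in>S. if dom f = T - {j} then weight f else 0) = density (\<lambda>f. dom f = T - {j})"
    unfolding density_def using finite_faces by (intro sum.mono_neutral_cong_right) (auto simp: S_def)
  also note density_dom
  finally show ?thesis by (simp only: mult_1)
qed

end

lemma exists_hyperplane_superset:
  fixes S :: "(real ^ 'd::finite) set"
  assumes "finite S" "card S \<le> CARD('d)"
  shows "\<exists>H. hyperplane H \<and> S \<subseteq> H"
proof -
  have "aff_dim S \<le> int (card S) - 1" using assms(1) by (rule aff_dim_le_card)
  then have "aff_dim S < int DIM(real ^ 'd)" using assms(2) by simp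
  then obtain a b where "a \<noteq> 0" "S \<subseteq> {x. a \<bullet> x = b}" by (rule aff_lowdim_subset_hyperplane)
  then show ?thesis unfolding hyperplane_def by blast
qed

context coloured_points
begin

text \<open>Some coefficient \<open>l j\<close> is nonzero, so the point of colour \<open>j\<close>
  lies in any hyperplane through \<open>z\<close> and the other points. These are at most
  \<open>CARD('d)\<close> points, so such a hyperplane exists and can be chosen without knowing the
  vertex of colour \<open>j\<close>.\<close>

lemma density_affine_combination:
  assumes hyp: "\<And>H c. hyperplane H \<Longrightarrow> real (card {i\<in>W c. p c i \<in> H}) \<le> \<eta> * real (card (W c))"
    and T: "card T \<le> CARD('d)"
  shows "density (\<lambda>f. dom f = T \<and> (\<exists>l. sum l (dom f) = 1 \<and> comb f l = z)) \<le> real (card T) * \<eta>"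
proof -
  define H where "H f = (SOME H. hyperplane H \<and> insert z ((\<lambda>c. p c (the (f c))) ` dom f) \<subseteq> H)" for f
  have H: "hyperplane (H f) \<and> insert z ((\<lambda>c. p c (the (f c))) ` dom f) \<subseteq> H f" if "Suc (card (dom f)) \<le> CARD('d)" for f
    unfolding H_def
  proof (rule someI_ex, rule exists_hyperplane_superset)
    have "card (insert z ((\<lambda>c. p c (the (f c))) ` dom f)) \<le> Suc (card ((\<lambda>c. p c (the (f c))) ` dom f))"
      by (simp add: card_insert_if)
    also have "\<dots> \<le> Suc (card (dom f))" by (simp add: card_image_le)
    finally show "card (insert z ((\<lambda>c. p c (the (f c))) ` dom f)) \<le> CARD('d)" using that by simp
  qed simp
  have cT: "Suc (card (T - {j})) \<le> CARD('d)" if "j \<in> T" for j using T that card_Suc_Diff1[of T j] by simp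
  have "density (\<lambda>f. dom f = T \<and> (\<exists>l. sum l (dom f) = 1 \<and> comb f l = z))
      \<le> density (\<lambda>f. \<exists>j\<in>T. dom f = T \<and> p j (the (f j)) \<in> H (f(j := None)))"
  proof (rule density_mono)
    fix f assume "dom f = T \<and> (\<exists>l. sum l (dom f) = 1 \<and> comb f l = z)"
    then obtain l where f: "dom f = T" and l: "sum l T = 1" "comb f l = z" by auto
    obtain j where j: "j \<in> T" "l j \<noteq> 0" using l(1) by (metis sum.neutral zero_neq_one)
    have "hyperplane (H (f(j := None))) \<and> insert z ((\<lambda>c. p c (the ((f(j := None)) c))) ` dom (f(j := None))) \<subseteq> H (f(j := None))"
      by (rule H) (use cT[OF j(1)] f in simp)
    then obtain a b where ab: "H (f(j := None)) = {x. a \<bullet> x = b}"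
      and sub: "insert z ((\<lambda>c. p c (the ((f(j := None)) c))) ` dom (f(j := None))) \<subseteq> {x. a \<bullet> x = b}"
      unfolding hyperplane_def by auto
    have az: "a \<bullet> z = b" using sub by simp
    have ap: "a \<bullet> p c (the (f c)) = b" if "c \<in> T - {j}" for c
      using subsetD[OF sub, of "p c (the (f c))"] that f by (auto intro!: rev_image_eqI[of c])
    have "b = (\<Sum>c\<in>T. l c * (a \<bullet> p c (the (f c))))"
      using az l(2) f by (simp add: comb_def inner_sum_right[symmetric] flip: inner_scaleR_right)
    also have "\<dots> = l j * (a \<bullet> p j (the (f j))) + (\<Sum>c\<in>T - {j}. l c * b)"
      using j(1) ap by (simp add: sum.remove)
    also have "(\<Sum>c\<in>T - {j}. l c * b) = (1 - l j) * b"
      using j(1) l(1) by (simp add: sum_distrib_right[symmetric] sum_diff1)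
    finally have "l j * (a \<bullet> p j (the (f j))) = l j * b" by (simp only: algebra_simps)
    then have "p j (the (f j)) \<in> H (f(j := None))" using j(2) ab by simp
    then show "\<exists>j\<in>T. dom f = T \<and> p j (the (f j)) \<in> H (f(j := None))" using j(1) f by blast
  qed
  also have "\<dots> \<le> (\<Sum>j\<in>T. density (\<lambda>f. dom f = T \<and> p j (the (f j)) \<in> H (f(j := None))))"
    by (rule density_Bex) simp
  also have "\<dots> \<le> (\<Sum>j\<in>T. \<eta>)"
  proof (rule sum_mono)
    fix j assume j: "j \<in> T"
    show "density (\<lambda>f. dom f = T \<and> p j (the (f j)) \<in> H (f(j := None))) \<le> \<eta>"
    proof (rule density_transversal[where B = "\<lambda>f v. p j v \<in> H f", OF j])
      fix f :: "'c \<Rightarrow> 'i option" assume "dom f = T - {j}"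
      then show "real (card {v\<in>W j. p j v \<in> H f}) \<le> \<eta> * real (card (W j))"
        using H[of f] cT[OF j] by (intro hyp) simp
    qed
  qed
  finally show ?thesis by simp
qed

end

text \<open>\<open>\<sigma>\<close> bounds the crossing cochains at grid vertices. At a cell of
  positive dimension all face hulls that meet it share a point \<open>z\<close>; the crossing faces
  miss a colour, and \<open>density_affine_combination\<close> bounds them by
  \<open>CARD('d) * \<eta>\<close> for each of at most \<open>2 ^ CARD('c)\<close> sets of colours.
  The maximum of the two is the size fed into \<open>crossing_size_bound\<close>.\<close>

theorem colourful_selection:
  fixes W :: "'c::finite \<Rightarrow> 'i set" and p :: "'c \<Rightarrow> 'i \<Rightarrow> real ^ 'd::finite"
  assumes "partite_complex W" and card_c: "CARD('c) = Suc CARD('d)"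
    and hyp: "\<And>H c. hyperplane H \<Longrightarrow> real (card {i\<in>W c. p c i \<in> H}) \<le> \<eta> * real (card (W c))"
    and sel: "\<And>y. partite_complex.density W (\<lambda>f. dom f = UNIV \<and> y \<in> convex hull (range (\<lambda>c. p c (the (f c))))) \<le> \<sigma>"
  shows "1 \<le> (2 ^ CARD('c) * (2 * real CARD('c) + 1)) ^ CARD('c) * max \<sigma> (2 ^ CARD('c) * real CARD('d) * \<eta>)"
proof -
  interpret coloured_points W p using assms(1) by (simp add: coloured_points_def)
  define pts where "pts f = (\<lambda>c. p c (the (f c))) ` dom f" for f
  have comb_hull: "comb f l \<in> convex hull (pts f)" if "sum l (dom f) = 1" "\<forall>c\<in>dom f. l c \<ge> 0" for f l
    unfolding comb_def using that by (intro convex_sum) (auto simp: pts_def intro: hull_inc)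
  have hull_comb: "\<exists>l. sum l (dom f) = 1 \<and> comb f l = z" if "z \<in> convex hull (pts f)" for f z
    using subsetD[OF convex_hull_image_indexed that[unfolded pts_def]] unfolding comb_def by auto
  have \<eta>: "\<eta> \<ge> 0"
  proof -
    fix c :: 'c
    obtain H :: "(real ^ 'd) set" where "hyperplane H" using exists_hyperplane_superset[of "{}"] by auto
    then have "0 \<le> \<eta> * real (card (W c))" using hyp[of H c] by linarith
    then show ?thesis using card_W_pos[of c] by (simp add: zero_le_mult_iff)
  qed
  define d where "d = real CARD('d)"
  have d: "d > 0" by (simp add: d_def)
  have "compact (convex hull (pts f))" for f
    by (intro compact_convex_hull finite_imp_compact) (simp add: pts_def)
  then obtain e where e: "e > 0"
    "\<And>Q. (\<forall>x\<in>Q. \<forall>y\<in>Q. dist x y < e) \<Longrightarrow> \<exists>z. \<forall>f\<in>faces. convex hull (pts f) \<inter> Q \<noteq> {} \<longrightarrow> z \<in> convex hull (pts f)"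
    using compact_family_small_sets[OF finite_faces, of "\<lambda>f. convex hull (pts f)"] by blast
  \<comment> \<open>Edges are shorter than \<open>2 * h\<close>, so in the sum norm the diameter of
    a cell is at most \<open>2 * d * h = e / 2\<close>.\<close>
  define h where "h = e / (4 * d)"
  have h: "h > 0" using e(1) d by (simp add: h_def)
  define R where "R = Max (insert 0 ((\<lambda>(c, i, v). \<bar>p c i $ v\<bar>) ` (SIGMA c:UNIV. W c \<times> UNIV))) + 1"
  have R: "\<bar>p c i $ v\<bar> < R" if "i \<in> W c" for c i v
  proof -
    have "finite (SIGMA c:(UNIV :: 'c set). W c \<times> (UNIV :: 'd set))" using finite_W by auto
    then have "\<bar>p c i $ v\<bar> \<le> Max (insert 0 ((\<lambda>(c, i, v). \<bar>p c i $ v\<bar>) ` (SIGMA c:UNIV. W c \<times> UNIV)))"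
      using that by (intro Max_ge) (auto intro!: rev_image_eqI[of "(c, i, v)"])
    then show ?thesis by (simp add: R_def)
  qed
  obtain N :: nat where N: "real N * h > 2 * R + h"
    using reals_Archimedean3[OF h] by blast
  \<comment> \<open>Consecutive disjoint intervals of length \<open>h\<close>: the first lies below
    \<open>- R\<close>, and the choice of \<open>N\<close> puts the one with index \<open>N\<close>
    above \<open>R\<close>.\<close>
  define U where "U v n = {real n * h - R - h <..< (real n + 1) * h - R - h}" for v :: 'd and n :: nat
  have infU: "infinite (U v n)" for v n unfolding U_def by (rule infinite_Ioo) (simp add: h algebra_simps)
  have "\<exists>g. (\<forall>v n. g v n \<in> U v n) \<and> generic N UNIV g" by (rule exists_generic) (rule infU)
  then obtain g where gU: "\<And>v n. g v n \<in> U v n" and gen: "generic N UNIV g"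
    by blast
  have step: "g v n < g v (Suc n)" "g v (Suc n) - g v n < 2 * h" for v n
    using gU[of v n] gU[of v "Suc n"] by (auto simp: U_def algebra_simps)
  interpret grid_crossing W p g N
  proof
    show "CARD('c) = Suc CARD('d)" by (rule card_c)
    show "generic N UNIV g" by (rule gen)
    show "strict_mono (g v)" for v by (simp add: strict_mono_Suc_iff step)
    show "g v 0 < p c i $ v \<and> p c i $ v < g v N" if "i \<in> W c" for i c v
      using gU[of v 0] gU[of v N] R[OF that, of v] N by (auto simp: U_def algebra_simps)
  qed
  define s where "s = max \<sigma> (2 ^ CARD('c) * d * \<eta>)"
  have size: "size_of (F b I) \<le> s" if "\<And>v. v \<notin> I \<Longrightarrow> b v \<le> N" "\<And>v. v \<in> I \<Longrightarrow> b v < N" for b I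
  proof (cases "I = {}")
    case True
    define y where "y = (\<chi> v. g v (b v))"
    have "size_of (F b I) \<le> density (\<lambda>f. dom f = UNIV \<and> y \<in> convex hull (range (\<lambda>c. p c (the (f c)))))"
      unfolding size_of_eq_density
    proof (rule density_mono)
      fix f assume "F b I f \<noteq> 0"
      then obtain l where f: "card (dom f) = CARD('c)" and l: "hits b {} f l"
        using True by (auto simp: F_def)
      have dom: "dom f = UNIV" using f card_subset_eq[of UNIV "dom f"] by simp
      have "comb f l = y" using l by (simp add: hits_def solution_def y_def vec_eq_iff)
      then have "y \<in> convex hull (pts f)" using comb_hull[of l f] l by (auto simp: hits_def solution_def)
      then show "dom f = UNIV \<and> y \<in> convex hull (range (\<lambda>c. p c (the (f c))))"
        using dom by (simp add: pts_def)
    qed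
    then show ?thesis using sel[of y] by (simp add: s_def)
  next
    case False
    define Q where "Q = {x :: real ^ 'd. \<forall>v. g v (b v) \<le> x $ v \<and> x $ v \<le> g v (Suc (b v))}"
    have "\<forall>x\<in>Q. \<forall>y\<in>Q. dist x y < e"
    proof (intro ballI)
      fix x y assume xy: "x \<in> Q" "y \<in> Q"
      have "dist x y \<le> (\<Sum>v\<in>UNIV. \<bar>(x - y) $ v\<bar>)" unfolding dist_norm by (rule norm_le_l1_cart)
      also have "\<dots> \<le> (\<Sum>v\<in>(UNIV :: 'd set). 2 * h)"
      proof (rule sum_mono)
        fix v
        have "g v (b v) \<le> x $ v" "x $ v \<le> g v (Suc (b v))" "g v (b v) \<le> y $ v" "y $ v \<le> g v (Suc (b v))"
          using xy by (auto simp: Q_def)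
        then show "\<bar>(x - y) $ v\<bar> \<le> 2 * h" using step(2)[of v "b v"] by simp
      qed
      also have "\<dots> = 2 * d * h" by (simp add: d_def)
      also have "\<dots> < e" using e(1) d by (simp add: h_def)
      finally show "dist x y < e" .
    qed
    from e(2)[OF this] obtain z where z: "\<forall>f\<in>faces. convex hull (pts f) \<inter> Q \<noteq> {} \<longrightarrow> z \<in> convex hull (pts f)"
      by (elim exE) (rule that)
    have "size_of (F b I) \<le> density (\<lambda>f. \<exists>T\<in>UNIV - {UNIV}. dom f = T \<and> (\<exists>l. sum l (dom f) = 1 \<and> comb f l = z))"
      unfolding size_of_eq_density
    proof (rule density_mono)
      fix f assume ff: "f \<in> faces" and "F b I f \<noteq> 0"
      then obtain l where f: "card (dom f) + card I = CARD('c)" and l: "hits b I f l"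
        by (auto simp: F_def)
      have dom: "dom f \<noteq> UNIV" using f False by auto
      have "comb f l \<in> Q"
        unfolding Q_def mem_Collect_eq
      proof
        fix v
        show "g v (b v) \<le> comb f l $ v \<and> comb f l $ v \<le> g v (Suc (b v))"
          using l step(1)[of v "b v"] by (cases "v \<in> I") (auto simp: hits_def solution_def)
      qed
      moreover have "comb f l \<in> convex hull (pts f)" using comb_hull[of l f] l by (auto simp: hits_def solution_def)
      ultimately have "z \<in> convex hull (pts f)" using z ff by blast
      then have "\<exists>l. sum l (dom f) = 1 \<and> comb f l = z" by (rule hull_comb)
      then show "\<exists>T\<in>UNIV - {UNIV}. dom f = T \<and> (\<exists>l. sum l (dom f) = 1 \<and> comb f l = z)" using dom by blast
    qed
    also have "\<dots> \<le> (\<Sum>T\<in>UNIV - {UNIV}. density (\<lambda>f. dom f = T \<and> (\<exists>l. sum l (dom f) = 1 \<and> comb f l = z)))"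
      by (rule density_Bex) simp
    also have "\<dots> \<le> (\<Sum>T\<in>(UNIV :: 'c set set) - {UNIV}. d * \<eta>)"
    proof (rule sum_mono)
      fix T :: "'c set" assume "T \<in> UNIV - {UNIV}"
      then have "card T < CARD('c)" by (intro psubset_card_mono) auto
      then have cT: "card T \<le> CARD('d)" using card_c by simp
      have "density (\<lambda>f. dom f = T \<and> (\<exists>l. sum l (dom f) = 1 \<and> comb f l = z)) \<le> real (card T) * \<eta>"
        by (rule density_affine_combination[OF hyp cT])
      also have "\<dots> \<le> d * \<eta>" using cT \<eta> by (intro mult_right_mono) (simp_all add: d_def)
      finally show "density (\<lambda>f. dom f = T \<and> (\<exists>l. sum l (dom f) = 1 \<and> comb f l = z)) \<le> d * \<eta>" .
    qed
    also have "\<dots> = real (card ((UNIV :: 'c set set) - {UNIV})) * (d * \<eta>)" by simp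
    also have "\<dots> \<le> 2 ^ CARD('c) * (d * \<eta>)"
    proof (intro mult_right_mono)
      have "card ((UNIV :: 'c set set) - {UNIV}) \<le> card (Pow (UNIV :: 'c set))" by (intro card_mono) auto
      then show "real (card ((UNIV :: 'c set set) - {UNIV})) \<le> 2 ^ CARD('c)"
        unfolding card_Pow[OF finite] by (metis of_nat_le_iff of_nat_numeral of_nat_power)
    qed (use d \<eta> in simp)
    finally show ?thesis by (simp add: s_def mult.assoc)
  qed
  interpret cubical_crossing W F N s
    using card_c F_homogeneous F_boundary F_outer size F_vertex by unfold_locales auto
  show ?thesis using crossing_size_bound unfolding ratio_def s_def d_def card_c by simp
qed

section \<open>Loose tuples through a common point\<close>

text \<open>The ray from \<open>x\<close> through \<open>y\<close> leaves the simplex through a point of some facet.\<close>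

lemma mem_convex_hull_facet:
  fixes p :: "'d::finite option \<Rightarrow> real ^ 'd"
  assumes x: "\<And>c. x \<in> C c" and C: "\<And>c. convex (C c)" and p: "\<And>c c'. c' \<noteq> c \<Longrightarrow> p c' \<in> C c"
    and y: "y \<in> convex hull (range p)"
  shows "\<exists>c. y \<in> C c"
proof -
  obtain l where l: "\<And>c. l c \<ge> 0" "sum l UNIV = 1" "y = (\<Sum>c\<in>UNIV. l c *\<^sub>R p c)"
    using subsetD[OF convex_hull_image_indexed[of UNIV p] y] by auto
  \<comment> \<open>One unknown for each vertex and one for \<open>x - y\<close>, against
    \<open>CARD('d)\<close> coordinates and the condition that the vertex coefficients sum to 0: a
    nonzero solution exists.\<close>
  define M where "M k e = (case (k, e) of (Some c, None) \<Rightarrow> 1 | (Some c, Some v) \<Rightarrow> p c $ v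
      | (None, None) \<Rightarrow> 0 | (None, Some v) \<Rightarrow> (x - y) $ v)" for k e
  have "card (UNIV :: 'd option set) < card (UNIV :: 'd option option set)" by (simp add: card_UNIV_option)
  from homogeneous_system_solution[OF _ _ this, of M]
  obtain n where n: "\<exists>k. n k \<noteq> 0" "\<And>e. (\<Sum>k\<in>UNIV. n k * M k e) = 0" by auto
  \<comment> \<open>Fixes the sign so that \<open>\<tau> \<ge> 0\<close>, that is, the motion from
    \<open>y\<close> points away from \<open>x\<close>.\<close>
  define r where "r = (if n None \<ge> 0 then 1 else - 1 :: real)"
  define m where "m c = r * n (Some c)" for c
  define \<tau> where "\<tau> = r * n None"
  have \<tau>: "\<tau> \<ge> 0" by (simp add: \<tau>_def r_def)
  have split: "(\<Sum>k\<in>UNIV. h k) = h None + (\<Sum>c\<in>UNIV. h (Some c))" for h :: "'d option option \<Rightarrow> real"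
    by (subst UNIV_option_conv) (simp add: sum.reindex)
  have m0: "sum m UNIV = 0"
    using n(2)[of None] unfolding split by (simp add: M_def m_def sum_distrib_left[symmetric])
  have mv: "(\<Sum>c\<in>UNIV. m c *\<^sub>R p c) = \<tau> *\<^sub>R (y - x)"
  proof (rule vec_eq_iff[THEN iffD2], rule allI)
    fix v
    have "n None * (x - y) $ v + (\<Sum>c\<in>UNIV. n (Some c) * p c $ v) = 0"
      using n(2)[of "Some v"] unfolding split by (simp add: M_def)
    then have "(\<Sum>c\<in>UNIV. n (Some c) * p c $ v) = n None * (y - x) $ v" by (simp add: algebra_simps)
    then show "(\<Sum>c\<in>UNIV. m c *\<^sub>R p c) $ v = (\<tau> *\<^sub>R (y - x)) $ v"
      by (simp add: m_def \<tau>_def mult.assoc sum_distrib_left[symmetric])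
  qed
  show ?thesis
  proof (cases "\<exists>c. m c \<noteq> 0")
    case False
    then have "n None \<noteq> 0" using n(1) by (metis m_def mult_eq_0_iff not_None_eq r_def zero_neq_neg_one zero_neq_one)
    moreover have "\<tau> *\<^sub>R (y - x) = 0" using mv False by simp
    ultimately have "y = x" by (simp add: \<tau>_def r_def split: if_splits)
    then show ?thesis using x by blast
  next
    case True
    have "\<exists>c. m c < 0"
    proof (rule ccontr)
      assume "\<not> ?thesis"
      then have "\<forall>c. m c \<ge> 0" by (simp add: not_less)
      then have "m c = 0" for c using m0 sum_nonneg_eq_0_iff[of UNIV m] by simp
      then show False using True by blast
    qed
    then have ne: "{c. m c < 0} \<noteq> {}" by blast
    \<comment> \<open>The first parameter at which a coefficient reaches 0, where the ray leaves the
      simplex opposite a vertex. If \<open>\<tau> = 0\<close>, the vertices are affinely dependent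
      and only the coefficients move.\<close>
    define t where "t = Min ((\<lambda>c. l c / - m c) ` {c. m c < 0})"
    have "t \<in> (\<lambda>c. l c / - m c) ` {c. m c < 0}" unfolding t_def using ne by (intro Min_in) auto
    then obtain c where c: "m c < 0" "t = l c / - m c" by auto
    have t: "t \<ge> 0" unfolding c(2) using c(1) l(1)[of c] by (intro divide_nonneg_pos) auto
    define l' where "l' c = l c + t * m c" for c
    have l'c: "l' c = 0" using c by (simp add: l'_def)
    have l': "l' e \<ge> 0" for e
    proof (cases "m e < 0")
      case True
      then have "t \<le> l e / - m e" unfolding t_def by (intro Min_le) auto
      then have "t * - m e \<le> l e" using pos_le_divide_eq[of "- m e" t "l e"] True by linarith
      then show ?thesis by (simp add: l'_def)
    next
      case False
      then show ?thesis using t l(1)[of e] by (simp add: l'_def)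
    qed
    have sum1: "sum l' UNIV = 1" using l(2) m0 by (simp add: l'_def sum.distrib sum_distrib_left[symmetric])
    have z: "(\<Sum>e\<in>UNIV. l' e *\<^sub>R p e) = y + (t * \<tau>) *\<^sub>R (y - x)"
    proof -
      have "(\<Sum>e\<in>UNIV. l' e *\<^sub>R p e) = y + t *\<^sub>R (\<Sum>c\<in>UNIV. m c *\<^sub>R p c)"
        by (simp add: l'_def l(3) scaleR_left_distrib sum.distrib scaleR_sum_right)
      then show ?thesis by (simp add: mv)
    qed
    have "(\<Sum>e\<in>UNIV - {c}. l' e *\<^sub>R p e) \<in> C c"
      using sum1 l'c l' p C[of c] by (intro convex_sum) (auto simp: sum_diff1)
    then have zC: "y + (t * \<tau>) *\<^sub>R (y - x) \<in> C c" using z l'c by (simp add: sum_diff1)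
    \<comment> \<open>\<open>y\<close> lies between \<open>x\<close> and the exit point, both in
      \<open>C c\<close>; \<open>u\<close> is the weight of the exit point.\<close>
    define u where "u = 1 / (1 + t * \<tau>)"
    have tt: "t * \<tau> \<ge> 0" using t \<tau> by simp
    have u: "0 \<le> u" "u \<le> 1" "u * (1 + t * \<tau>) = 1" using tt by (simp_all add: u_def)
    have "u *\<^sub>R (y + (t * \<tau>) *\<^sub>R (y - x)) + (1 - u) *\<^sub>R x \<in> C c"
      using convexD[OF C zC x, of u "1 - u"] u by simp
    moreover have "u *\<^sub>R (y + (t * \<tau>) *\<^sub>R (y - x)) + (1 - u) *\<^sub>R x = y"
    proof (rule vec_eq_iff[THEN iffD2], rule allI)
      fix v
      have "u * (y $ v + t * \<tau> * (y $ v - x $ v)) + (1 - u) * x $ v = (u * (1 + t * \<tau>)) * (y $ v - x $ v) + x $ v"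
        by (simp add: algebra_simps)
      then show "(u *\<^sub>R (y + (t * \<tau>) *\<^sub>R (y - x)) + (1 - u) *\<^sub>R x) $ v = y $ v" using u(3) by simp
    qed
    ultimately show ?thesis by auto
  qed
qed

text \<open>The orientation of \<open>y\<close> and the points \<open>x i\<close>; it vanishes iff
  these \<open>CARD('d) + 1\<close> points are affinely dependent.\<close>

definition row_det :: "real ^ 'd \<Rightarrow> ('d::finite \<Rightarrow> real ^ 'd) \<Rightarrow> real" where
  "row_det y x = det (\<chi> i. x i - y)"

lemma row_det_eq_0_iff:
  "row_det y x = 0 \<longleftrightarrow> (\<exists>c. (\<exists>i. c i \<noteq> 0) \<and> (\<Sum>i\<in>UNIV. c i *\<^sub>R (x i - y)) = 0)"
proof -
  have "row i (\<chi> i. x i - y) = x i - y" for i by (simp add: row_def vec_eq_iff)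
  then show ?thesis
    unfolding row_det_def using invertible_det_nz[of "\<chi> i. x i - y"] invertible_right_inverse[of "\<chi> i. x i - y"]
      matrix_right_invertible_independent_rows[of "\<chi> i. x i - y"]
    by (auto simp: scalar_mult_eq_scaleR)
qed

text \<open>Multilinearity of the determinant; \<open>sum l S = 1\<close> lets the shift by
  \<open>y\<close> be distributed over the terms.\<close>

lemma row_det_convex_combination:
  assumes "finite S" "sum l S = 1"
  shows "row_det y (x(t := \<Sum>u\<in>S. l u *\<^sub>R a u)) = (\<Sum>u\<in>S. l u * row_det y (x(t := a u)))"
proof -
  have e: "(\<Sum>u\<in>S. l u *\<^sub>R a u) - y = (\<Sum>u\<in>S. l u *s (a u - y))"
    using assms(2) by (simp add: scalar_mult_eq_scaleR scaleR_diff_right sum_subtractf scaleR_sum_left[symmetric])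
  have upd: "(\<chi> i. (x(t := z)) i - y) = (\<chi> i. if i = t then z - y else x i - y)" for z
    by (simp add: vec_eq_iff)
  show ?thesis unfolding row_det_def upd e det_linear_row_sum[OF assms(1)] det_row_mul ..
qed

text \<open>The determinant has constant nonzero sign, first on vertices and then, by multilinearity, on the whole product.\<close>

lemma not_mem_convex_hull_transversal:
  fixes K :: "'d::finite \<Rightarrow> 'w::finite \<Rightarrow> real ^ 'd"
  assumes sep: "\<And>t v. \<exists>H. hyperplane H \<and> y \<in> H \<and> (\<forall>j. j \<noteq> t \<longrightarrow> K j (v j) \<in> H) \<and> H \<inter> convex hull (range (K t)) = {}"
    and x: "\<And>t. x t \<in> convex hull (range (K t))" and w: "sum w UNIV = 1"
  shows "(\<Sum>t\<in>UNIV. w t *\<^sub>R x t) \<noteq> y"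
proof -
  have nz: "row_det y ((\<lambda>j. K j (v j))(t := z)) \<noteq> 0" if z: "z \<in> convex hull (range (K t))" for v t z
  proof
    define xs where "xs = (\<lambda>j. K j (v j))(t := z)"
    assume "row_det y ((\<lambda>j. K j (v j))(t := z)) = 0"
    then obtain c where c: "\<exists>i. c i \<noteq> 0" "(\<Sum>i\<in>UNIV. c i *\<^sub>R (xs i - y)) = 0"
      unfolding xs_def[symmetric] row_det_eq_0_iff by blast
    obtain j where j: "c j \<noteq> 0" "j = t \<or> c t = 0" using c(1) by metis
    obtain H where H: "hyperplane H" "y \<in> H" "\<forall>i. i \<noteq> j \<longrightarrow> K i (v i) \<in> H" "H \<inter> convex hull (range (K j)) = {}"
      using sep[of j v] by blast
    obtain a b where ab: "H = {x. a \<bullet> x = b}" using H(1) unfolding hyperplane_def by blast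
    have "0 = a \<bullet> (\<Sum>i\<in>UNIV. c i *\<^sub>R (xs i - y))" using c(2) by simp
    also have "\<dots> = (\<Sum>i\<in>UNIV. c i * (a \<bullet> (xs i - y)))" by (simp add: inner_sum_right)
    also have "\<dots> = (\<Sum>i\<in>UNIV. if i = j then c j * (a \<bullet> (xs j - y)) else 0)"
    proof (intro sum.cong refl)
      fix i
      show "c i * (a \<bullet> (xs i - y)) = (if i = j then c j * (a \<bullet> (xs j - y)) else 0)"
      proof (cases "i = j \<or> c i = 0")
        case False
        then have "i \<noteq> t" using j(2) by blast
        then have "xs i \<in> H" using H(3) False by (simp add: xs_def)
        then show ?thesis using False H(2) ab by (simp add: inner_diff_right)
      qed auto
    qed
    also have "\<dots> = c j * (a \<bullet> (xs j - y))" by simp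
    finally have "xs j \<in> H" using j(1) H(2) ab by (simp add: inner_diff_right)
    moreover have "xs j \<in> convex hull (range (K j))" using z by (auto simp: xs_def intro: hull_inc)
    ultimately show False using H(4) by blast
  qed
  have same: "row_det y (\<lambda>j. K j (v j)) * row_det y ((\<lambda>j. K j (v j))(t := K t u)) > 0" for v t u
  proof (rule ccontr)
    \<comment> \<open>\<open>\<phi>\<close> is affine, so opposite signs at two vertices would give
      a zero on the segment between them; \<open>s\<close> below is the interpolation
      weight.\<close>
    define \<phi> where "\<phi> z = row_det y ((\<lambda>j. K j (v j))(t := z))" for z
    assume "\<not> ?thesis"
    moreover have "(\<lambda>j. K j (v j)) = (\<lambda>j. K j (v j))(t := K t (v t))" by auto
    ultimately have neg: "\<phi> (K t (v t)) * \<phi> (K t u) \<le> 0" unfolding \<phi>_def by (metis not_less)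
    have ph: "\<phi> z \<noteq> 0" if "z \<in> convex hull (range (K t))" for z unfolding \<phi>_def by (rule nz[OF that])
    define A B where "A = \<phi> (K t (v t))" and "B = \<phi> (K t u)"
    have AB: "A * B < 0" "A \<noteq> 0" "B \<noteq> 0" using neg ph[of "K t (v t)"] ph[of "K t u"]
      by (auto simp: A_def B_def hull_inc order_less_le)
    then have AB': "A > 0 \<and> B < 0 \<or> A < 0 \<and> B > 0" by (auto simp: mult_less_0_iff)
    define s where "s = B / (B - A)"
    have s: "0 \<le> s" "s \<le> 1" "s * A + (1 - s) * B = 0"
      using AB' by (auto simp: s_def field_simps)
    have "\<phi> (\<Sum>i\<in>UNIV. (if i then s else 1 - s) *\<^sub>R (if i then K t (v t) else K t u))
        = (\<Sum>i\<in>UNIV. (if i then s else 1 - s) * \<phi> (if i then K t (v t) else K t u))"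
      unfolding \<phi>_def by (rule row_det_convex_combination) (simp_all add: UNIV_bool)
    then have "\<phi> (s *\<^sub>R K t (v t) + (1 - s) *\<^sub>R K t u) = 0" using s(3) by (simp add: UNIV_bool A_def B_def add.commute)
    moreover have "s *\<^sub>R K t (v t) + (1 - s) *\<^sub>R K t u \<in> convex hull (range (K t))"
      using convexD[OF convex_convex_hull, of "K t (v t)" "range (K t)" "K t u" s "1 - s"] s(1,2) by (simp add: hull_inc)
    ultimately show False using ph by blast
  qed
  fix v0 :: "'d \<Rightarrow> 'w"
  define s where "s = sgn (row_det y (\<lambda>j. K j (v0 j)))"
  have pos: "s * row_det y (\<lambda>j. K j (v j)) > 0" if "finite S" "\<forall>j. j \<notin> S \<longrightarrow> v j = v0 j" for v S
    using that
  proof (induction S arbitrary: v rule: finite_induct)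
    case empty
    then have "v = v0" by blast
    moreover have "row_det y (\<lambda>j. K j (v0 j)) \<noteq> 0" using same[of v0] by (metis mult_zero_left order_less_irrefl)
    ultimately show ?case by (simp add: s_def sgn_if)
  next
    case (insert t S)
    define v' where "v' = v(t := v0 t)"
    have 1: "s * row_det y (\<lambda>j. K j (v' j)) > 0" using insert.prems by (intro insert.IH) (auto simp: v'_def)
    have "(\<lambda>j. K j (v j)) = (\<lambda>j. K j (v' j))(t := K t (v t))" by (auto simp: v'_def)
    then have "row_det y (\<lambda>j. K j (v' j)) * row_det y (\<lambda>j. K j (v j)) > 0" using same[of v' t "v t"] by simp
    then show ?case using 1 by (auto simp: zero_less_mult_iff)
  qed
  have "s * row_det y x' > 0"
    if "finite S" "\<forall>t. x' t \<in> convex hull (range (K t))" "\<forall>t. t \<notin> S \<longrightarrow> x' t \<in> range (K t)" for x' S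
    using that
  proof (induction S arbitrary: x' rule: finite_induct)
    case empty
    then have "\<forall>t. \<exists>u. x' t = K t u" by blast
    then have "\<exists>v. \<forall>t. x' t = K t (v t)" by (rule choice)
    then obtain v where "x' = (\<lambda>t. K t (v t))" by blast
    then show ?case using pos[of UNIV v] by simp
  next
    case (insert t S)
    obtain l where l: "\<And>u. l u \<ge> 0" "sum l UNIV = 1" "x' t = (\<Sum>u\<in>UNIV. l u *\<^sub>R K t u)"
      using subsetD[OF convex_hull_image_indexed[of UNIV "K t"] insert.prems(1)[THEN spec, of t]] by auto
    have p: "s * row_det y (x'(t := K t u)) > 0" for u
      using insert.prems by (intro insert.IH) (auto simp: hull_inc)
    have "x' = x'(t := \<Sum>u\<in>UNIV. l u *\<^sub>R K t u)" using l(3) by auto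
    then have "row_det y x' = (\<Sum>u\<in>UNIV. l u * row_det y (x'(t := K t u)))"
      using row_det_convex_combination[of UNIV l y x' t "K t"] l(2) by simp
    then have e: "s * row_det y x' = (\<Sum>u\<in>UNIV. l u * (s * row_det y (x'(t := K t u))))"
      by (simp add: sum_distrib_left mult.left_commute)
    obtain u where u: "l u > 0" using l(1,2) by (metis less_eq_real_def sum.neutral zero_neq_one)
    have "(\<Sum>u\<in>UNIV. l u * (s * row_det y (x'(t := K t u)))) > 0"
      using u l(1) p by (intro sum_pos2[of _ u]) (auto intro: mult_nonneg_nonneg mult_pos_pos less_imp_le)
    then show ?case using e by simp
  qed
  from this[of UNIV x] have "row_det y x \<noteq> 0" using x by auto
  then have no: "\<And>c i. (\<Sum>i\<in>UNIV. c i *\<^sub>R (x i - y)) = 0 \<Longrightarrow> c i = 0" unfolding row_det_eq_0_iff by blast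
  show ?thesis
  proof
    assume "(\<Sum>t\<in>UNIV. w t *\<^sub>R x t) = y"
    then have "(\<Sum>t\<in>UNIV. w t *\<^sub>R (x t - y)) = 0"
      using w by (simp add: scaleR_diff_right sum_subtractf scaleR_sum_left[symmetric])
    then have "w t = 0" for t by (rule no)
    then show False using w by simp
  qed
qed

context partite_complex
begin

lemma density_total:
  "density (\<lambda>f. dom f = UNIV \<and> P (\<lambda>c. the (f c))) = real (card {f. (\<forall>c. f c \<in> W c) \<and> P f}) / (\<Prod>c\<in>UNIV. real (card (W c)))"
proof -
  have "density (\<lambda>f. dom f = UNIV \<and> P (\<lambda>c. the (f c))) = (\<Sum>f\<in>{f\<in>faces. dom f = UNIV \<and> P (\<lambda>c. the (f c))}. 1 / (\<Prod>c\<in>UNIV. real (card (W c))))"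
    unfolding density_def by (intro sum.cong refl) (simp add: weight_def prod_dividef)
  also have "\<dots> = real (card {f\<in>faces. dom f = UNIV \<and> P (\<lambda>c. the (f c))}) / (\<Prod>c\<in>UNIV. real (card (W c)))"
    by simp
  also have "card {f\<in>faces. dom f = UNIV \<and> P (\<lambda>c. the (f c))} = card {f. (\<forall>c. f c \<in> W c) \<and> P f}"
  proof (rule bij_betw_same_card[OF bij_betw_byWitness[where f = "\<lambda>f c. the (f c)" and f' = "\<lambda>f c. Some (f c)"]])
    show "\<forall>f\<in>{f\<in>faces. dom f = UNIV \<and> P (\<lambda>c. the (f c))}. (\<lambda>c. Some (the (f c))) = f"
    proof (intro ballI ext)
      fix f c assume "f \<in> {f\<in>faces. dom f = UNIV \<and> P (\<lambda>c. the (f c))}"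
      then have "c \<in> dom f" by simp
      then show "Some (the (f c)) = f c" by auto
    qed
  qed (auto simp: faces_def)
  finally show ?thesis .
qed

end

lemma exists_skip_enumeration: "\<exists>\<sigma> :: 'd::finite \<Rightarrow> 'd option. bij_betw \<sigma> UNIV (UNIV - {c})"
  by (rule finite_same_card_bij) (simp_all add: card_UNIV_option card_Diff_singleton)

section \<open>Tuples of simplices when hyperplanes cross few of them\<close>

locale simplex_tuples = partite_complex W for W :: "'d::finite option \<Rightarrow> 'i set" +
  fixes vtx :: "'i \<Rightarrow> 'd option \<Rightarrow> real ^ 'd" and \<eta> :: real
  assumes crossing: "hyperplane H \<Longrightarrow> real (card {i\<in>W c. H \<inter> convex hull (range (vtx i)) \<noteq> {}}) \<le> \<eta> * real (card (W c))"
begin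

text \<open>If \<open>y\<close> lies in the hull of the \<open>CARD('d)\<close> simplices other than
  \<open>c\<close>, the conclusion of \<open>not_mem_convex_hull_transversal\<close> fails. So for
  some \<open>t\<close> and some choice \<open>v\<close> of vertices, the hyperplane chosen through
  \<open>y\<close> and the vertices of all but the \<open>t\<close>-th simplex meets the
  \<open>t\<close>-th one. The factor counts the pairs \<open>(t, v)\<close>.\<close>

lemma density_facet_hull:
  "density (\<lambda>f. dom f = UNIV \<and> y \<in> convex hull (\<Union>c'\<in>UNIV - {c}. range (vtx (the (f c'))))) \<le> real CARD('d \<times> ('d \<Rightarrow> 'd option)) * \<eta>"
proof -
  obtain \<sigma> :: "'d \<Rightarrow> 'd option" where \<sigma>: "bij_betw \<sigma> UNIV (UNIV - {c})" using exists_skip_enumeration by blast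
  have inj: "\<sigma> i = \<sigma> j \<longleftrightarrow> i = j" for i j using \<sigma> by (auto simp: bij_betw_def inj_eq)
  define pts where "pts t v f = insert y ((\<lambda>j. vtx (the (f (\<sigma> j))) (v j)) ` (UNIV - {t}))" for t v and f :: "'d option \<Rightarrow> 'i option"
  define H where "H t v f = (SOME H. hyperplane H \<and> pts t v f \<subseteq> H)" for t v f
  have H: "hyperplane (H t v f) \<and> pts t v f \<subseteq> H t v f" for t v f
    unfolding H_def
  proof (rule someI_ex, rule exists_hyperplane_superset)
    have "card (pts t v f) \<le> Suc (card ((\<lambda>j. vtx (the (f (\<sigma> j))) (v j)) ` (UNIV - {t})))"
      by (simp add: pts_def card_insert_if)
    also have "\<dots> \<le> Suc (card (UNIV - {t}))" by (intro Suc_le_mono[THEN iffD2] card_image_le) simp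
    also have "\<dots> = CARD('d)" by (simp add: card_Diff_singleton)
    finally show "card (pts t v f) \<le> CARD('d)" .
  qed (simp add: pts_def)
  define B where "B q f i \<longleftrightarrow> H (fst q) (snd q) f \<inter> convex hull (range (vtx i)) \<noteq> {}" for q f i
  have "density (\<lambda>f. dom f = UNIV \<and> y \<in> convex hull (\<Union>c'\<in>UNIV - {c}. range (vtx (the (f c')))))
    \<le> density (\<lambda>f. \<exists>q\<in>UNIV. dom f = UNIV \<and> B q (f(\<sigma> (fst q) := None)) (the (f (\<sigma> (fst q)))))"
  proof (rule density_mono, rule ccontr)
    fix f :: "'d option \<Rightarrow> 'i option"
    assume f: "dom f = UNIV \<and> y \<in> convex hull (\<Union>c'\<in>UNIV - {c}. range (vtx (the (f c'))))"
      and no: "\<not> (\<exists>q\<in>UNIV. dom f = UNIV \<and> B q (f(\<sigma> (fst q) := None)) (the (f (\<sigma> (fst q)))))"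
    define K where "K j = vtx (the (f (\<sigma> j)))" for j
    have "\<exists>H. hyperplane H \<and> y \<in> H \<and> (\<forall>j. j \<noteq> t \<longrightarrow> K j (v j) \<in> H) \<and> H \<inter> convex hull (range (K t)) = {}" for t v
    proof (intro exI conjI allI impI)
      let ?H = "H t v (f(\<sigma> t := None))"
      show "hyperplane ?H" using H by blast
      show "y \<in> ?H" using H[of t v "f(\<sigma> t := None)"] by (simp add: pts_def)
      show "K j (v j) \<in> ?H" if "j \<noteq> t" for j
      proof -
        have "K j (v j) = vtx (the ((f(\<sigma> t := None)) (\<sigma> j))) (v j)" using that inj[of j t] by (simp add: K_def)
        also have "\<dots> \<in> pts t v (f(\<sigma> t := None))" unfolding pts_def using that by blast
        finally show ?thesis using H[of t v "f(\<sigma> t := None)"] by blast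
      qed
      show "?H \<inter> convex hull (range (K t)) = {}" using no f by (auto simp: B_def K_def)
    qed
    note sep = this
    have "(\<Union>c'\<in>UNIV - {c}. range (vtx (the (f c')))) \<subseteq> \<Union>((\<lambda>j. convex hull (range (K j))) ` UNIV)"
    proof (intro UN_least)
      fix c' assume "c' \<in> UNIV - {c}"
      then obtain j where "c' = \<sigma> j" using \<sigma> by (auto simp: bij_betw_def)
      then show "range (vtx (the (f c'))) \<subseteq> \<Union>((\<lambda>j. convex hull (range (K j))) ` UNIV)"
        using hull_subset[of "range (K j)" convex] by (auto simp: K_def)
    qed
    then have "y \<in> convex hull (\<Union>((\<lambda>j. convex hull (range (K j))) ` UNIV))" using f hull_mono by blast
    then obtain w x where wx: "sum w UNIV = 1" "\<forall>j. x j \<in> convex hull (range (K j))" "y = (\<Sum>j\<in>UNIV. w j *\<^sub>R x j)"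
      by (subst (asm) convex_hull_finite_union) auto
    show False using not_mem_convex_hull_transversal[OF sep wx(2)[THEN spec] wx(1)] wx(3) by simp
  qed
  also have "\<dots> \<le> (\<Sum>q\<in>UNIV. density (\<lambda>f. dom f = UNIV \<and> B q (f(\<sigma> (fst q) := None)) (the (f (\<sigma> (fst q))))))"
    by (rule density_Bex) simp
  also have "\<dots> \<le> (\<Sum>q\<in>(UNIV :: ('d \<times> ('d \<Rightarrow> 'd option)) set). \<eta>)"
  proof (intro sum_mono density_transversal UNIV_I)
    show "real (card {v \<in> W (\<sigma> (fst q)). B q f v}) \<le> \<eta> * real (card (W (\<sigma> (fst q))))" for q f
      unfolding B_def using H by (intro crossing) blast
  qed
  finally show ?thesis by simp
qed

lemma density_loose_through_point:
  "density (\<lambda>f. dom f = UNIV \<and> hull_loose (\<lambda>c. vtx (the (f c))) \<and> y \<in> convex hull (range (\<lambda>c. vtx (the (f c)) None)))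
    \<le> real CARD('d option) * (real CARD('d \<times> ('d \<Rightarrow> 'd option)) * \<eta>)"
proof -
  have "density (\<lambda>f. dom f = UNIV \<and> hull_loose (\<lambda>c. vtx (the (f c))) \<and> y \<in> convex hull (range (\<lambda>c. vtx (the (f c)) None)))
    \<le> density (\<lambda>f. \<exists>c\<in>UNIV. dom f = UNIV \<and> y \<in> convex hull (\<Union>c'\<in>UNIV - {c}. range (vtx (the (f c')))))"
  proof (rule density_mono)
    fix f :: "'d option \<Rightarrow> 'i option"
    assume f: "dom f = UNIV \<and> hull_loose (\<lambda>c. vtx (the (f c))) \<and> y \<in> convex hull (range (\<lambda>c. vtx (the (f c)) None))"
    then obtain x where "\<And>c. x \<in> convex hull (\<Union>c'\<in>UNIV - {c}. range (vtx (the (f c'))))"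
      unfolding hull_loose_def by blast
    then have "\<exists>c. y \<in> convex hull (\<Union>c'\<in>UNIV - {c}. range (vtx (the (f c'))))"
      by (rule mem_convex_hull_facet[where p = "\<lambda>c. vtx (the (f c)) None"]) (use f in \<open>auto intro: hull_inc\<close>)
    then show "\<exists>c\<in>UNIV. dom f = UNIV \<and> y \<in> convex hull (\<Union>c'\<in>UNIV - {c}. range (vtx (the (f c'))))"
      using f by blast
  qed
  also have "\<dots> \<le> (\<Sum>c\<in>UNIV. density (\<lambda>f. dom f = UNIV \<and> y \<in> convex hull (\<Union>c'\<in>UNIV - {c}. range (vtx (the (f c'))))))"
    by (rule density_Bex) simp
  also have "\<dots> \<le> (\<Sum>c\<in>(UNIV :: 'd option set). real CARD('d \<times> ('d \<Rightarrow> 'd option)) * \<eta>)"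
    by (intro sum_mono density_facet_hull)
  finally show ?thesis by simp
qed

end

lemma exists_tight_density:
  "\<exists>\<eta>>0. \<exists>\<kappa>>0. \<forall>(W :: 'd::finite option \<Rightarrow> 'i set) (vtx :: 'i \<Rightarrow> 'd option \<Rightarrow> real ^ 'd).
    simplex_tuples W vtx \<eta> \<longrightarrow>
    \<kappa> * (\<Prod>c\<in>UNIV. real (card (W c))) \<le> real (card {f. (\<forall>c. f c \<in> W c) \<and> \<not> hull_loose (\<lambda>c. vtx (f c))})"
proof -
  let ?c = "CARD('d option)"
  define L where "L = (2 ^ ?c * (2 * real ?c + 1)) ^ ?c"
  define A where "A = 2 ^ ?c * real CARD('d)"
  define M where "M = real ?c * real CARD('d \<times> ('d \<Rightarrow> 'd option))"
  have L: "L > 0" by (simp add: L_def)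
  have AM: "A \<ge> 0" "M \<ge> 0" by (simp_all add: A_def M_def)
  \<comment> \<open>\<open>L * (2 * \<kappa>) = 1 / 2\<close> contradicts selection, so some
    \<open>y\<close> is hit with density above \<open>2 * \<kappa>\<close>. \<open>\<eta>\<close>
    keeps both the crossing term in the maximum and the density of loose tuples through
    \<open>y\<close> at most \<open>\<kappa>\<close>.\<close>
  define \<eta> where "\<eta> = 1 / (4 * L * (A + M + 1))"
  define \<kappa> where "\<kappa> = 1 / (4 * L)"
  have \<eta>: "\<eta> > 0" using L AM by (simp add: \<eta>_def)
  have \<kappa>: "\<kappa> > 0" using L by (simp add: \<kappa>_def)
  have \<eta>\<kappa>: "\<eta> = \<kappa> / (A + M + 1)" by (simp add: \<eta>_def \<kappa>_def)
  have sm: "A * \<eta> \<le> \<kappa>" "M * \<eta> \<le> \<kappa>"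
    using \<kappa> AM unfolding \<eta>\<kappa> by (simp_all add: field_simps)
  have "\<kappa> * (\<Prod>c\<in>UNIV. real (card (W c))) \<le> real (card {f. (\<forall>c. f c \<in> W c) \<and> \<not> hull_loose (\<lambda>c. vtx (f c))})"
    if "simplex_tuples W vtx \<eta>" for W :: "'d option \<Rightarrow> 'i set" and vtx :: "'i \<Rightarrow> 'd option \<Rightarrow> real ^ 'd"
  proof -
    interpret simplex_tuples W vtx \<eta> by (rule that)
    define on where "on y f \<longleftrightarrow> y \<in> convex hull (range (\<lambda>c. vtx (the (f c)) None))" for y and f :: "'d option \<Rightarrow> 'i option"
    have "\<exists>y. density (\<lambda>f. dom f = UNIV \<and> on y f) > 2 * \<kappa>"
    proof (rule ccontr)
      assume no: "\<not> ?thesis"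
      have "1 \<le> L * max (2 * \<kappa>) (A * \<eta>)"
        unfolding L_def A_def
      proof (rule colourful_selection[where p = "\<lambda>c i. vtx i None"])
        show "partite_complex W" by unfold_locales
        show "CARD('d option) = Suc CARD('d)" by (simp add: card_UNIV_option)
        show "density (\<lambda>f. dom f = UNIV \<and> y \<in> convex hull (range (\<lambda>c. vtx (the (f c)) None))) \<le> 2 * \<kappa>" for y
          using no unfolding on_def by (simp add: not_less)
        fix H :: "(real ^ 'd) set" and c assume H: "hyperplane H"
        have "card {i\<in>W c. vtx i None \<in> H} \<le> card {i\<in>W c. H \<inter> convex hull (range (vtx i)) \<noteq> {}}"
        proof (intro card_mono subsetI CollectI conjI)
          fix i assume "i \<in> {i\<in>W c. vtx i None \<in> H}"
          then show "i \<in> W c" "H \<inter> convex hull (range (vtx i)) \<noteq> {}"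
            using hull_inc[of "vtx i None" "range (vtx i)" convex] by auto
        qed (simp add: finite_W)
        then show "real (card {i\<in>W c. vtx i None \<in> H}) \<le> \<eta> * real (card (W c))"
          using crossing[OF H, of c] by linarith
      qed
      also have "max (2 * \<kappa>) (A * \<eta>) = 2 * \<kappa>" using sm \<kappa> by simp
      also have "L * (2 * \<kappa>) = 1 / 2" using L by (simp add: \<kappa>_def)
      finally show False by simp
    qed
    then obtain y where y: "density (\<lambda>f. dom f = UNIV \<and> on y f) > 2 * \<kappa>" by blast
    define lo where "lo f \<longleftrightarrow> hull_loose (\<lambda>c. vtx (the (f c)))" for f :: "'d option \<Rightarrow> 'i option"
    have "density (\<lambda>f. dom f = UNIV \<and> on y f)
        \<le> density (\<lambda>f. \<exists>b\<in>UNIV. if b then dom f = UNIV \<and> lo f \<and> on y f else dom f = UNIV \<and> \<not> lo f)"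
      by (rule density_mono) (auto simp: UNIV_bool)
    also have "\<dots> \<le> (\<Sum>b\<in>UNIV. density (\<lambda>f. if b then dom f = UNIV \<and> lo f \<and> on y f else dom f = UNIV \<and> \<not> lo f))"
      by (rule density_Bex) simp
    also have "\<dots> = density (\<lambda>f. dom f = UNIV \<and> lo f \<and> on y f) + density (\<lambda>f. dom f = UNIV \<and> \<not> lo f)"
      by (simp add: UNIV_bool)
    also have "density (\<lambda>f. dom f = UNIV \<and> lo f \<and> on y f) \<le> \<kappa>"
      using density_loose_through_point[of y] sm(2) unfolding lo_def on_def M_def by (simp add: mult.assoc)
    finally have "\<kappa> < density (\<lambda>f. dom f = UNIV \<and> \<not> lo f)" using y by simp
    also have "\<dots> = real (card {f. (\<forall>c. f c \<in> W c) \<and> \<not> hull_loose (\<lambda>c. vtx (f c))}) / (\<Prod>c\<in>UNIV. real (card (W c)))"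
      unfolding lo_def by (rule density_total)
    finally have "\<kappa> * (\<Prod>c\<in>UNIV. real (card (W c))) < real (card {f. (\<forall>c. f c \<in> W c) \<and> \<not> hull_loose (\<lambda>c. vtx (f c))})"
      using card_W_pos by (simp add: pos_less_divide_eq prod_pos)
    then show ?thesis by simp
  qed
  then show ?thesis using \<eta> \<kappa> by blast
qed

section \<open>Dense boxes\<close>

locale clustered_tuples =
  fixes V :: "'i set" and cl :: "'c::finite \<Rightarrow> 'i \<Rightarrow> 's" and E :: "('c \<Rightarrow> 'i) \<Rightarrow> bool" and \<delta> :: real
  assumes finite_V: "finite V" and V_nonempty: "V \<noteq> {}"
begin

definition tuples :: "('c \<Rightarrow> 'i) set" where
  "tuples = {f. \<forall>c. f c \<in> V}"

definition cell :: "'c \<Rightarrow> 'i \<Rightarrow> 'i set" where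
  "cell c i = {j\<in>V. cl c j = cl c i}"

definition box :: "'c set \<Rightarrow> ('c \<Rightarrow> 'i) \<Rightarrow> ('c \<Rightarrow> 'i) set" where
  "box S f = {g. (\<forall>c\<in>S. g c \<in> cell c (f c)) \<and> (\<forall>c. c \<notin> S \<longrightarrow> g c = f c)}"

definition differ :: "('c \<Rightarrow> 'i) \<Rightarrow> ('c \<Rightarrow> 'i) \<Rightarrow> real" where
  "differ f g = of_bool (E f \<noteq> E g)"

lemma finite_tuples: "finite tuples"
proof -
  have "tuples = UNIV \<rightarrow>\<^sub>E V" by (auto simp: tuples_def PiE_def)
  then show ?thesis using finite_V by (simp add: finite_PiE)
qed

lemma card_tuples: "card tuples = card V ^ CARD('c)"
proof -
  have "tuples = UNIV \<rightarrow>\<^sub>E V" by (auto simp: tuples_def PiE_def)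
  then show ?thesis by (simp add: card_PiE)
qed

text \<open>Exchanging \<open>f c\<close> with \<open>i\<close> is an involution on pairs of a tuple
  and an index.\<close>

lemma sum_tuples_swap:
  "(\<Sum>f\<in>tuples. \<Sum>i\<in>V. G f i) = (\<Sum>f\<in>tuples. \<Sum>i\<in>V. G (f(c := i)) (f c))"
proof -
  have "(\<Sum>q\<in>tuples \<times> V. G (fst q) (snd q)) = (\<Sum>q\<in>tuples \<times> V. G ((fst q)(c := snd q)) (fst q c))"
    by (rule sum.reindex_bij_witness[where i = "\<lambda>q. ((fst q)(c := snd q), fst q c)" and j = "\<lambda>q. ((fst q)(c := snd q), fst q c)"])
      (auto simp: tuples_def)
  then show ?thesis by (simp add: sum.cartesian_product case_prod_beta)
qed

lemma finite_cell: "finite (cell c i)"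
  using finite_V by (simp add: cell_def)

lemma card_cell_pos: "i \<in> V \<Longrightarrow> real (card (cell c i)) > 0"
  using finite_cell[of c i] by (auto simp: card_gt_0_iff cell_def)

lemma sum_cell: "(\<Sum>j\<in>cell c i. h j) = (\<Sum>j\<in>V. if cl c j = cl c i then h j else 0)"
  unfolding cell_def using finite_V by (simp add: sum.inter_filter)

text \<open>Redrawing one entry of a uniform tuple inside its cell leaves the tuple uniform; the
  swap works because lying in the same cell is symmetric.\<close>

lemma sum_resample:
  "(\<Sum>f\<in>tuples. (\<Sum>i\<in>cell c (f c). H (f(c := i))) / real (card (cell c (f c)))) = (\<Sum>f\<in>tuples. H f)"
  for H :: "('c \<Rightarrow> 'i) \<Rightarrow> real"
proof -
  have "(\<Sum>f\<in>tuples. (\<Sum>i\<in>cell c (f c). H (f(c := i))) / real (card (cell c (f c))))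
      = (\<Sum>f\<in>tuples. \<Sum>i\<in>V. if cl c i = cl c (f c) then H (f(c := i)) / real (card (cell c (f c))) else 0)"
    by (intro sum.cong refl) (simp add: sum_cell sum_divide_distrib if_distrib[of "\<lambda>x. x / _"] cong: if_cong)
  also have "\<dots> = (\<Sum>f\<in>tuples. \<Sum>i\<in>V. if cl c (f c) = cl c i then H f / real (card (cell c i)) else 0)"
    by (subst sum_tuples_swap[where c = c]) simp
  also have "\<dots> = (\<Sum>f\<in>tuples. \<Sum>i\<in>cell c (f c). H f / real (card (cell c (f c))))"
    unfolding sum_cell by (intro sum.cong refl) (auto simp: cell_def)
  also have "\<dots> = (\<Sum>f\<in>tuples. H f)"
  proof (intro sum.cong refl)
    fix f assume "f \<in> tuples"
    then have "real (card (cell c (f c))) > 0" by (intro card_cell_pos) (simp add: tuples_def)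
    then show "(\<Sum>i\<in>cell c (f c). H f / real (card (cell c (f c)))) = H f" by simp
  qed
  finally show ?thesis .
qed

lemma box_insert:
  assumes "c \<notin> S"
  shows "(\<Sum>g\<in>box (insert c S) f. h g) = (\<Sum>i\<in>cell c (f c). \<Sum>g\<in>box S (f(c := i)). h g)"
proof -
  have fin: "finite (box S (f(c := i)))" for i
  proof -
    have "box S (f(c := i)) \<subseteq> UNIV \<rightarrow>\<^sub>E (\<Union>c'. insert ((f(c := i)) c') (cell c' ((f(c := i)) c')))"
      by (fastforce simp: box_def PiE_def)
    then show ?thesis by (rule finite_subset) (intro finite_PiE, simp_all add: finite_cell)
  qed
  have "box (insert c S) f = (\<Union>i\<in>cell c (f c). box S (f(c := i)))"
  proof (intro equalityI subsetI)
    fix g assume g: "g \<in> box (insert c S) f"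
    then have "g \<in> box S (f(c := g c))" using assms by (auto simp: box_def)
    moreover have "g c \<in> cell c (f c)" using g by (simp add: box_def)
    ultimately show "g \<in> (\<Union>i\<in>cell c (f c). box S (f(c := i)))" by (rule UN_I[rotated])
  next
    fix g assume "g \<in> (\<Union>i\<in>cell c (f c). box S (f(c := i)))"
    then obtain i where i: "i \<in> cell c (f c)" "g \<in> box S (f(c := i))" by blast
    have "g c' \<in> cell c' (f c')" if "c' \<in> S" for c'
      using i(2) that assms by (cases "c' = c") (auto simp: box_def)
    moreover have "g c = i" using i(2) assms by (simp add: box_def)
    moreover have "g c' = f c'" if "c' \<notin> S" "c' \<noteq> c" for c' using i(2) that by (simp add: box_def)
    ultimately show "g \<in> box (insert c S) f" using i(1) by (simp add: box_def)
  qed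
  moreover have "disjoint_family_on (\<lambda>i. box S (f(c := i))) (cell c (f c))"
    unfolding disjoint_family_on_def
  proof (intro ballI impI, rule equals0I)
    fix m n g assume "m \<noteq> n" "g \<in> box S (f(c := m)) \<inter> box S (f(c := n))"
    then show False using assms by (auto simp: box_def)
  qed
  ultimately show ?thesis
    using fin finite_cell by (simp add: sum.UNION_disjoint_family)
qed

lemma card_box: "card (box S f) = (\<Prod>c\<in>S. card (cell c (f c)))"
proof -
  have "finite S" by simp
  then show ?thesis
  proof (induction S arbitrary: f rule: finite_induct)
    case empty
    have "box {} f = {f}" by (auto simp: box_def)
    then show ?case by simp
  next
    case (insert c S)
    have "card (box (insert c S) f) = (\<Sum>i\<in>cell c (f c). card (box S (f(c := i))))"
      using box_insert[OF insert.hyps(2), of "\<lambda>_. 1::nat" f] by simp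
    also have "\<dots> = (\<Sum>i\<in>cell c (f c). \<Prod>c\<in>S. card (cell c (f c)))"
      unfolding insert.IH using insert.hyps(2) by (intro sum.cong prod.cong refl) auto
    finally show ?case using insert.hyps by simp
  qed
qed

lemma differ_nonneg: "differ f g \<ge> 0"
  by (simp add: differ_def)

lemma differ_triangle: "differ f h \<le> differ f g + differ g h"
  by (auto simp: differ_def)

text \<open>The entry of colour \<open>c\<close> is itself uniform, so it may be replaced by an
  independent \<open>i\<close>; for each \<open>j\<close> in the cell of \<open>i\<close> the
  hypothesis then bounds the disagreement.\<close>

lemma sum_differ_cell:
  assumes close: "\<And>c i j. i \<in> V \<Longrightarrow> j \<in> V \<Longrightarrow> cl c i = cl c j \<Longrightarrow>
      real (card {f\<in>tuples. E (f(c := i)) \<noteq> E (f(c := j))}) \<le> \<delta> * real (card tuples)"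
  shows "(\<Sum>f\<in>tuples. (\<Sum>i\<in>cell c (f c). differ f (f(c := i))) / real (card (cell c (f c)))) \<le> \<delta> * real (card tuples)"
proof -
  define K where "K f = (\<Sum>i\<in>cell c (f c). differ f (f(c := i))) / real (card (cell c (f c)))" for f
  have "real (card V) * (\<Sum>f\<in>tuples. K f) = (\<Sum>f\<in>tuples. \<Sum>i\<in>V. K f)" by (simp add: sum_distrib_left)
  also have "\<dots> = (\<Sum>f\<in>tuples. \<Sum>i\<in>V. K (f(c := i)))" by (rule sum_tuples_swap)
  also have "\<dots> = (\<Sum>i\<in>V. \<Sum>f\<in>tuples. K (f(c := i)))" by (rule sum.swap)
  also have "\<dots> \<le> (\<Sum>i\<in>V. \<delta> * real (card tuples))"
  proof (rule sum_mono)
    fix i assume i: "i \<in> V"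
    have "(\<Sum>f\<in>tuples. K (f(c := i))) = (\<Sum>j\<in>cell c i. \<Sum>f\<in>tuples. differ (f(c := i)) (f(c := j))) / real (card (cell c i))"
      unfolding K_def by (simp add: sum_divide_distrib[symmetric] sum.swap[of _ "cell c i"])
    also have "\<dots> \<le> (\<Sum>j\<in>cell c i. \<delta> * real (card tuples)) / real (card (cell c i))"
    proof (intro divide_right_mono sum_mono)
      fix j assume j: "j \<in> cell c i"
      have "(\<Sum>f\<in>tuples. differ (f(c := i)) (f(c := j))) = real (card {f\<in>tuples. E (f(c := i)) \<noteq> E (f(c := j))})"
        unfolding differ_def using finite_tuples by (simp add: of_bool_def sum.If_cases Int_def)
      also have "\<dots> \<le> \<delta> * real (card tuples)" using i j by (intro close) (auto simp: cell_def)
      finally show "(\<Sum>f\<in>tuples. differ (f(c := i)) (f(c := j))) \<le> \<delta> * real (card tuples)" .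
    qed simp
    also have "\<dots> = \<delta> * real (card tuples)" using card_cell_pos[OF i, of c] by simp
    finally show "(\<Sum>f\<in>tuples. K (f(c := i))) \<le> \<delta> * real (card tuples)" .
  qed
  also have "\<dots> = real (card V) * (\<delta> * real (card tuples))" by simp
  finally have "(\<Sum>f\<in>tuples. K f) \<le> \<delta> * real (card tuples)"
    using finite_V V_nonempty by (simp add: card_gt_0_iff)
  then show ?thesis by (simp add: K_def)
qed

text \<open>The box is resampled one colour at a time.\<close>

lemma sum_differ_box:
  assumes close: "\<And>c i j. i \<in> V \<Longrightarrow> j \<in> V \<Longrightarrow> cl c i = cl c j \<Longrightarrow>
      real (card {f\<in>tuples. E (f(c := i)) \<noteq> E (f(c := j))}) \<le> \<delta> * real (card tuples)"
  shows "(\<Sum>f\<in>tuples. (\<Sum>g\<in>box S f. differ f g) / real (card (box S f))) \<le> real (card S) * \<delta> * real (card tuples)"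
proof -
  have "finite S" by simp
  then show ?thesis
  proof (induction S rule: finite_induct)
    case empty
    have "box {} f = {f}" for f by (auto simp: box_def)
    then show ?case by (simp add: differ_def)
  next
    case (insert c S)
    define H where "H f = (\<Sum>g\<in>box S f. differ f g) / real (card (box S f))" for f
    have "(\<Sum>f\<in>tuples. (\<Sum>g\<in>box (insert c S) f. differ f g) / real (card (box (insert c S) f)))
      \<le> (\<Sum>f\<in>tuples. (\<Sum>i\<in>cell c (f c). differ f (f(c := i)) + H (f(c := i))) / real (card (cell c (f c))))"
    proof (rule sum_mono)
      fix f assume f: "f \<in> tuples"
      define k where "k = real (\<Prod>c\<in>S. card (cell c (f c)))"
      have kf: "real (card (box S (f(c := i)))) = k" for i
        unfolding card_box k_def using insert.hyps(2) by (intro arg_cong[where f = real] prod.cong refl) auto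
      have k: "k > 0"
      proof -
        have "f c' \<in> V" for c' using f by (simp add: tuples_def)
        then show ?thesis using card_cell_pos unfolding k_def of_nat_prod by (intro prod_pos) blast
      qed
      have m: "real (card (cell c (f c))) > 0" using f by (intro card_cell_pos) (simp add: tuples_def)
      have "(\<Sum>g\<in>box (insert c S) f. differ f g) = (\<Sum>i\<in>cell c (f c). \<Sum>g\<in>box S (f(c := i)). differ f g)"
        by (rule box_insert[OF insert.hyps(2)])
      also have "\<dots> \<le> (\<Sum>i\<in>cell c (f c). k * (differ f (f(c := i)) + H (f(c := i))))"
      proof (rule sum_mono)
        fix i
        have "(\<Sum>g\<in>box S (f(c := i)). differ f g) \<le> (\<Sum>g\<in>box S (f(c := i)). differ f (f(c := i)) + differ (f(c := i)) g)"
          by (intro sum_mono differ_triangle)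
        also have "\<dots> = k * (differ f (f(c := i)) + H (f(c := i)))"
          using k by (simp add: sum.distrib kf H_def distrib_left)
        finally show "(\<Sum>g\<in>box S (f(c := i)). differ f g) \<le> k * (differ f (f(c := i)) + H (f(c := i)))" .
      qed
      also have "\<dots> = k * (\<Sum>i\<in>cell c (f c). differ f (f(c := i)) + H (f(c := i)))" by (simp add: sum_distrib_left)
      finally have le: "(\<Sum>g\<in>box (insert c S) f. differ f g) \<le> k * (\<Sum>i\<in>cell c (f c). differ f (f(c := i)) + H (f(c := i)))" .
      have "real (card (box (insert c S) f)) = k * real (card (cell c (f c)))"
        using insert.hyps by (simp add: card_box k_def)
      then show "(\<Sum>g\<in>box (insert c S) f. differ f g) / real (card (box (insert c S) f))
        \<le> (\<Sum>i\<in>cell c (f c). differ f (f(c := i)) + H (f(c := i))) / real (card (cell c (f c)))"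
        using le k m by (simp add: field_simps)
    qed
    also have "\<dots> = (\<Sum>f\<in>tuples. (\<Sum>i\<in>cell c (f c). differ f (f(c := i))) / real (card (cell c (f c)))) + (\<Sum>f\<in>tuples. H f)"
      by (simp add: sum.distrib add_divide_distrib sum_resample)
    also have "\<dots> \<le> \<delta> * real (card tuples) + real (card S) * \<delta> * real (card tuples)"
    proof (rule add_mono)
      show "(\<Sum>f\<in>tuples. (\<Sum>i\<in>cell c (f c). differ f (f(c := i))) / real (card (cell c (f c)))) \<le> \<delta> * real (card tuples)"
        by (rule sum_differ_cell) (rule close)
      show "(\<Sum>f\<in>tuples. H f) \<le> real (card S) * \<delta> * real (card tuples)"
        unfolding H_def by (rule insert.IH)
    qed
    finally show ?case using insert.hyps by (simp add: algebra_simps)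
  qed
qed

text \<open>Each colour has at most \<open>N\<close> cells, so those with fewer than
  \<open>m\<close> elements cover at most \<open>N * m\<close> indices; the bound is summed over the
  colours.\<close>

lemma card_small_cells:
  assumes N: "\<And>c. real (card (cl c ` V)) \<le> N" and "m \<ge> 0"
  shows "real (card {f\<in>tuples. \<exists>c. real (card (cell c (f c))) < m}) * real (card V) \<le> real CARD('c) * N * m * real (card tuples)"
proof -
  have small: "real (card {i\<in>V. real (card (cell c i)) < m}) \<le> N * m" for c
  proof -
    have "{i\<in>V. real (card (cell c i)) < m} \<subseteq> (\<Union>s\<in>{s\<in>cl c ` V. real (card {j\<in>V. cl c j = s}) < m}. {j\<in>V. cl c j = s})"
      by (auto simp: cell_def)
    then have "card {i\<in>V. real (card (cell c i)) < m} \<le> card (\<Union>s\<in>{s\<in>cl c ` V. real (card {j\<in>V. cl c j = s}) < m}. {j\<in>V. cl c j = s})"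
      using finite_V by (intro card_mono) auto
    also have "\<dots> \<le> (\<Sum>s\<in>{s\<in>cl c ` V. real (card {j\<in>V. cl c j = s}) < m}. card {j\<in>V. cl c j = s})"
      using finite_V by (intro card_UN_le) auto
    finally have "real (card {i\<in>V. real (card (cell c i)) < m}) \<le> (\<Sum>s\<in>{s\<in>cl c ` V. real (card {j\<in>V. cl c j = s}) < m}. real (card {j\<in>V. cl c j = s}))"
      unfolding of_nat_sum[symmetric] of_nat_le_iff .
    also have "\<dots> \<le> (\<Sum>s\<in>{s\<in>cl c ` V. real (card {j\<in>V. cl c j = s}) < m}. m)"
      by (intro sum_mono) auto
    also have "\<dots> = real (card {s\<in>cl c ` V. real (card {j\<in>V. cl c j = s}) < m}) * m" by simp
    also have "\<dots> \<le> N * m"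
    proof (intro mult_right_mono assms(2))
      have "card {s\<in>cl c ` V. real (card {j\<in>V. cl c j = s}) < m} \<le> card (cl c ` V)"
        using finite_V by (intro card_mono) auto
      then show "real (card {s\<in>cl c ` V. real (card {j\<in>V. cl c j = s}) < m}) \<le> N" using N[of c] by linarith
    qed
    finally show ?thesis .
  qed
  define P where "P c i = (if real (card (cell c i)) < m then 1 else 0 :: real)" for c i
  have "real (card {f\<in>tuples. \<exists>c. real (card (cell c (f c))) < m}) = (\<Sum>f\<in>tuples. if \<exists>c. real (card (cell c (f c))) < m then 1 else 0)"
    using finite_tuples by (simp add: sum.If_cases Int_def)
  also have "\<dots> \<le> (\<Sum>f\<in>tuples. \<Sum>c\<in>UNIV. P c (f c))"
  proof (rule sum_mono)
    fix f :: "'c \<Rightarrow> 'i"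
    show "(if \<exists>c. real (card (cell c (f c))) < m then 1 else 0) \<le> (\<Sum>c\<in>UNIV. P c (f c))"
    proof (cases "\<exists>c. real (card (cell c (f c))) < m")
      case True
      then obtain c where "P c (f c) = 1" by (auto simp: P_def)
      moreover have "P c (f c) \<le> (\<Sum>c\<in>UNIV. P c (f c))" by (intro member_le_sum) (auto simp: P_def)
      ultimately show ?thesis using True by simp
    qed (auto intro: sum_nonneg simp: P_def)
  qed
  also have "\<dots> = (\<Sum>c\<in>UNIV. \<Sum>f\<in>tuples. P c (f c))" by (rule sum.swap)
  finally have "real (card {f\<in>tuples. \<exists>c. real (card (cell c (f c))) < m}) * real (card V)
      \<le> (\<Sum>c\<in>UNIV. \<Sum>f\<in>tuples. P c (f c)) * real (card V)" by (intro mult_right_mono) auto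
  also have "\<dots> = (\<Sum>c\<in>UNIV. \<Sum>f\<in>tuples. \<Sum>i\<in>V. P c (f c))" 
    by (simp add: sum_distrib_right mult.commute[of "real (card V)"])
  also have "\<dots> = (\<Sum>c\<in>UNIV. \<Sum>f\<in>tuples. \<Sum>i\<in>V. P c i)"
  proof (rule sum.cong[OF refl])
    fix c :: 'c
    show "(\<Sum>f\<in>tuples. \<Sum>i\<in>V. P c (f c)) = (\<Sum>f\<in>tuples. \<Sum>i\<in>V. P c i)"
      by (subst sum_tuples_swap[where c = c]) simp
  qed
  also have "\<dots> \<le> (\<Sum>c\<in>(UNIV :: 'c set). \<Sum>f\<in>tuples. N * m)"
    using small finite_V by (intro sum_mono) (simp add: P_def sum.If_cases Int_def)
  also have "\<dots> = real CARD('c) * N * m * real (card tuples)" by simp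
  finally show ?thesis .
qed

end

text \<open>A maximal \<open>\<delta>\<close>-separated set in each colour provides the cluster
  centres: \<open>sep\<close> bounds its size by \<open>N\<close>, and members of one cluster are
  \<open>2 * \<delta>\<close>-close through their centre. Tuples with \<open>E\<close> that avoid
  small cells still have density \<open>\<epsilon> / 2\<close>, so averaging
  \<open>sum_differ_box\<close> over them finds one whose box has few tuples without
  \<open>E\<close>.\<close>

lemma exists_dense_box:
  fixes E :: "('c::finite \<Rightarrow> 'i) \<Rightarrow> bool" and V :: "'i set"
  defines "T \<equiv> {f. \<forall>c. f c \<in> V}"
  assumes V: "finite V" "V \<noteq> {}" and pos: "\<epsilon> > 0" "\<delta> > 0"
    and dense: "\<epsilon> * real (card T) \<le> real (card {f\<in>T. E f})"
    and sep: "\<And>c S. S \<subseteq> V \<Longrightarrow>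
      (\<And>i j. i \<in> S \<Longrightarrow> j \<in> S \<Longrightarrow> i \<noteq> j \<Longrightarrow> \<delta> * real (card T) \<le> real (card {f\<in>T. E (f(c := i)) \<noteq> E (f(c := j))})) \<Longrightarrow>
      real (card S) \<le> N"
  shows "\<exists>W. (\<forall>c. W c \<subseteq> V \<and> W c \<noteq> {} \<and> \<epsilon> / (2 * real CARD('c) * N) * real (card V) \<le> real (card (W c))) \<and>
    real (card {f. (\<forall>c. f c \<in> W c) \<and> \<not> E f}) \<le> 4 * real CARD('c) * \<delta> / \<epsilon> * (\<Prod>c\<in>UNIV. real (card (W c)))"
proof -
  define far where "far c i j \<longleftrightarrow> \<delta> * real (card T) \<le> real (card {f\<in>T. E (f(c := i)) \<noteq> E (f(c := j))})" for c i j
  have "\<exists>S. S \<subseteq> V \<and> (\<forall>i\<in>S. \<forall>j\<in>S. i \<noteq> j \<longrightarrow> far c i j) \<and> (\<forall>i\<in>V. \<exists>s\<in>S. i = s \<or> \<not> far c i s)" for c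
  proof -
    define \<S> where "\<S> = {S. S \<subseteq> V \<and> (\<forall>i\<in>S. \<forall>j\<in>S. i \<noteq> j \<longrightarrow> far c i j)}"
    have "finite \<S>" using V(1) by (auto simp: \<S>_def intro: finite_subset[of _ "Pow V"])
    moreover have "{} \<in> \<S>" by (simp add: \<S>_def)
    ultimately obtain S where S: "S \<in> \<S>" "\<forall>S'\<in>\<S>. S \<subseteq> S' \<longrightarrow> S = S'"
      using finite_has_maximal[of \<S>] by (metis empty_iff)
    have "\<exists>s\<in>S. i = s \<or> \<not> far c i s" if i: "i \<in> V" for i
    proof (rule ccontr)
      assume no: "\<not> ?thesis"
      have sym: "far c a b = far c b a" for a b
      proof -
        have "{f\<in>T. E (f(c := a)) \<noteq> E (f(c := b))} = {f\<in>T. E (f(c := b)) \<noteq> E (f(c := a))}" by auto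
        then show ?thesis by (simp add: far_def)
      qed
      then have "insert i S \<in> \<S>" using S(1) i no by (auto simp: \<S>_def)
      then have "S = insert i S" using S(2) by blast
      then show False using no by blast
    qed
    then show ?thesis using S(1) by (auto simp: \<S>_def)
  qed
  then have "\<exists>S. \<forall>c. S c \<subseteq> V \<and> (\<forall>i\<in>S c. \<forall>j\<in>S c. i \<noteq> j \<longrightarrow> far c i j) \<and> (\<forall>i\<in>V. \<exists>s\<in>S c. i = s \<or> \<not> far c i s)"
    by (intro choice allI)
  then obtain S where S': "\<forall>c. S c \<subseteq> V \<and> (\<forall>i\<in>S c. \<forall>j\<in>S c. i \<noteq> j \<longrightarrow> far c i j) \<and> (\<forall>i\<in>V. \<exists>s\<in>S c. i = s \<or> \<not> far c i s)"
    by (elim exE) (rule that)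
  then have S: "\<And>c. S c \<subseteq> V" "\<And>c i j. i \<in> S c \<Longrightarrow> j \<in> S c \<Longrightarrow> i \<noteq> j \<Longrightarrow> far c i j"
    "\<And>c i. i \<in> V \<Longrightarrow> \<exists>s\<in>S c. i = s \<or> \<not> far c i s" by simp_all
  define cl where "cl c i = (SOME s. s \<in> S c \<and> (i = s \<or> \<not> far c i s))" for c i
  have cl: "cl c i \<in> S c" "i = cl c i \<or> \<not> far c i (cl c i)" if "i \<in> V" for c i
  proof -
    have "\<exists>s. s \<in> S c \<and> (i = s \<or> \<not> far c i s)" using S(3)[OF that] by blast
    then have "cl c i \<in> S c \<and> (i = cl c i \<or> \<not> far c i (cl c i))" unfolding cl_def by (rule someI_ex)
    then show "cl c i \<in> S c" "i = cl c i \<or> \<not> far c i (cl c i)" by auto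
  qed
  interpret clustered_tuples V cl E "2 * \<delta>" using V by unfold_locales
  have T: "T = tuples" by (simp add: T_def tuples_def)
  have cT: "real (card T) > 0" using V by (simp add: T card_tuples card_gt_0_iff)
  have S_card: "real (card (S c)) \<le> N" for c
    by (rule sep[OF S(1), of c c]) (use S(2) in \<open>simp add: far_def\<close>)
  have clS: "real (card (cl c ` V)) \<le> N" for c
  proof -
    have "card (cl c ` V) \<le> card (S c)" using cl(1) by (intro card_mono finite_subset[OF S(1) V(1)]) auto
    then show ?thesis using S_card[of c] by linarith
  qed
  have N: "N > 0"
  proof -
    fix c :: 'c
    have "real (card (cl c ` V)) > 0" using V by (simp add: card_gt_0_iff)
    then show ?thesis using clS[of c] by linarith
  qed
  have near: "real (card {f\<in>tuples. E (f(c := i)) \<noteq> E (f(c := cl c i))}) \<le> \<delta> * real (card tuples)" if "i \<in> V" for c i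
    using cl(2)[OF that, of c]
  proof
    assume "i = cl c i"
    then have "{f\<in>tuples. E (f(c := i)) \<noteq> E (f(c := cl c i))} = {}" by auto
    then show ?thesis using pos(2) by (simp only:) simp
  qed (simp add: far_def T)
  have close: "real (card {f\<in>tuples. E (f(c := i)) \<noteq> E (f(c := j))}) \<le> 2 * \<delta> * real (card tuples)"
    if ij: "i \<in> V" "j \<in> V" "cl c i = cl c j" for c i j
  proof -
    have "card {f\<in>tuples. E (f(c := i)) \<noteq> E (f(c := j))}
        \<le> card ({f\<in>tuples. E (f(c := i)) \<noteq> E (f(c := cl c i))} \<union> {f\<in>tuples. E (f(c := j)) \<noteq> E (f(c := cl c j))})"
      using finite_tuples ij(3) by (intro card_mono) auto
    also have "\<dots> \<le> card {f\<in>tuples. E (f(c := i)) \<noteq> E (f(c := cl c i))} + card {f\<in>tuples. E (f(c := j)) \<noteq> E (f(c := cl c j))}"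
      by (rule card_Un_le)
    finally show ?thesis using near[OF ij(1), of c] near[OF ij(2), of c] by linarith
  qed
  \<comment> \<open>Makes the tuples with an entry in a cell smaller than \<open>m\<close> at most
    half of the guaranteed \<open>\<epsilon> * card tuples\<close>.\<close>
  define m where "m = \<epsilon> / (2 * real CARD('c) * N) * real (card V)"
  have m: "m \<ge> 0" using pos N by (simp add: m_def)
  define Z where "Z = {f\<in>tuples. \<exists>c. real (card (cell c (f c))) < m}"
  define A where "A = {f\<in>tuples. E f} - Z"
  have "real (card Z) * real (card V) \<le> real CARD('c) * N * m * real (card tuples)"
    unfolding Z_def by (rule card_small_cells[OF clS m])
  also have "\<dots> = (\<epsilon> / 2 * real (card tuples)) * real (card V)" using N by (simp add: m_def)
  finally have "real (card Z) \<le> \<epsilon> / 2 * real (card tuples)" using V by (simp add: card_gt_0_iff)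
  moreover have "real (card {f\<in>tuples. E f}) - real (card Z) \<le> real (card A)"
  proof -
    have "card {f\<in>tuples. E f} \<le> card (A \<union> Z)" using finite_tuples by (intro card_mono) (auto simp: A_def Z_def)
    then show ?thesis using card_Un_le[of A Z] by linarith
  qed
  ultimately have A: "real (card A) \<ge> \<epsilon> / 2 * real (card tuples)" using dense by (simp add: T)
  define \<rho> where "\<rho> f = (\<Sum>g\<in>box UNIV f. differ f g) / real (card (box UNIV f))" for f
  have "\<exists>f\<in>A. \<rho> f \<le> 4 * real CARD('c) * \<delta> / \<epsilon>"
  proof (rule ccontr)
    assume no: "\<not> ?thesis"
    have fA: "finite A" using finite_tuples by (simp add: A_def)
    have "\<epsilon> / 2 * real (card tuples) > 0" using cT pos by (simp add: T)
    then have "A \<noteq> {}" using A by auto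
    then have "(\<Sum>f\<in>A. 4 * real CARD('c) * \<delta> / \<epsilon>) < (\<Sum>f\<in>A. \<rho> f)"
      using no fA by (intro sum_strict_mono) auto
    also have "\<dots> \<le> (\<Sum>f\<in>tuples. \<rho> f)"
      using finite_tuples differ_nonneg by (intro sum_mono2) (auto simp: A_def \<rho>_def intro!: divide_nonneg_nonneg sum_nonneg)
    also have "\<dots> \<le> real CARD('c) * (2 * \<delta>) * real (card tuples)"
      unfolding \<rho>_def by (rule sum_differ_box[OF close])
    finally have "real (card A) * (4 * real CARD('c) * \<delta> / \<epsilon>) < real CARD('c) * (2 * \<delta>) * real (card tuples)" by simp
    moreover have "\<epsilon> / 2 * real (card tuples) * (4 * real CARD('c) * \<delta> / \<epsilon>) \<le> real (card A) * (4 * real CARD('c) * \<delta> / \<epsilon>)"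
      using A pos by (intro mult_right_mono) auto
    moreover have "\<epsilon> / 2 * real (card tuples) * (4 * real CARD('c) * \<delta> / \<epsilon>) = real CARD('c) * (2 * \<delta>) * real (card tuples)"
      using pos by simp
    ultimately show False by linarith
  qed
  then obtain f where f: "f \<in> A" "\<rho> f \<le> 4 * real CARD('c) * \<delta> / \<epsilon>" by blast
  have fV: "f c \<in> V" for c using f(1) by (simp add: A_def tuples_def)
  define W where "W c = cell c (f c)" for c
  have box: "box UNIV f = {g. \<forall>c. g c \<in> W c}" by (simp add: box_def W_def)
  have fin: "finite (box UNIV f)"
  proof -
    have "box UNIV f \<subseteq> tuples" by (auto simp: box W_def cell_def tuples_def)
    then show ?thesis using finite_tuples by (rule finite_subset)
  qed
  have cb: "real (card (box UNIV f)) = (\<Prod>c\<in>UNIV. real (card (W c)))" by (simp add: card_box W_def)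
  have bpos: "real (card (box UNIV f)) > 0" unfolding cb W_def using card_cell_pos[OF fV] by (intro prod_pos) blast
  have "(\<Sum>g\<in>box UNIV f. differ f g) = real (card {g. (\<forall>c. g c \<in> W c) \<and> \<not> E g})"
  proof -
    have "E f" using f(1) by (simp add: A_def)
    then show ?thesis unfolding differ_def using fin by (simp add: of_bool_def sum.If_cases Int_def box)
  qed
  then have "real (card {g. (\<forall>c. g c \<in> W c) \<and> \<not> E g}) \<le> 4 * real CARD('c) * \<delta> / \<epsilon> * (\<Prod>c\<in>UNIV. real (card (W c)))"
    using f(2) bpos unfolding \<rho>_def cb[symmetric] by (simp add: pos_divide_le_eq)
  moreover have "W c \<subseteq> V \<and> W c \<noteq> {} \<and> m \<le> real (card (W c))" for c
    using f(1) fV[of c] by (auto simp: A_def Z_def W_def cell_def not_less)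
  ultimately show ?thesis unfolding m_def by (intro exI[of _ W]) blast
qed

section \<open>Counting loose families\<close>

lemma simplex_vertex_enumeration:
  fixes S :: "(real ^ 'd::finite) set"
  assumes "int CARD('d) simplex S"
  shows "\<exists>v :: 'd option \<Rightarrow> real ^ 'd. S = convex hull (range v)"
proof -
  obtain C where C: "\<not> affine_dependent C" "int (card C) = int CARD('d) + 1" "S = convex hull C"
    using assms unfolding simplex_def by blast
  have "card C = CARD('d option)" using C(2) by (simp add: card_UNIV_option)
  moreover have "finite C" using C(1) by (rule aff_independent_finite)
  ultimately obtain v :: "'d option \<Rightarrow> real ^ 'd" where "bij_betw v UNIV C"
    using finite_same_card_bij[of "UNIV :: 'd option set" C] by auto
  then show ?thesis using C(3) by (auto simp: bij_betw_def)
qed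

text \<open>Each loose family is the set of members of some loose tuple: enumerate it by the colours
  and choose an index for each member.\<close>

lemma card_loose_families:
  fixes \<Delta> :: "nat \<Rightarrow> (real ^ 'd::finite) set"
  assumes V: "finite V" and vtx: "\<And>i. i \<in> V \<Longrightarrow> \<Delta> i = convex hull (range (vtx i :: 'd option \<Rightarrow> real ^ 'd))"
  shows "card {\<F>. \<F> \<subseteq> \<Delta> ` V \<and> loose_family \<F>} \<le> card {f :: 'd option \<Rightarrow> nat. (\<forall>c. f c \<in> V) \<and> hull_loose (\<lambda>c. vtx (f c))}"
proof -
  have "{f :: 'd option \<Rightarrow> nat. \<forall>c. f c \<in> V} = UNIV \<rightarrow>\<^sub>E V" by (auto simp: PiE_def)
  then have "finite {f :: 'd option \<Rightarrow> nat. \<forall>c. f c \<in> V}" using V by (simp add: finite_PiE)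
  then have fin: "finite {f :: 'd option \<Rightarrow> nat. (\<forall>c. f c \<in> V) \<and> hull_loose (\<lambda>c. vtx (f c))}" by (rule rev_finite_subset) auto
  have "{\<F>. \<F> \<subseteq> \<Delta> ` V \<and> loose_family \<F>} \<subseteq> (\<lambda>f. range (\<lambda>c. \<Delta> (f c))) ` {f :: 'd option \<Rightarrow> nat. (\<forall>c. f c \<in> V) \<and> hull_loose (\<lambda>c. vtx (f c))}"
  proof
    fix \<F> assume "\<F> \<in> {\<F>. \<F> \<subseteq> \<Delta> ` V \<and> loose_family \<F>}"
    then have F: "\<F> \<subseteq> \<Delta> ` V" "card \<F> = CARD('d) + 1" "(\<Inter>K\<in>\<F>. conv_family (\<F> - {K})) \<noteq> {}"
      by (auto simp: loose_family_def separated_compact_family_def tight_family_def)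
    have "finite \<F>" using F(1) V by (auto intro: finite_subset)
    then obtain h :: "'d option \<Rightarrow> (real ^ 'd) set" where h: "bij_betw h UNIV \<F>"
      using finite_same_card_bij[of "UNIV :: 'd option set" \<F>] F(2) by (auto simp: card_UNIV_option)
    have "\<exists>i. i \<in> V \<and> \<Delta> i = h c" for c
    proof -
      have "h c \<in> \<Delta> ` V" using h F(1) by (auto simp: bij_betw_def)
      then show ?thesis by auto
    qed
    then have "\<exists>f. \<forall>c. f c \<in> V \<and> \<Delta> (f c) = h c" by (intro choice allI)
    then obtain f where f: "\<And>c. f c \<in> V" "\<And>c. \<Delta> (f c) = h c" by auto
    obtain x where x: "\<And>K. K \<in> \<F> \<Longrightarrow> x \<in> conv_family (\<F> - {K})" using F(3) by blast
    have "x \<in> convex hull (\<Union>c'\<in>UNIV - {c}. range (vtx (f c')))" for c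
    proof -
      have "x \<in> conv_family (\<F> - {h c})" using h by (intro x) (auto simp: bij_betw_def)
      moreover have "\<F> - {h c} = h ` (UNIV - {c})" using h by (auto simp: bij_betw_def inj_eq)
      moreover have "\<Union>(h ` (UNIV - {c})) \<subseteq> convex hull (\<Union>c'\<in>UNIV - {c}. range (vtx (f c')))"
      proof (intro Union_least)
        fix K assume "K \<in> h ` (UNIV - {c})"
        then obtain c' where c': "c' \<noteq> c" "K = convex hull (range (vtx (f c')))" using f vtx by auto
        have "range (vtx (f c')) \<subseteq> (\<Union>c'\<in>UNIV - {c}. range (vtx (f c')))" using c'(1) by blast
        then show "K \<subseteq> convex hull (\<Union>c'\<in>UNIV - {c}. range (vtx (f c')))" unfolding c'(2) by (rule hull_mono)
      qed
      then have "convex hull (\<Union>(h ` (UNIV - {c}))) \<subseteq> convex hull (\<Union>c'\<in>UNIV - {c}. range (vtx (f c')))"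
        by (rule hull_minimal) (rule convex_convex_hull)
      ultimately show ?thesis unfolding conv_family_def by auto
    qed
    then have "hull_loose (\<lambda>c. vtx (f c))" unfolding hull_loose_def by blast
    moreover have "\<F> = range (\<lambda>c. \<Delta> (f c))" using h f(2) by (simp add: bij_betw_def)
    ultimately show "\<F> \<in> (\<lambda>f. range (\<lambda>c. \<Delta> (f c))) ` {f :: 'd option \<Rightarrow> nat. (\<forall>c. f c \<in> V) \<and> hull_loose (\<lambda>c. vtx (f c))}"
      using f(1) by blast
  qed
  then show ?thesis using fin by (rule surj_card_le[rotated])
qed

text \<open>A simplex is a point with \<open>(CARD('d) + 1) * CARD('d)\<close> coordinates, and
  \<open>CARD('d) \<ge> 2\<close> makes this less than \<open>CARD('d) ^ 3\<close>, as
  \<open>card_separated_le\<close> requires.\<close>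

lemma card_separated_indices:
  assumes "CARD('d::finite) \<ge> 2"
  shows "\<exists>K>0. \<forall>(vtx :: nat \<Rightarrow> 'd option \<Rightarrow> real ^ 'd) V c S \<delta>.
    finite V \<longrightarrow> V \<noteq> {} \<longrightarrow> finite S \<longrightarrow> 0 < \<delta> \<longrightarrow> \<delta> \<le> 1 \<longrightarrow>
    (\<forall>i\<in>S. \<forall>j\<in>S. i \<noteq> j \<longrightarrow> \<delta> * real (card {f :: 'd option \<Rightarrow> nat. \<forall>c. f c \<in> V}) \<le>
      real (card {f\<in>{f :: 'd option \<Rightarrow> nat. \<forall>c. f c \<in> V}. hull_loose (\<lambda>c'. vtx ((f(c := i)) c')) \<noteq> hull_loose (\<lambda>c'. vtx ((f(c := j)) c'))})) \<longrightarrow>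
    real (card S) \<le> (K / \<delta>) ^ (CARD('d) ^ 3)"
proof -
  obtain M m where Mm: "\<forall>(c0 :: 'd option) (V :: 'd option \<Rightarrow> 'd option \<Rightarrow> real ^ 'd).
    \<exists>G :: (real ^ ('d option \<times> 'd) \<Rightarrow> real) set. finite G \<and> card G \<le> M \<and> G \<subseteq> polyfun m \<and>
      (\<forall>z z'. (\<forall>g\<in>G. g z > 0 \<longleftrightarrow> g z' > 0) \<longrightarrow>
        hull_loose (V(c0 := (\<lambda>k. \<chi> t. z $ (k, t)))) = hull_loose (V(c0 := (\<lambda>k. \<chi> t. z' $ (k, t)))))"
    using hull_loose_sign_determined by (elim exE) (rule that)
  have "CARD('d option \<times> 'd) < CARD('d) ^ 3"
  proof -
    have "CARD('d) + 1 < CARD('d) * CARD('d)"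
      using assms mult_le_mono1[OF assms, of "CARD('d)"] by linarith
    then have "(CARD('d) + 1) * CARD('d) < CARD('d) * CARD('d) * CARD('d)" by (rule mult_strict_right_mono) simp
    then show ?thesis by (simp add: card_UNIV_option power3_eq_cube)
  qed
  from card_separated_le[OF this, of M m] obtain K where K: "K > 0"
    and sep: "\<forall>(R :: ('d option \<Rightarrow> nat) \<Rightarrow> nat \<Rightarrow> bool) (z :: nat \<Rightarrow> real ^ ('d option \<times> 'd)) E S (\<delta>::real).
    finite E \<longrightarrow> E \<noteq> {} \<longrightarrow> finite S \<longrightarrow> 0 < \<delta> \<longrightarrow> \<delta> \<le> 1 \<longrightarrow>
    (\<forall>e\<in>E. \<exists>G. finite G \<and> card G \<le> M \<and> G \<subseteq> polyfun m \<and>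
      (\<forall>i\<in>S. \<forall>j\<in>S. (\<forall>g\<in>G. g (z i) > 0 \<longleftrightarrow> g (z j) > 0) \<longrightarrow> R e i = R e j)) \<longrightarrow>
    (\<forall>i\<in>S. \<forall>j\<in>S. i \<noteq> j \<longrightarrow> \<delta> * real (card E) \<le> real (card {e\<in>E. R e i \<noteq> R e j})) \<longrightarrow>
    real (card S) \<le> (K / \<delta>) ^ (CARD('d) ^ 3)"
    by (elim exE conjE) (rule that)
  have "real (card S) \<le> (K / \<delta>) ^ (CARD('d) ^ 3)"
    if V: "finite V" "V \<noteq> {}" and S: "finite S" "0 < \<delta>" "\<delta> \<le> 1"
      and far: "\<forall>i\<in>S. \<forall>j\<in>S. i \<noteq> j \<longrightarrow> \<delta> * real (card {f :: 'd option \<Rightarrow> nat. \<forall>c. f c \<in> V}) \<le>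
      real (card {f\<in>{f :: 'd option \<Rightarrow> nat. \<forall>c. f c \<in> V}. hull_loose (\<lambda>c'. vtx ((f(c := i)) c')) \<noteq> hull_loose (\<lambda>c'. vtx ((f(c := j)) c'))})"
    for vtx :: "nat \<Rightarrow> 'd option \<Rightarrow> real ^ 'd" and V c S \<delta>
  proof -
    define R where "R f i = hull_loose (\<lambda>c'. vtx ((f(c := i)) c'))" for f :: "'d option \<Rightarrow> nat" and i
    define z where "z i = (\<chi> q. vtx i (fst q) $ snd q)" for i
    define T where "T = {f :: 'd option \<Rightarrow> nat. \<forall>c. f c \<in> V}"
    have "T = UNIV \<rightarrow>\<^sub>E V" by (auto simp: T_def PiE_def)
    then have T: "finite T" "T \<noteq> {}" using V by (simp_all add: finite_PiE PiE_eq_empty_iff)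
    have zv: "(\<lambda>k. \<chi> t. z i $ (k, t)) = vtx i" for i by (simp add: z_def fun_eq_iff vec_eq_iff)
    have "\<exists>G. finite G \<and> card G \<le> M \<and> G \<subseteq> polyfun m \<and>
      (\<forall>i\<in>S. \<forall>j\<in>S. (\<forall>g\<in>G. g (z i) > 0 \<longleftrightarrow> g (z j) > 0) \<longrightarrow> R f i = R f j)" for f
    proof -
      from Mm[THEN spec[of _ c], THEN spec[of _ "\<lambda>c'. vtx (f c')"]] obtain G :: "(real ^ ('d option \<times> 'd) \<Rightarrow> real) set"
        where G: "finite G" "card G \<le> M" "G \<subseteq> polyfun m"
        "\<forall>z z'. (\<forall>g\<in>G. g z > 0 \<longleftrightarrow> g z' > 0) \<longrightarrow>
        hull_loose ((\<lambda>c'. vtx (f c'))(c := (\<lambda>k. \<chi> t. z $ (k, t)))) = hull_loose ((\<lambda>c'. vtx (f c'))(c := (\<lambda>k. \<chi> t. z' $ (k, t))))"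
        by (elim exE conjE) (rule that)
      have upd: "(\<lambda>c'. vtx (f c'))(c := vtx i) = (\<lambda>c'. vtx ((f(c := i)) c'))" for i by auto
      have "\<forall>i\<in>S. \<forall>j\<in>S. (\<forall>g\<in>G. g (z i) > 0 \<longleftrightarrow> g (z j) > 0) \<longrightarrow> R f i = R f j"
      proof (intro ballI impI)
        fix i j assume "\<forall>g\<in>G. g (z i) > 0 \<longleftrightarrow> g (z j) > 0"
        from G(4)[THEN spec, THEN spec, THEN mp, OF this] show "R f i = R f j"
          unfolding zv upd R_def .
      qed
      then show ?thesis by (intro exI[of _ G] conjI G(1,2,3))
    qed
    then have GG: "\<forall>f\<in>T. \<exists>G. finite G \<and> card G \<le> M \<and> G \<subseteq> polyfun m \<and>
      (\<forall>i\<in>S. \<forall>j\<in>S. (\<forall>g\<in>G. g (z i) > 0 \<longleftrightarrow> g (z j) > 0) \<longrightarrow> R f i = R f j)" by (intro ballI)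
    show ?thesis
      by (rule sep[THEN spec, THEN spec, THEN spec, THEN spec, THEN spec, THEN mp, THEN mp, THEN mp, THEN mp, THEN mp, THEN mp, THEN mp,
          OF T S GG far[folded R_def T_def]])
  qed
  then show ?thesis by (intro exI[of _ K] conjI K allI impI)
qed

lemma powr_bound_of_power_bound:
  fixes \<epsilon> B :: real and r n d :: nat
  assumes "\<epsilon> > 0" "B \<ge> 0" "r > 0" "d > 0" and le: "\<epsilon> ^ Suc n \<le> B * real r powr (- 1 / real d)"
  shows "\<epsilon> \<le> B powr (1 / real (Suc n)) * real r powr (- 1 / (real d * real (Suc n)))"
proof -
  have "\<epsilon> = (\<epsilon> ^ Suc n) powr (1 / real (Suc n))"
    using assms(1) by (simp only: powr_powr powr_realpow[symmetric]) simp
  also have "\<dots> \<le> (B * real r powr (- 1 / real d)) powr (1 / real (Suc n))"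
    using le assms(1) by (intro powr_mono2) auto
  also have "\<dots> = B powr (1 / real (Suc n)) * real r powr (- 1 / (real d * real (Suc n)))"
    using assms by (simp add: powr_mult powr_powr)
  finally show ?thesis .
qed

lemma loose_tuples_density:
  assumes d2: "CARD('d::finite) \<ge> 2"
  shows "\<exists>B\<ge>0. \<forall>r (\<Delta> :: nat \<Rightarrow> (real ^ 'd) set) vtx \<epsilon>. 0 < r \<longrightarrow> 0 < \<epsilon> \<longrightarrow>
    (\<forall>i\<in>{1..r}. \<Delta> i = convex hull (range (vtx i :: 'd option \<Rightarrow> real ^ 'd))) \<longrightarrow>
    (\<forall>H. hyperplane H \<longrightarrow> real (card {i\<in>{1..r}. H \<inter> \<Delta> i \<noteq> {}}) \<le> c * real r powr (1 - 1 / real CARD('d))) \<longrightarrow>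
    \<epsilon> * real (card {f :: 'd option \<Rightarrow> nat. \<forall>c. f c \<in> {1..r}}) = real (card {f\<in>{f :: 'd option \<Rightarrow> nat. \<forall>c. f c \<in> {1..r}}. hull_loose (\<lambda>c. vtx (f c))}) \<longrightarrow>
    \<epsilon> ^ Suc (CARD('d) ^ 3) \<le> B * real r powr (- 1 / real CARD('d))"
proof -
  obtain \<eta> \<kappa>0 where \<eta>: "\<eta> > 0" and \<kappa>0: "\<kappa>0 > 0"
    and tight: "\<forall>(W :: 'd option \<Rightarrow> nat set) (vtx :: nat \<Rightarrow> 'd option \<Rightarrow> real ^ 'd).
    simplex_tuples W vtx \<eta> \<longrightarrow>
    \<kappa>0 * (\<Prod>c\<in>UNIV. real (card (W c))) \<le> real (card {f. (\<forall>c. f c \<in> W c) \<and> \<not> hull_loose (\<lambda>c. vtx (f c))})"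
    using exists_tight_density by (elim exE conjE) (rule that)
  obtain K where K: "K > 0" and sep: "\<forall>(vtx :: nat \<Rightarrow> 'd option \<Rightarrow> real ^ 'd) V c S \<delta>.
    finite V \<longrightarrow> V \<noteq> {} \<longrightarrow> finite S \<longrightarrow> 0 < \<delta> \<longrightarrow> \<delta> \<le> 1 \<longrightarrow>
    (\<forall>i\<in>S. \<forall>j\<in>S. i \<noteq> j \<longrightarrow> \<delta> * real (card {f :: 'd option \<Rightarrow> nat. \<forall>c. f c \<in> V}) \<le>
      real (card {f\<in>{f :: 'd option \<Rightarrow> nat. \<forall>c. f c \<in> V}. hull_loose (\<lambda>c'. vtx ((f(c := i)) c')) \<noteq> hull_loose (\<lambda>c'. vtx ((f(c := j)) c'))})) \<longrightarrow>
    real (card S) \<le> (K / \<delta>) ^ (CARD('d) ^ 3)"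
    using card_separated_indices[OF d2] by (elim exE conjE) (rule that)
  \<comment> \<open>The minimum with 1 ensures \<open>\<delta> \<le> 1\<close> below.\<close>
  define \<kappa> where "\<kappa> = min \<kappa>0 1"
  have \<kappa>: "0 < \<kappa>" "\<kappa> \<le> \<kappa>0" "\<kappa> \<le> 1" using \<kappa>0 by (auto simp: \<kappa>_def)
  define D where "D = real CARD('d option)"
  have D: "D \<ge> 1" by (simp add: D_def Suc_le_eq)
  define n where "n = CARD('d) ^ 3"
  \<comment> \<open>Read off from \<open>\<eta> * \<epsilon> * r / (2 * D * N) \<le> \<bar>c\<bar> *
    r powr (1 - 1 / d)\<close>, with \<open>d\<close> for \<open>CARD('d)\<close>, and
    \<open>N * \<epsilon> ^ n = (8 * D * K / \<kappa>) ^ n\<close>; the absolute value covers every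
    sign of \<open>c\<close>.\<close>
  define B where "B = (2 * D * \<bar>c\<bar> / \<eta>) * (8 * D * K / \<kappa>) ^ n"
  have B: "B \<ge> 0" using D \<eta> K \<kappa> by (simp add: B_def)
  have "\<epsilon> ^ Suc n \<le> B * real r powr (- 1 / real CARD('d))"
    if r: "0 < r" and \<epsilon>: "0 < \<epsilon>" and \<Delta>: "\<forall>i\<in>{1..r}. \<Delta> i = convex hull (range (vtx i :: 'd option \<Rightarrow> real ^ 'd))"
      and cross: "\<forall>H. hyperplane H \<longrightarrow> real (card {i\<in>{1..r}. H \<inter> \<Delta> i \<noteq> {}}) \<le> c * real r powr (1 - 1 / real CARD('d))"
      and eq: "\<epsilon> * real (card {f :: 'd option \<Rightarrow> nat. \<forall>c. f c \<in> {1..r}}) = real (card {f\<in>{f :: 'd option \<Rightarrow> nat. \<forall>c. f c \<in> {1..r}}. hull_loose (\<lambda>c. vtx (f c))})"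
    for r \<epsilon> vtx and \<Delta> :: "nat \<Rightarrow> (real ^ 'd) set"
  proof -
    define T where "T = {f :: 'd option \<Rightarrow> nat. \<forall>c. f c \<in> {1..r}}"
    have "T = UNIV \<rightarrow>\<^sub>E {1..r}" by (auto simp: T_def PiE_def)
    then have T: "finite T" "card T > 0" using r by (simp_all add: finite_PiE card_PiE)
    have "\<epsilon> \<le> 1"
    proof -
      have "card {f\<in>T. hull_loose (\<lambda>c. vtx (f c))} \<le> card T" using T(1) by (intro card_mono) auto
      then have "\<epsilon> * real (card T) \<le> 1 * real (card T)" using eq by (simp add: T_def)
      then show ?thesis using T(2) by simp
    qed
    \<comment> \<open>Brings the bound \<open>4 * D * \<delta> / \<epsilon>\<close> on the non-loose
      fraction of the box down to \<open>\<kappa> / 2\<close>, below the fraction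
      \<open>\<kappa>0\<close> that would be non-loose if no hyperplane crossed more than a fraction
      \<open>\<eta>\<close> of a side.\<close>
    define \<delta> where "\<delta> = \<kappa> * \<epsilon> / (8 * D)"
    have \<delta>: "\<delta> > 0" using \<kappa> \<epsilon> D by (simp add: \<delta>_def)
    have "\<kappa> * \<epsilon> \<le> 1 * 1" using \<kappa> \<epsilon> \<open>\<epsilon> \<le> 1\<close> by (intro mult_mono) auto
    then have "\<delta> \<le> 1" using D by (simp add: \<delta>_def)
    define N where "N = (K / \<delta>) ^ n"
    have N: "N > 0" using K \<delta> by (simp add: N_def)
    have "\<exists>W :: 'd option \<Rightarrow> nat set. (\<forall>c. W c \<subseteq> {1..r} \<and> W c \<noteq> {} \<and> \<epsilon> / (2 * real CARD('d option) * N) * real (card {1..r}) \<le> real (card (W c))) \<and>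
      real (card {f. (\<forall>c. f c \<in> W c) \<and> \<not> hull_loose (\<lambda>c. vtx (f c))}) \<le> 4 * real CARD('d option) * \<delta> / \<epsilon> * (\<Prod>c\<in>UNIV. real (card (W c)))"
    proof (rule exists_dense_box[where E = "\<lambda>f. hull_loose (\<lambda>c. vtx (f c))"])
      show "{1..r} \<noteq> {}" using r by simp
      show "\<epsilon> * real (card {f :: 'd option \<Rightarrow> nat. \<forall>c. f c \<in> {1..r}}) \<le> real (card {f\<in>{f :: 'd option \<Rightarrow> nat. \<forall>c. f c \<in> {1..r}}. hull_loose (\<lambda>c. vtx (f c))})"
        using eq by simp
      fix c :: "'d option" and S :: "nat set"
      assume S: "S \<subseteq> {1..r}"
        and far: "\<And>i j. i \<in> S \<Longrightarrow> j \<in> S \<Longrightarrow> i \<noteq> j \<Longrightarrow> \<delta> * real (card {f :: 'd option \<Rightarrow> nat. \<forall>c. f c \<in> {1..r}}) \<le>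
          real (card {f\<in>{f :: 'd option \<Rightarrow> nat. \<forall>c. f c \<in> {1..r}}. hull_loose (\<lambda>c'. vtx ((f(c := i)) c')) \<noteq> hull_loose (\<lambda>c'. vtx ((f(c := j)) c'))})"
      have "finite S" using S by (rule finite_subset) simp
      have "{1..r} \<noteq> {}" using r by simp
      note sep' = sep[THEN spec[of _ vtx], THEN spec, THEN spec[of _ c], THEN spec, THEN spec, THEN mp, THEN mp, THEN mp, THEN mp, THEN mp, THEN mp,
          OF finite_atLeastAtMost this \<open>finite S\<close> \<delta> \<open>\<delta> \<le> 1\<close>]
      show "real (card S) \<le> N"
        unfolding N_def n_def by (rule sep') (intro ballI impI far)
    qed (use \<epsilon> \<delta> in simp_all)
    then obtain W :: "'d option \<Rightarrow> nat set" where W: "\<And>c. W c \<subseteq> {1..r}" "\<And>c. W c \<noteq> {}" "\<And>c. \<epsilon> / (2 * D * N) * real r \<le> real (card (W c))"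
      "real (card {f. (\<forall>c. f c \<in> W c) \<and> \<not> hull_loose (\<lambda>c. vtx (f c))}) \<le> 4 * D * \<delta> / \<epsilon> * (\<Prod>c\<in>UNIV. real (card (W c)))"
      unfolding D_def[symmetric] by auto
    have fW: "finite (W c)" for c using W(1) by (rule finite_subset) simp
    have pW: "(\<Prod>c\<in>UNIV. real (card (W c))) > 0" using fW W(2) by (intro prod_pos) (simp add: card_gt_0_iff)
    have "\<not> simplex_tuples W vtx \<eta>"
    proof
      assume "simplex_tuples W vtx \<eta>"
      from tight[THEN spec, THEN spec, THEN mp, OF this] W(4)
      have "\<kappa>0 * (\<Prod>c\<in>UNIV. real (card (W c))) \<le> 4 * D * \<delta> / \<epsilon> * (\<Prod>c\<in>UNIV. real (card (W c)))" by linarith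
      then have "\<kappa>0 \<le> 4 * D * \<delta> / \<epsilon>" by (rule mult_right_le_imp_le) (rule pW)
      also have "\<dots> = \<kappa> / 2" using \<epsilon> D by (simp add: \<delta>_def)
      finally show False using \<kappa> by simp
    qed
    moreover have "partite_complex W" using fW W(2) by unfold_locales
    ultimately obtain H e where H: "hyperplane H"
      "\<not> real (card {i\<in>W e. H \<inter> convex hull (range (vtx i)) \<noteq> {}}) \<le> \<eta> * real (card (W e))"
      unfolding simplex_tuples_def simplex_tuples_axioms_def by blast
    have "\<eta> * (\<epsilon> / (2 * D * N) * real r) \<le> \<eta> * real (card (W e))" using W(3) \<eta> by (intro mult_left_mono) auto
    also have "\<dots> \<le> real (card {i\<in>W e. H \<inter> convex hull (range (vtx i)) \<noteq> {}})" using H(2) by simp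
    also have "\<dots> \<le> real (card {i\<in>{1..r}. H \<inter> \<Delta> i \<noteq> {}})"
    proof -
      have "{i\<in>W e. H \<inter> convex hull (range (vtx i)) \<noteq> {}} \<subseteq> {i\<in>{1..r}. H \<inter> \<Delta> i \<noteq> {}}"
        using W(1) \<Delta> by blast
      then show ?thesis by (simp add: card_mono)
    qed
    also have "\<dots> \<le> c * real r powr (1 - 1 / real CARD('d))" using cross H(1) by blast
    also have "\<dots> \<le> \<bar>c\<bar> * real r powr (1 - 1 / real CARD('d))" by (intro mult_right_mono) auto
    also have "\<dots> = \<bar>c\<bar> * (real r * real r powr (- 1 / real CARD('d)))"
      using r by (simp add: powr_diff powr_minus_divide)
    finally have "(\<eta> * \<epsilon> / (2 * D * N)) * real r \<le> (\<bar>c\<bar> * real r powr (- 1 / real CARD('d))) * real r"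
      by (simp add: mult_ac)
    then have "\<eta> * \<epsilon> / (2 * D * N) \<le> \<bar>c\<bar> * real r powr (- 1 / real CARD('d))" by (rule mult_right_le_imp_le) (use r in simp)
    then have le: "\<epsilon> \<le> (2 * D * \<bar>c\<bar> / \<eta>) * N * real r powr (- 1 / real CARD('d))"
      using \<eta> D N by (simp add: field_simps)
    have N': "N * \<epsilon> ^ n = (8 * D * K / \<kappa>) ^ n"
      using \<epsilon> \<kappa> D by (simp add: N_def \<delta>_def power_mult_distrib[symmetric] mult.commute)
    have "\<epsilon> ^ Suc n = \<epsilon> * \<epsilon> ^ n" by simp
    also have "\<dots> \<le> ((2 * D * \<bar>c\<bar> / \<eta>) * N * real r powr (- 1 / real CARD('d))) * \<epsilon> ^ n"
      using le \<epsilon> by (intro mult_right_mono) auto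
    also have "\<dots> = (2 * D * \<bar>c\<bar> / \<eta>) * (N * \<epsilon> ^ n) * real r powr (- 1 / real CARD('d))" by (simp only: mult_ac)
    also have "\<dots> = B * real r powr (- 1 / real CARD('d))" unfolding N' B_def ..
    finally show ?thesis .
  qed
  then show ?thesis unfolding n_def by (intro exI[of _ B] conjI B allI impI)
qed

theorem theorem3p2:
  fixes c :: real
  assumes "CARD('d::finite) \<ge> 2"
  shows "\<exists>C::real. \<forall>(P :: (real ^ 'd) set) (r::nat) Q \<Delta>.
    finite P \<and> general_position P \<and> 0 < r \<and> r \<le> card P \<and> low_crossing_partition c P r Q \<Delta> \<longrightarrow>
    real (card {\<F>. \<F> \<subseteq> \<Delta> ` {1..r} \<and> loose_family \<F>})
      \<le> C * real r powr (real CARD('d) + 1 - 1 / (real CARD('d) ^ 4 + real CARD('d)))"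
proof -
  obtain B where B: "B \<ge> 0" and bound: "\<forall>r (\<Delta> :: nat \<Rightarrow> (real ^ 'd) set) vtx \<epsilon>. 0 < r \<longrightarrow> 0 < \<epsilon> \<longrightarrow>
    (\<forall>i\<in>{1..r}. \<Delta> i = convex hull (range (vtx i :: 'd option \<Rightarrow> real ^ 'd))) \<longrightarrow>
    (\<forall>H. hyperplane H \<longrightarrow> real (card {i\<in>{1..r}. H \<inter> \<Delta> i \<noteq> {}}) \<le> c * real r powr (1 - 1 / real CARD('d))) \<longrightarrow>
    \<epsilon> * real (card {f :: 'd option \<Rightarrow> nat. \<forall>c. f c \<in> {1..r}}) = real (card {f\<in>{f :: 'd option \<Rightarrow> nat. \<forall>c. f c \<in> {1..r}}. hull_loose (\<lambda>c. vtx (f c))}) \<longrightarrow>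
    \<epsilon> ^ Suc (CARD('d) ^ 3) \<le> B * real r powr (- 1 / real CARD('d))"
    using loose_tuples_density[OF assms, of c] by (elim exE conjE) (rule that)
  let ?d = "real CARD('d)"
  define C where "C = B powr (1 / real (Suc (CARD('d) ^ 3)))"
  have "real (card {\<F>. \<F> \<subseteq> \<Delta> ` {1..r} \<and> loose_family \<F>}) \<le> C * real r powr (?d + 1 - 1 / (?d ^ 4 + ?d))"
    if r: "0 < r" and part: "low_crossing_partition c P r Q \<Delta>" for P :: "(real ^ 'd) set" and r Q \<Delta>
  proof -
    have "\<forall>i. \<exists>v :: 'd option \<Rightarrow> real ^ 'd. i \<in> {1..r} \<longrightarrow> \<Delta> i = convex hull (range v)"
      using part simplex_vertex_enumeration unfolding low_crossing_partition_def simplicial_partition_def by blast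
    from choice[OF this] obtain vtx :: "nat \<Rightarrow> 'd option \<Rightarrow> real ^ 'd"
      where vtx: "\<forall>i. i \<in> {1..r} \<longrightarrow> \<Delta> i = convex hull (range (vtx i))" by (elim exE) (rule that)
    define T where "T = {f :: 'd option \<Rightarrow> nat. \<forall>c. f c \<in> {1..r}}"
    have "T = UNIV \<rightarrow>\<^sub>E {1..r}" by (auto simp: T_def PiE_def)
    then have cT: "card T = r ^ (CARD('d) + 1)" by (simp add: card_PiE card_UNIV_option)
    define L where "L = {f\<in>T. hull_loose (\<lambda>c. vtx (f c))}"
    define \<epsilon> where "\<epsilon> = real (card L) / real (card T)"
    have eq: "\<epsilon> * real (card T) = real (card L)" using r by (simp add: \<epsilon>_def cT)
    have "real (card {\<F>. \<F> \<subseteq> \<Delta> ` {1..r} \<and> loose_family \<F>}) \<le> real (card L)"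
      using card_loose_families[of "{1..r}" \<Delta> vtx] vtx by (simp add: L_def T_def)
    also have "\<dots> = \<epsilon> * real r powr (?d + 1)"
    proof -
      have "real r ^ (CARD('d) + 1) = real r powr (?d + 1)"
        by (subst powr_realpow[symmetric]) (use r in \<open>simp_all add: add.commute\<close>)
      then show ?thesis unfolding eq[symmetric] cT by simp
    qed
    also have "\<dots> \<le> (C * real r powr (- 1 / (?d * real (Suc (CARD('d) ^ 3))))) * real r powr (?d + 1)"
    proof (rule mult_right_mono)
      show "\<epsilon> \<le> C * real r powr (- 1 / (?d * real (Suc (CARD('d) ^ 3))))"
      proof (cases "\<epsilon> > 0")
        case True
        have "\<epsilon> ^ Suc (CARD('d) ^ 3) \<le> B * real r powr (- 1 / ?d)"
        proof (rule bound[THEN spec, THEN spec, THEN spec, THEN spec, THEN mp, THEN mp, THEN mp, THEN mp, THEN mp])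
          show "\<forall>i\<in>{1..r}. \<Delta> i = convex hull (range (vtx i))" using vtx by (intro ballI) simp
          show "\<forall>H. hyperplane H \<longrightarrow> real (card {i\<in>{1..r}. H \<inter> \<Delta> i \<noteq> {}}) \<le> c * real r powr (1 - 1 / real CARD('d))"
            using part unfolding low_crossing_partition_def by (elim conjE)
        qed (use r True eq in \<open>simp_all only: L_def T_def\<close>)
        then show ?thesis unfolding C_def using True B r by (intro powr_bound_of_power_bound) auto
      next
        case False
        moreover have "C * real r powr (- 1 / (?d * real (Suc (CARD('d) ^ 3)))) \<ge> 0" by (simp add: C_def)
        ultimately show ?thesis by linarith
      qed
    qed simp
    also have "\<dots> = C * real r powr (- 1 / (?d * real (Suc (CARD('d) ^ 3))) + (?d + 1))"
      by (simp only: powr_add mult.assoc)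
    also have "?d * real (Suc (CARD('d) ^ 3)) = ?d ^ 4 + ?d"
      by (simp add: power3_eq_cube power4_eq_xxxx algebra_simps)
    finally show ?thesis by (simp add: algebra_simps)
  qed
  then show ?thesis by (intro exI[of _ C] allI impI) (elim conjE)
qed

end
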